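(* Let $u$ be a weak solution of $A_{\mu,p}u=0$ in $\Omega$ and let $x_0\in\Omega$, $R>0$ be such that $B_R(x_0)\subset\Omega$ and $u\geq0$ in $B_R(x_0)$. Then there exists a constant $C=C(N,p,\Sigma,\mu)>0$ such that, for any $0<r<R$ with $r\in(0,1]$, $$\operatorname{Tail}(u_+;x_0,r)\leq C\operatorname*{ess\,sup}_{B_r(x_0)}u+C\left(\frac rR\right)^{\frac p{p-1}}\operatorname{Tail}(u_-;x_0,R).$$
   Context: Let $p\in(1,\infty)$ and let $\Omega\subset\mathbb{R}^N$ be a bounded domain. $\mu$ is a nonnegative finite Borel measure on $[0,1]$, nontrivial on $(0,1)$, with $\mu(\{0\})=0$ and $\alpha:=\mu(\{1\})>0$; $\Sigma:=\operatorname{supp}(\mu)$. $B_r(x_0)$ is the open ball of radius $r$ centered at $x_0$; $u_+:=\max\{u,0\}$, $u_-:=\max\{-u,0\}$. The operator is $A_{\mu,p}u=\int_{(0,1)}(-\Delta)_p^su\,d\mu(s)-\alpha\Delta_pu$ (fractional $p$-Laplacians and the $p$-Laplacian $\Delta_pu=\operatorname{div}(|\nabla u|^{p-2}\nabla u)$); solutions are understood in the weak sense defined below. For $s\in(0,1)$ the normalization constant is $$C_{N,p,s}=\frac{\frac{sp}{2}(1-s)2^{2s-1}}{\pi^{\frac{N-1}{2}}}\,\frac{\Gamma\left(\frac{N+ps}{2}\right)}{\Gamma\left(\frac{p+1}{2}\right)\Gamma(2-s)}.$$ Tail: for $u\in L^{p-1}_{loc}(\mathbb{R}^N)$, $$\operatorname{Tail}(u;x_0,r)=\left[\int_{(0,1)}C_{N,p,s}\,r^{p}\left(\int_{\mathbb{R}^N\setminus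 B_r(x_0)}\frac{|u(y)|^{p-1}}{|y-x_0|^{N+sp}}\,dy\right)d\mu(s)\right]^{\frac1{p-1}}.$$ Tail space: $L^{p-1}_{sp,\mu}(\mathbb{R}^N)=\{u\in L^{p-1}_{loc}(\mathbb{R}^N):\operatorname{Tail}(u;x,r)<\infty\ \forall x\in\mathbb{R}^N,\ \forall r\in(0,\infty)\}$. For a bounded domain $\Omega'$, $W_0^{1,p}(\Omega')=\{v\in W^{1,p}(\Omega'):v=0\text{ in }\mathbb{R}^N\setminus\Omega'\}$. A function $u\in W^{1,p}_{loc}(\Omega)\cap L^{p-1}_{sp,\mu}(\mathbb{R}^N)$ is a weak solution of $A_{\mu,p}u=0$ in $\Omega$ if for every $\Omega'\Subset\Omega$ and every $v\in W_0^{1,p}(\Omega')$ $$\int_{(0,1)}C_{N,p,s}\iint_{\mathbb{R}^{2N}}\frac{|u(x)-u(y)|^{p-2}(u(x)-u(y))(v(x)-v(y))}{|x-y|^{N+sp}}\,dx\,dy\,d\mu(s)+\alpha\int_\Omega|\nabla u|^{p-2}\nabla u\cdot\nabla v\,dx=0.$$ *)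

theory Defs
  imports "HOL-Analysis.Analysis" "HOL-Probability.Essential_Supremum"
begin

text \<open>
  Functions are representatives of their almost-everywhere classes for \<^const>\<open>lebesgue\<close>.
  All powers use \<open>0 powr t = 0\<close>, also for \<open>t \<le> 0\<close>; this is harmless in products such as
  \<open>\<bar>a\<bar> powr (p - 2) * a\<close>.
\<close>

primrec C_k :: "nat \<Rightarrow> ('a::euclidean_space \<Rightarrow> real) \<Rightarrow> bool" where
  "C_k 0 f \<longleftrightarrow> continuous_on UNIV f"
| "C_k (Suc k) f \<longleftrightarrow>
     (\<forall>x. f differentiable (at x)) \<and> (\<forall>b\<in>Basis. C_k k (\<lambda>x. frechet_derivative f (at x) b))"

definition test_function :: "('a::euclidean_space) set \<Rightarrow> ('a \<Rightarrow> real) \<Rightarrow> bool" where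
  "test_function \<Omega> \<phi> \<longleftrightarrow>
     (\<forall>k. C_k k \<phi>) \<and> compact (closure {x. \<phi> x \<noteq> 0}) \<and> closure {x. \<phi> x \<noteq> 0} \<subseteq> \<Omega>"

definition L_p :: "real \<Rightarrow> ('a::euclidean_space) set \<Rightarrow> ('a \<Rightarrow> 'b::euclidean_space) \<Rightarrow> bool" where
  "L_p q \<Omega> f \<longleftrightarrow>
     f \<in> borel_measurable (lebesgue_on \<Omega>) \<and>
     integrable (lebesgue_on \<Omega>) (\<lambda>x. norm (f x) powr q)"

definition L_p_loc :: "real \<Rightarrow> ('a::euclidean_space) set \<Rightarrow> ('a \<Rightarrow> 'b::euclidean_space) \<Rightarrow> bool" where
  "L_p_loc q \<Omega> f \<longleftrightarrow>
     f \<in> borel_measurable (lebesgue_on \<Omega>) \<and> (\<forall>K. compact K \<and> K \<subseteq> \<Omega> \<longrightarrow> L_p q K f)"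

definition has_weak_gradient ::
  "('a::euclidean_space) set \<Rightarrow> ('a \<Rightarrow> real) \<Rightarrow> ('a \<Rightarrow> 'a) \<Rightarrow> bool" where
  "has_weak_gradient \<Omega> u G \<longleftrightarrow>
     L_p_loc 1 \<Omega> u \<and> L_p_loc 1 \<Omega> G \<and>
     (\<forall>\<phi>. test_function \<Omega> \<phi> \<longrightarrow>
       (\<forall>b\<in>Basis. (LINT x|lebesgue_on \<Omega>. u x * frechet_derivative \<phi> (at x) b) =
                  - (LINT x|lebesgue_on \<Omega>. (G x \<bullet> b) * \<phi> x)))"

definition W1p :: "real \<Rightarrow> ('a::euclidean_space) set \<Rightarrow> ('a \<Rightarrow> real) set" where
  "W1p p \<Omega> = {u. L_p p \<Omega> u \<and> (\<exists>G. has_weak_gradient \<Omega> u G \<and> L_p p \<Omega> G)}"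

definition W1p_loc :: "real \<Rightarrow> ('a::euclidean_space) set \<Rightarrow> ('a \<Rightarrow> real) set" where
  "W1p_loc p \<Omega> = {u. L_p_loc p \<Omega> u \<and> (\<exists>G. has_weak_gradient \<Omega> u G \<and> L_p_loc p \<Omega> G)}"

text \<open>
  The space of Sobolev functions that vanish outside \<open>\<Omega>\<close>. The weak derivative is required on
  the whole space, so that the vanishing is also a boundary condition (the indicator
  of \<open>\<Omega>\<close> is excluded) and the gradient of \<open>v\<close> is defined everywhere.
\<close>

definition W1p_0 :: "real \<Rightarrow> ('a::euclidean_space) set \<Rightarrow> ('a \<Rightarrow> real) set" where
  "W1p_0 p \<Omega> = {v \<in> W1p p UNIV. AE x in lebesgue. x \<notin> \<Omega> \<longrightarrow> v x = 0}"

definition C_Nps :: "nat \<Rightarrow> real \<Rightarrow> real \<Rightarrow> real" where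
  "C_Nps N p s =
     (s * p / 2 * (1 - s) * 2 powr (2 * s - 1)) / pi powr ((real N - 1) / 2) *
     (Gamma ((real N + p * s) / 2) / (Gamma ((p + 1) / 2) * Gamma (2 - s)))"

text \<open>The tail is extended-valued: finiteness is what the tail space below demands.\<close>

definition Tail_integral ::
  "real measure \<Rightarrow> real \<Rightarrow> (('a::euclidean_space) \<Rightarrow> real) \<Rightarrow> 'a \<Rightarrow> real \<Rightarrow> ennreal" where
  "Tail_integral \<mu> p u x0 r =
     (\<integral>\<^sup>+s\<in>{0<..<1}.
        ennreal (C_Nps DIM('a) p s * r powr p) *
        (\<integral>\<^sup>+y\<in>- ball x0 r.
           ennreal (\<bar>u y\<bar> powr (p - 1) / norm (y - x0) powr (real DIM('a) + s * p)) \<partial>lebesgue)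
      \<partial>\<mu>)"

definition Tail ::
  "real measure \<Rightarrow> real \<Rightarrow> (('a::euclidean_space) \<Rightarrow> real) \<Rightarrow> 'a \<Rightarrow> real \<Rightarrow> ereal" where
  "Tail \<mu> p u x0 r =
     (if Tail_integral \<mu> p u x0 r = \<infinity> then \<infinity>
      else ereal (enn2real (Tail_integral \<mu> p u x0 r) powr (1 / (p - 1))))"

definition tail_space :: "real measure \<Rightarrow> real \<Rightarrow> (('a::euclidean_space) \<Rightarrow> real) set" where
  "tail_space \<mu> p = {u. L_p_loc (p - 1) UNIV u \<and> (\<forall>x. \<forall>r>0. Tail \<mu> p u x r < \<infinity>)}"

definition nonlocal_form ::
  "real measure \<Rightarrow> real \<Rightarrow> (('a::euclidean_space) \<Rightarrow> real) \<Rightarrow> ('a \<Rightarrow> real) \<Rightarrow> real" where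
  "nonlocal_form \<mu> p u v =
     (LINT s:{0<..<1}|\<mu>. C_Nps DIM('a) p s *
        (LINT (x, y)|(lebesgue :: ('a \<times> 'a) measure).
           \<bar>u x - u y\<bar> powr (p - 2) * (u x - u y) * (v x - v y) /
             norm (x - y) powr (real DIM('a) + s * p)))"

text \<open>Weak gradients are unique up to null sets, so it does not matter which \<open>G\<close> and \<open>H\<close> are used.\<close>

definition weak_solution ::
  "real measure \<Rightarrow> real \<Rightarrow> ('a::euclidean_space) set \<Rightarrow> ('a \<Rightarrow> real) \<Rightarrow> bool" where
  "weak_solution \<mu> p \<Omega> u \<longleftrightarrow>
     u \<in> W1p_loc p \<Omega> \<and> u \<in> tail_space \<mu> p \<and>
     (\<forall>\<Omega>' v G H.
        open \<Omega>' \<and> connected \<Omega>' \<and> bounded \<Omega>' \<and> closure \<Omega>' \<subseteq> \<Omega> \<and> v \<in> W1p_0 p \<Omega>' \<and>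
        has_weak_gradient \<Omega> u G \<and> has_weak_gradient UNIV v H \<longrightarrow>
        nonlocal_form \<mu> p u v +
          measure \<mu> {1} * (LINT x|lebesgue_on \<Omega>. norm (G x) powr (p - 2) * (G x \<bullet> H x)) = 0)"

end

theory Submission
  imports Defs
begin

text \<open>
  Let \<open>k > 0\<close> be an upper bound of \<open>u\<close> on \<open>B\<^sub>r\<close>. The equation is tested with \<open>v = (u - 2k) \<eta>\<close>, where
  \<open>\<eta>\<close> is a smooth radial cutoff that vanishes outside \<open>B\<^bsub>r/2\<^esub>\<close>. On \<open>B\<^sub>r\<close> the factor \<open>u - 2k\<close> lies between
  \<open>-2k\<close> and \<open>-k\<close>. So a point \<open>y\<close> outside \<open>B\<^sub>r\<close> at which \<open>u\<close> is large contributes to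
  \<open>\<bar>u x - u y\<bar>\<^bsup>p-2\<^esup> (u x - u y) v x\<close> a positive amount of order \<open>k (u y)\<^sub>+\<^bsup>p-1\<^esup>\<close>, and these
  contributions add up to at least a constant times \<open>k r\<^bsup>N-p\<^esup>\<close> and the \<open>(p-1)\<close>-st power of the
  tail of \<open>u\<^sub>+\<close>. Since the
  whole sum is zero, that tail is controlled by the negative contributions, of which there are three:
  points outside the ball where \<open>u\<close> is small or negative (\<open>pair_form_cross_ge\<close>); they give
  \<open>k\<^sup>p r\<^bsup>N-p\<^esup>\<close> and the tail of \<open>u\<^sub>-\<close>, which only sees the complement of \<open>B\<^sub>R\<close>; pairs of points
  inside \<open>B\<^sub>r\<close> (\<open>pair_form_near_ge\<close>) and the gradient term (\<open>local_form_ge\<close>), for which the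
  Caccioppoli argument again gives \<open>k\<^sup>p r\<^bsup>N-p\<^esup>\<close>. Dividing by \<open>k r\<^bsup>N-p\<^esup>\<close> and letting \<open>k\<close>
  decrease to the essential supremum gives the claim.

  The constant does not depend on the order \<open>s\<close>. The kernel integrals over the inner and the outer
  region grow like \<open>1/(1-s)\<close> and \<open>1/s\<close> (\<open>nn_integral_near_kernel\<close>, \<open>nn_integral_far_kernel\<close>), and
  the normalization constant carries the compensating factor \<open>s (1-s)\<close> (\<open>C_Nps_bounded\<close>). The
  factor \<open>r\<^bsup>-sp\<^esup>\<close> is at most \<open>r\<^bsup>-p\<^esup>\<close> because \<open>r \<le> 1\<close>.

  An inequality between integrands yields one between integrals only if the nonlocal form
  converges absolutely. Near the diagonal this is the embedding of \<open>W\<^bsup>1,p\<^esup>\<close> into \<open>W\<^bsup>s,p\<^esup>\<close>. It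
  rests on the identity \<open>u(x + h) - u(x) = \<integral>\<^sub>0\<^sup>1 \<nabla>u(x + t h) \<bullet> h dt\<close> for almost every \<open>x\<close>
  (\<open>weak_derivative_difference\<close>), which follows from the definition of the weak gradient, from
  Fubini's theorem and from the fundamental lemma of the calculus of variations. Away from the
  diagonal the finiteness of the tail is used.
\<close>

section \<open>Smooth functions\<close>

lemma C_k_Suc_imp_C_k: "C_k (Suc k) f \<Longrightarrow> C_k k f"
proof (induction k arbitrary: f)
  case 0
  then show ?case
    by (auto simp: continuous_on_eq_continuous_at intro: differentiable_imp_continuous_within)
next
  case (Suc k)
  then show ?case by (metis C_k.simps(2))
qed

lemma C_k_const: "C_k k (\<lambda>x. c)"
proof (induction k arbitrary: c)
  case (Suc k)
  then show ?case by (simp add: frechet_derivative_const)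
qed simp

lemma frechet_derivative_add:
  fixes f g :: "'a::euclidean_space \<Rightarrow> real"
  assumes "f differentiable (at x)" "g differentiable (at x)"
  shows "frechet_derivative (\<lambda>x. f x + g x) (at x) = (\<lambda>h. frechet_derivative f (at x) h + frechet_derivative g (at x) h)"
  using assms unfolding frechet_derivative_works
  by (intro frechet_derivative_at[symmetric] has_derivative_add) 

lemma frechet_derivative_mult:
  fixes f g :: "'a::euclidean_space \<Rightarrow> real"
  assumes "f differentiable (at x)" "g differentiable (at x)"
  shows "frechet_derivative (\<lambda>x. f x * g x) (at x)
    = (\<lambda>h. f x * frechet_derivative g (at x) h + frechet_derivative f (at x) h * g x)"
  using assms unfolding frechet_derivative_works
  by (intro frechet_derivative_at[symmetric] has_derivative_mult) 

lemma C_k_add: "C_k k f \<Longrightarrow> C_k k g \<Longrightarrow> C_k k (\<lambda>x. f x + g x)"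
proof (induction k arbitrary: f g)
  case 0
  then show ?case by (auto intro: continuous_intros)
next
  case (Suc k)
  then show ?case by (auto simp: frechet_derivative_add intro: differentiable_add)
qed

lemma C_k_mult: "C_k k f \<Longrightarrow> C_k k g \<Longrightarrow> C_k k (\<lambda>x. f x * g x)"
proof (induction k arbitrary: f g)
  case 0
  then show ?case by (auto intro: continuous_intros)
next
  case (Suc k)
  have "C_k k f" "C_k k g" using Suc.prems C_k_Suc_imp_C_k by blast+
  with Suc show ?case
    by (auto simp: frechet_derivative_mult intro!: C_k_add Suc.IH differentiable_mult)
qed

lemma C_k_sum: "(\<And>i. i \<in> A \<Longrightarrow> C_k k (f i)) \<Longrightarrow> C_k k (\<lambda>x. \<Sum>i\<in>A. f i x)"
  by (induction A rule: infinite_finite_induct) (auto intro: C_k_const C_k_add)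

lemma C_k_prod: "(\<And>i. i \<in> A \<Longrightarrow> C_k k (f i)) \<Longrightarrow> C_k k (\<lambda>x. \<Prod>i\<in>A. f i x)"
  by (induction A rule: infinite_finite_induct) (auto intro: C_k_const C_k_mult)

lemma C_k_inner_left: "C_k k (\<lambda>x. x \<bullet> b)"
proof (cases k)
  case (Suc j)
  have d: "((\<lambda>x. x \<bullet> b) has_derivative (\<lambda>h. h \<bullet> b)) (at x)" for x :: 'a
    by (auto intro!: derivative_eq_intros)
  have "frechet_derivative (\<lambda>x. x \<bullet> b) (at x) c = c \<bullet> b" for x c :: 'a
    using frechet_derivative_at[OF d] by metis
  then show ?thesis
    unfolding Suc using d by (auto simp: C_k_const differentiable_def)
qed (auto intro: continuous_intros)

lemma has_derivative_frechet_shift: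
  fixes f :: "'a::euclidean_space \<Rightarrow> real"
  assumes "f differentiable (at (x - a))"
  shows "((\<lambda>x. f (x - a)) has_derivative frechet_derivative f (at (x - a))) (at x)"
proof -
  have "((\<lambda>x. f (x - a)) has_derivative (\<lambda>h. frechet_derivative f (at (x - a)) h)) (at x)"
    using assms unfolding frechet_derivative_works
    by (intro has_derivative_compose[where f = "\<lambda>x. x - a" and g = f and f' = "\<lambda>h. h", simplified o_def])
       (auto intro!: derivative_eq_intros)
  then show ?thesis by simp
qed

lemma C_k_shift:
  fixes f :: "'a::euclidean_space \<Rightarrow> real"
  shows "C_k k f \<Longrightarrow> C_k k (\<lambda>x. f (x - a))"
proof (induction k arbitrary: f)
  case 0
  then show ?case by (auto intro!: continuous_intros elim: continuous_on_compose2)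
next
  case (Suc k)
  then have d: "f differentiable (at x)" for x by simp
  note s = has_derivative_frechet_shift[OF d]
  from Suc show ?case
    by (auto simp: frechet_derivative_at[OF s, symmetric] differentiable_def intro!: s exI)
qed

text \<open>The functions \<open>t \<mapsto> t\<^sup>-\<^sup>n exp (-1/t)\<close>, extended by zero to the left half-line. All
  derivatives of \<open>exp (-1/t)\<close> are linear combinations of them, so the whole family is needed to
  run the induction that proves smoothness.\<close>

definition flat :: "nat \<Rightarrow> real \<Rightarrow> real" where
  "flat n t = (if 0 < t then (1/t)^n * exp (- (1/t)) else 0)"

lemma flat_nonneg [simp]: "0 \<le> flat n t"
  by (simp add: flat_def)

lemma flat_0_le_1: "flat 0 t \<le> 1"
  by (simp add: flat_def)

lemma flat_tendsto_0: "(flat n \<longlongrightarrow> 0) (at 0)"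
proof -
  have "((\<lambda>x::real. x ^ n / exp x) \<longlongrightarrow> 0) at_top" by (rule tendsto_power_div_exp_0)
  then have "((\<lambda>t::real. (inverse t) ^ n / exp (inverse t)) \<longlongrightarrow> 0) (at_right 0)"
    by (rule filterlim_compose) (rule filterlim_inverse_at_top_right)
  then have R: "(flat n \<longlongrightarrow> 0) (at_right 0)"
    by (rule Lim_transform_eventually)
       (auto simp: flat_def eventually_at_filter exp_minus field_simps)
  have L: "(flat n \<longlongrightarrow> 0) (at_left 0)"
    by (rule tendsto_eventually) (auto simp: flat_def eventually_at_filter)
  from L R show ?thesis by (simp add: filterlim_split_at)
qed

lemma flat_has_derivative: "(flat n has_field_derivative flat (n + 2) t - real n * flat (n + 1) t) (at t)"
proof -
  consider "t > 0" | "t < 0" | "t = 0" by linarith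
  then show ?thesis
  proof cases
    case 1
    have q: "((\<lambda>t. 1/t) has_field_derivative - (1 / t^2)) (at t)"
      using 1 by (auto intro!: derivative_eq_intros simp: power2_eq_square)
    have "real n * (1/t)^(n - Suc 0) * (1 / t^2) = real n * (1/t)^(n + 1)"
      by (cases n) (auto simp: power2_eq_square)
    then have "((\<lambda>t. (1/t)^n * exp (- (1/t))) has_field_derivative flat (n + 2) t - real n * flat (n + 1) t) (at t)"
      using 1 by (intro DERIV_cong[OF DERIV_mult[OF DERIV_power[OF q] DERIV_fun_exp[OF DERIV_minus[OF q]]]])
        (simp add: flat_def power_add power2_eq_square algebra_simps)
    then show ?thesis
      by (rule has_field_derivative_transform_within_open[where S = "{0<..}"]) (use 1 in \<open>auto simp: flat_def\<close>)
  next
    case 2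
    have "((\<lambda>t. 0) has_field_derivative flat (n + 2) t - real n * flat (n + 1) t) (at t)"
      using 2 by (auto intro!: derivative_eq_intros simp: flat_def)
    then show ?thesis
      by (rule has_field_derivative_transform_within_open[where S = "{..<0}"]) (use 2 in \<open>auto simp: flat_def\<close>)
  next
    case 3
    have "((\<lambda>y. (flat n y - flat n 0) / (y - 0)) \<longlongrightarrow> 0) (at 0)"
      by (rule Lim_transform_eventually[OF flat_tendsto_0[of "Suc n"]])
         (auto simp: flat_def eventually_at_filter)
    then show ?thesis using 3 by (simp add: has_field_derivative_iff flat_def)
  qed
qed

lemma continuous_on_flat: "continuous_on S (flat n)"
  by (meson DERIV_isCont continuous_at_imp_continuous_on flat_has_derivative)

lemma flat_compose_has_derivative:
  fixes g :: "'a::euclidean_space \<Rightarrow> real"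
  assumes "g differentiable (at x)"
  shows "((\<lambda>x. flat n (g x)) has_derivative
    (\<lambda>h. (flat (n + 2) (g x) - real n * flat (n + 1) (g x)) * frechet_derivative g (at x) h)) (at x)"
  using has_derivative_compose[OF assms[unfolded frechet_derivative_works]
      flat_has_derivative[unfolded has_field_derivative_def, of n "g x"]]
  by simp

text \<open>Differentiating \<open>flat n \<circ> g\<close> produces \<open>flat (n + 1) \<circ> g\<close> and \<open>flat (n + 2) \<circ> g\<close>, so the induction
  on the smoothness order has to treat all \<open>n\<close> at once.\<close>

lemma C_k_flat_compose:
  fixes g :: "'a::euclidean_space \<Rightarrow> real"
  assumes "\<And>k. C_k k g"
  shows "C_k k (\<lambda>x. flat n (g x))"
proof (induction k arbitrary: n)
  case 0
  have "continuous_on UNIV g" using assms[of 0] by simp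
  then show ?case by (auto intro: continuous_on_compose2[OF continuous_on_flat[of UNIV]])
next
  case (Suc k)
  have d: "g differentiable (at x)" for x using assms[of "Suc 0"] by simp
  note s = flat_compose_has_derivative[OF d]
  have "C_k k (\<lambda>x. (flat (n + 2) (g x) - real n * flat (n + 1) (g x)) * frechet_derivative g (at x) b)"
    if "b \<in> Basis" for b
  proof (rule C_k_mult)
    show "C_k k (\<lambda>x. flat (n + 2) (g x) - real n * flat (n + 1) (g x))"
      using C_k_add[OF Suc C_k_mult[OF C_k_const[of k "- real n"] Suc], of "n+2" "n+1"] by simp
    show "C_k k (\<lambda>x. frechet_derivative g (at x) b)" using assms[of "Suc k"] that by simp
  qed
  then show ?case
    by (auto simp: frechet_derivative_at[OF s, symmetric] differentiable_def intro!: s exI)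
qed

text \<open>As \<open>n\<close> grows these bumps increase to the indicator of the box. Boxes, unlike balls, form an
  intersection-stable generator of the Borel sets.\<close>

definition box_bump :: "'a::euclidean_space \<Rightarrow> 'a \<Rightarrow> nat \<Rightarrow> 'a \<Rightarrow> real" where
  "box_bump a c n x =
     (\<Prod>b\<in>Basis. flat 0 (real n * (x \<bullet> b - a \<bullet> b)) * flat 0 (real n * (c \<bullet> b - x \<bullet> b)))"

lemma C_k_diff: "C_k k f \<Longrightarrow> C_k k g \<Longrightarrow> C_k k (\<lambda>x. f x - g x)"
  using C_k_add[OF _ C_k_mult[OF C_k_const[of k "-1"]], of f g] by simp

lemma C_k_box_bump: "C_k k (box_bump a c n)"
  unfolding box_bump_def
  by (intro C_k_prod C_k_mult C_k_flat_compose C_k_diff C_k_const C_k_inner_left)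

lemma box_bump_bounds: "0 \<le> box_bump a c n x" "box_bump a c n x \<le> 1"
  unfolding box_bump_def
  by (auto intro!: prod_nonneg prod_le_1 mult_le_one simp: flat_0_le_1)

lemma box_bump_nonzero_iff: "n > 0 \<Longrightarrow> box_bump a c n x \<noteq> 0 \<longleftrightarrow> x \<in> box a c"
  by (auto simp: box_bump_def mem_box flat_def zero_less_mult_iff)

lemma box_bump_tendsto:
  fixes x :: "'a::euclidean_space"
  shows "(\<lambda>n. box_bump a c (Suc n) x) \<longlonglongrightarrow> indicator (box a c) x"
proof (cases "x \<in> box a c")
  case True
  have *: "(\<lambda>n. flat 0 (real (Suc n) * d)) \<longlonglongrightarrow> 1" if "d > 0" for d
  proof -
    have "(\<lambda>n. exp (- (1 / real (Suc n) * (1 / d)))) \<longlonglongrightarrow> exp (- (0 * (1 / d)))"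
      by (intro tendsto_intros lim_1_over_n[THEN LIMSEQ_Suc])
    then show ?thesis using that by (simp add: flat_def zero_less_mult_iff mult.commute)
  qed
  have "(\<lambda>n. box_bump a c (Suc n) x) \<longlonglongrightarrow> (\<Prod>b\<in>(Basis :: 'a set). 1 * 1)"
    unfolding box_bump_def
    by (intro tendsto_prod tendsto_mult *) (use True in \<open>auto simp: mem_box\<close>)
  then show ?thesis using True by simp
next
  case False
  then have "box_bump a c (Suc n) x = 0" for n using box_bump_nonzero_iff[of "Suc n"] by blast
  then show ?thesis using False by simp
qed

lemma test_function_box_bump:
  assumes "cbox a c \<subseteq> S" "n > 0"
  shows "test_function S (box_bump a c n)"
proof -
  have "closure {x. box_bump a c n x \<noteq> 0} \<subseteq> cbox a c"
    using box_bump_nonzero_iff[OF assms(2), of a c] by (intro closure_minimal) (auto simp: mem_box less_imp_le)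
  moreover from this have "bounded (closure {x. box_bump a c n x \<noteq> 0})"
    using bounded_cbox bounded_subset by blast
  ultimately show ?thesis
    unfolding test_function_def using assms(1)
    by (auto simp: C_k_box_bump compact_eq_bounded_closed)
qed

lemma test_function_mono: "test_function S \<phi> \<Longrightarrow> S \<subseteq> T \<Longrightarrow> test_function T \<phi>"
  by (auto simp: test_function_def)

lemma test_function_mult:
  assumes "test_function S \<phi>" "test_function T \<psi>"
  shows "test_function (S \<inter> T) (\<lambda>x. \<phi> x * \<psi> x)"
proof -
  have c: "closure {x. \<phi> x * \<psi> x \<noteq> 0} \<subseteq> closure {x. \<phi> x \<noteq> 0} \<inter> closure {x. \<psi> x \<noteq> 0}"
    by (intro Int_greatest closure_mono) auto
  then have "compact (closure {x. \<phi> x * \<psi> x \<noteq> 0})"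
    using assms unfolding test_function_def
    by (meson Int_lower1 bounded_subset closed_closure compact_eq_bounded_closed subset_trans)
  with c show ?thesis using assms by (auto simp: test_function_def intro!: C_k_mult)
qed

lemma test_function_shift:
  fixes \<phi> :: "'a::euclidean_space \<Rightarrow> real"
  assumes \<phi>: "test_function S \<phi>" and T: "(\<lambda>x. x + a) ` closure {x. \<phi> x \<noteq> 0} \<subseteq> T"
  shows "test_function T (\<lambda>x. \<phi> (x - a))"
proof -
  have "{x. \<phi> (x - a) \<noteq> 0} = (\<lambda>x. a + x) ` {x. \<phi> x \<noteq> 0}"
    by (force simp: image_iff)
  then have "closure {x. \<phi> (x - a) \<noteq> 0} = (\<lambda>x. a + x) ` closure {x. \<phi> x \<noteq> 0}"
    by (simp add: closure_translation)
  moreover have "(\<lambda>x. a + x) = (\<lambda>x. x + a)" by (auto simp: add.commute)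
  ultimately show ?thesis using \<phi> T
    by (auto simp: test_function_def C_k_shift intro!: compact_continuous_image continuous_intros)
qed

context
  fixes S :: "'a::euclidean_space set" and \<phi> :: "'a \<Rightarrow> real"
  assumes \<phi>: "test_function S \<phi>"
begin

lemma test_function_differentiable: "\<phi> differentiable (at x)"
  using \<phi> unfolding test_function_def by (metis C_k.simps(2))

lemma test_function_has_derivative: "(\<phi> has_derivative frechet_derivative \<phi> (at x)) (at x)"
  using test_function_differentiable frechet_derivative_works by blast

lemma test_function_linear: "linear (frechet_derivative \<phi> (at x))"
  using test_function_has_derivative by (rule has_derivative_linear)

lemma test_function_derivative_eq_sum:
  "frechet_derivative \<phi> (at x) h = (\<Sum>b\<in>Basis. (h \<bullet> b) * frechet_derivative \<phi> (at x) b)"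
proof -
  have "frechet_derivative \<phi> (at x) h = frechet_derivative \<phi> (at x) (\<Sum>b\<in>Basis. (h \<bullet> b) *\<^sub>R b)"
    by (simp add: euclidean_representation)
  also have "\<dots> = (\<Sum>b\<in>Basis. (h \<bullet> b) * frechet_derivative \<phi> (at x) b)"
    using test_function_linear by (simp add: linear_sum linear_scale)
  finally show ?thesis .
qed

lemma continuous_on_test_function: "continuous_on A \<phi>"
  using \<phi> unfolding test_function_def by (metis C_k.simps(1) continuous_on_subset subset_UNIV)

lemma continuous_on_test_function_derivative: "continuous_on A (\<lambda>x. frechet_derivative \<phi> (at x) h)"
proof -
  have "continuous_on UNIV (\<lambda>x. frechet_derivative \<phi> (at x) b)" if "b \<in> Basis" for b
    using \<phi> that unfolding test_function_def by (metis C_k.simps)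
  then have "continuous_on UNIV (\<lambda>x. \<Sum>b\<in>Basis. (h \<bullet> b) * frechet_derivative \<phi> (at x) b)"
    by (intro continuous_intros)
  then show ?thesis by (subst test_function_derivative_eq_sum) (auto intro: continuous_on_subset)
qed

lemma test_function_zero: "x \<notin> closure {x. \<phi> x \<noteq> 0} \<Longrightarrow> \<phi> x = 0"
  using closure_subset[of "{x. \<phi> x \<noteq> 0}"] by auto

lemma test_function_derivative_zero:
  assumes "x \<notin> closure {x. \<phi> x \<noteq> 0}" shows "frechet_derivative \<phi> (at x) h = 0"
proof -
  have "((\<lambda>x. 0) has_derivative (\<lambda>h. 0)) (at x)" by simp
  then have "(\<phi> has_derivative (\<lambda>h. 0)) (at x)"
    by (rule has_derivative_transform_within_open[where s = "- closure {x. \<phi> x \<noteq> 0}"])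
       (use assms in \<open>auto dest: test_function_zero[symmetric]\<close>)
  from frechet_derivative_at[OF this] show ?thesis by metis
qed

lemma test_function_bounded: "\<exists>M>0. \<forall>x. \<bar>\<phi> x\<bar> \<le> M"
  and test_function_derivative_bounded: "\<exists>M>0. \<forall>x. \<bar>frechet_derivative \<phi> (at x) h\<bar> \<le> M"
proof -
  let ?K = "closure {x. \<phi> x \<noteq> 0}"
  have *: "\<exists>M>0. \<forall>x. \<bar>f x\<bar> \<le> M" if c: "continuous_on ?K f" and z: "\<And>x. x \<notin> ?K \<Longrightarrow> f x = 0" for f :: "'a \<Rightarrow> real"
  proof -
    have "compact (f ` ?K)" using \<phi> c by (auto simp: test_function_def intro: compact_continuous_image)
    then obtain M where "M > 0" "\<And>x. x \<in> ?K \<Longrightarrow> \<bar>f x\<bar> \<le> M"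
      using compact_imp_bounded bounded_pos by (metis imageI real_norm_def)
    then show ?thesis using z by (metis abs_zero less_imp_le)
  qed
  show "\<exists>M>0. \<forall>x. \<bar>\<phi> x\<bar> \<le> M"
    by (rule *[OF continuous_on_test_function test_function_zero])
  show "\<exists>M>0. \<forall>x. \<bar>frechet_derivative \<phi> (at x) h\<bar> \<le> M"
    by (rule *[OF continuous_on_test_function_derivative test_function_derivative_zero])
qed

lemma borel_measurable_test_function [measurable]: "\<phi> \<in> borel_measurable borel"
  using continuous_on_test_function by (rule borel_measurable_continuous_onI)

lemma borel_measurable_test_function_derivative [measurable]:
  "(\<lambda>x. frechet_derivative \<phi> (at x) h) \<in> borel_measurable borel"
  using continuous_on_test_function_derivative by (rule borel_measurable_continuous_onI)

end

section \<open>The fundamental lemma of the calculus of variations\<close>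

text \<open>The positive and the negative part of \<open>f\<close> are densities of two measures that agree on an
  intersection-stable generator, so the measures coincide, and a density is determined almost everywhere.\<close>

lemma AE_zero_if_box_integrals_zero:
  fixes f :: "'a::euclidean_space \<Rightarrow> real"
  assumes f: "integrable lborel f"
    and zero: "\<And>a c. (LINT x|lborel. indicator (box a c) x * f x) = 0"
  shows "AE x in lborel. f x = 0"
proof -
  have [measurable]: "f \<in> borel_measurable borel" using f by simp
  let ?M = "density lborel (\<lambda>x. ennreal (f x))" and ?N = "density lborel (\<lambda>x. ennreal (- f x))"
  have fin: "(\<integral>\<^sup>+x. ennreal (f x) * indicator A x \<partial>lborel) < \<infinity>" for A
  proof -
    have "(\<integral>\<^sup>+x. ennreal (f x) * indicator A x \<partial>lborel) \<le> (\<integral>\<^sup>+x. ennreal (norm (f x)) \<partial>lborel)"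
      by (intro nn_integral_mono) (auto split: split_indicator intro: ennreal_leI)
    also have "\<dots> < \<infinity>" using f by (simp add: integrable_iff_bounded)
    finally show ?thesis .
  qed
  have "?M = ?N"
  proof (rule measure_eqI_generator_eq)
    let ?E = "range (\<lambda>(a, b). box a b::'a set)"
    show "Int_stable ?E" by (auto simp: Int_stable_def box_Int_box)
    show "?E \<subseteq> Pow UNIV" "sets ?M = sigma_sets UNIV ?E" "sets ?N = sigma_sets UNIV ?E"
      by (simp_all add: borel_eq_box)
    let ?A = "\<lambda>n::nat. box (- (real n *\<^sub>R One)) (real n *\<^sub>R One) :: 'a set"
    show "range ?A \<subseteq> ?E" "(\<Union>i. ?A i) = UNIV" unfolding UN_box_eq_UNIV by auto
    show "emeasure ?M (?A i) \<noteq> \<infinity>" for i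
      using fin[of "?A i"] by (simp add: emeasure_density)
    show "emeasure ?M X = emeasure ?N X" if "X \<in> ?E" for X
    proof -
      from that obtain a c where X: "X = box a c" by auto
      let ?g = "\<lambda>x. indicator (box a c) x * f x"
      have g: "integrable lborel ?g"
        using integrable_mult_indicator[OF _ f, of "box a c"] by simp
      have *: "(\<integral>\<^sup>+x. ennreal (?g x) \<partial>lborel) < \<infinity>" "(\<integral>\<^sup>+x. ennreal (- ?g x) \<partial>lborel) < \<infinity>"
        using g by (auto simp: real_integrable_def less_top)
      have "enn2real (\<integral>\<^sup>+x. ennreal (?g x) \<partial>lborel) = enn2real (\<integral>\<^sup>+x. ennreal (- ?g x) \<partial>lborel)"
        using zero[of a c] g by (simp add: real_lebesgue_integral_def)
      then have "(\<integral>\<^sup>+x. ennreal (?g x) \<partial>lborel) = (\<integral>\<^sup>+x. ennreal (- ?g x) \<partial>lborel)"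
        using * by (metis ennreal_enn2real infinity_ennreal_def)
      moreover have "(\<integral>\<^sup>+x. ennreal (?g x) \<partial>lborel) = (\<integral>\<^sup>+x. ennreal (f x) * indicator X x \<partial>lborel)"
        "(\<integral>\<^sup>+x. ennreal (- ?g x) \<partial>lborel) = (\<integral>\<^sup>+x. ennreal (- f x) * indicator X x \<partial>lborel)"
        by (auto intro!: nn_integral_cong simp: X split: split_indicator)
      ultimately show ?thesis by (simp add: emeasure_density X)
    qed
  qed
  then have "AE x in lborel. ennreal (f x) = ennreal (- f x)"
    by (intro sigma_finite_measure.density_unique[OF sigma_finite_lborel]) auto
  then show ?thesis
  proof eventually_elim
    case (elim x)
    show ?case
    proof (cases "0 \<le> f x")
      case True
      then have "ennreal (f x) = 0" using elim by (simp add: ennreal_neg)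
      then show ?thesis using True by simp
    next
      case False
      then have "ennreal (- f x) = 0" using elim by (simp add: ennreal_neg)
      then show ?thesis using False by simp
    qed
  qed
qed

text \<open>Box bumps converge boundedly to the indicator of a box whose closure lies in \<open>S\<close>, so \<open>f\<close>
  integrates to zero over all boxes inside a fixed one, and countably many closed boxes exhaust \<open>S\<close>.\<close>

lemma AE_zero_if_test_integrals_zero:
  fixes f :: "'a::euclidean_space \<Rightarrow> real"
  assumes f: "integrable lborel f" and S: "open S"
    and zero: "\<And>\<phi>. test_function S \<phi> \<Longrightarrow> (LINT x|lborel. f x * \<phi> x) = 0"
  shows "AE x in lborel. x \<in> S \<longrightarrow> f x = 0"
proof -
  have [measurable]: "f \<in> borel_measurable borel" using f by simp
  have *: "(LINT x|lborel. indicator (box a c) x * f x) = 0" if "cbox a c \<subseteq> S" for a c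
  proof -
    have "(\<lambda>n. LINT x|lborel. f x * box_bump a c (Suc n) x) \<longlonglongrightarrow> (LINT x|lborel. f x * indicator (box a c) x)"
    proof (rule integral_dominated_convergence[where w = "\<lambda>x. norm (f x)"])
      have "test_function S (box_bump a c (Suc n))" for n using that by (simp add: test_function_box_bump)
      note [measurable] = borel_measurable_test_function[OF this]
      show "(\<lambda>x. f x * box_bump a c (Suc n) x) \<in> borel_measurable lborel" for n by simp
      show "AE x in lborel. (\<lambda>n. f x * box_bump a c (Suc n) x) \<longlonglongrightarrow> f x * indicator (box a c) x"
        by (intro AE_I2 tendsto_intros box_bump_tendsto)
      show "AE x in lborel. norm (f x * box_bump a c (Suc n) x) \<le> norm (f x)" for n
        by (intro AE_I2) (auto simp: abs_mult box_bump_bounds intro!: mult_left_le)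
    qed (use f in auto)
    moreover have "(LINT x|lborel. f x * box_bump a c (Suc n) x) = 0" for n
      using that by (intro zero test_function_box_bump) auto
    ultimately have "(LINT x|lborel. f x * indicator (box a c) x) = 0"
      by (simp add: LIMSEQ_const_iff)
    then show ?thesis by (simp add: mult.commute)
  qed
  have box: "AE x in lborel. x \<in> cbox A C \<longrightarrow> f x = 0" if AC: "cbox A C \<subseteq> S" for A C
  proof -
    have "AE x in lborel. indicator (box A C) x * f x = 0"
    proof (rule AE_zero_if_box_integrals_zero)
      show "integrable lborel (\<lambda>x. indicator (box A C) x * f x)"
        using integrable_mult_indicator[OF _ f, of "box A C"] by simp
      fix a c :: 'a
      obtain a' c' where b: "box a c \<inter> box A C = box a' c'"
        by (simp add: box_Int_box)
      show "(LINT x|lborel. indicator (box a c) x * (indicator (box A C) x * f x)) = 0"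
      proof (cases "box a' c' = {}")
        case True
        then have "(\<lambda>x. indicator (box a c) x * (indicator (box A C) x * f x)) = (\<lambda>_. 0)"
          using b by (intro ext) (auto split: split_indicator)
        then show ?thesis by (metis integral_zero)
      next
        case False
        have "closure (box a' c') \<subseteq> closure (box A C)" using b by (intro closure_mono) auto
        then have "cbox a' c' \<subseteq> cbox A C"
          using False b by (metis box_eq_empty(1) closure_box empty_subsetI inf_bot_right)
        then have "(LINT x|lborel. indicator (box a' c') x * f x) = 0" using AC by (intro *) auto
        moreover have "indicator (box a c) x * (indicator (box A C) x * f x) = indicator (box a' c') x * f x" for x
          unfolding b[symmetric] by (auto split: split_indicator)
        ultimately show ?thesis by (simp only:)
      qed
    qed
    moreover have "AE x in lborel. x \<notin> cbox A C - box A C"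
      using negligible_frontier_interval[of A C]
      by (intro AE_not_in) (simp add: negligible_iff_null_sets null_sets_completion_iff)
    ultimately show ?thesis by eventually_elim auto
  qed
  obtain D where D: "countable D" "D \<subseteq> Pow S" "\<And>X. X \<in> D \<Longrightarrow> \<exists>a b. X = cbox a b" "\<Union>D = S"
    using open_countable_Union_open_cbox[OF S] by metis
  have "AE x in lborel. \<forall>X\<in>D. x \<in> X \<longrightarrow> f x = 0"
    unfolding AE_ball_countable[OF D(1)] using D(2,3) box by blast
  then show ?thesis unfolding D(4)[symmetric] by eventually_elim auto
qed

section \<open>Difference quotients of weakly differentiable functions\<close>

lemma
  fixes f :: "'a::euclidean_space \<Rightarrow> 'b::{banach,second_countable_topology}"
  assumes [measurable]: "f \<in> borel_measurable borel"
  shows integral_lborel_shift: "(LINT x|lborel. f (x + a)) = (LINT x|lborel. f x)"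
    and integrable_lborel_shift_iff: "integrable lborel (\<lambda>x. f (x + a)) \<longleftrightarrow> integrable lborel f"
proof -
  have "(LINT x|lborel. f x) = (LINT x|distr lborel borel ((+) a). f x)" by (simp add: lborel_distr_plus)
  also have "\<dots> = (LINT x|lborel. f (x + a))" by (subst integral_distr) (auto simp: add.commute)
  finally show "(LINT x|lborel. f (x + a)) = (LINT x|lborel. f x)" by simp
  have "integrable lborel f \<longleftrightarrow> integrable (distr lborel borel ((+) a)) f" by (simp add: lborel_distr_plus)
  also have "\<dots> \<longleftrightarrow> integrable lborel (\<lambda>x. f (x + a))" by (subst integrable_distr_eq) (auto simp: add.commute)
  finally show "integrable lborel (\<lambda>x. f (x + a)) \<longleftrightarrow> integrable lborel f" by simp
qed

lemma nn_integral_lborel_shift: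
  fixes f :: "'a::euclidean_space \<Rightarrow> ennreal"
  assumes [measurable]: "f \<in> borel_measurable borel"
  shows "(\<integral>\<^sup>+x. f (x + a) \<partial>lborel) = (\<integral>\<^sup>+x. f x \<partial>lborel)"
proof -
  have "(\<integral>\<^sup>+x. f x \<partial>lborel) = (\<integral>\<^sup>+x. f x \<partial>distr lborel borel ((+) a))" by (simp add: lborel_distr_plus)
  also have "\<dots> = (\<integral>\<^sup>+x. f (x + a) \<partial>lborel)" by (subst nn_integral_distr) (auto simp: add.commute)
  finally show ?thesis by simp
qed

text \<open>This justifies each exchange of the integral over \<open>x\<close> with that over the points
  \<open>x + t h\<close> of a segment; the bounded factor \<open>b\<close> stands for a test function or its derivative.\<close>

lemma integrable_segment_average:
  fixes g :: "'a::euclidean_space \<Rightarrow> real"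
  assumes g: "integrable lborel g" and [measurable]: "b \<in> borel_measurable borel"
    and M: "\<And>t x. \<bar>b (t, x)\<bar> \<le> M"
  shows "integrable (lborel \<Otimes>\<^sub>M lborel) (\<lambda>(t, x). indicator {0..1::real} t * (g (x + t *\<^sub>R h) * b (t, x)))"
proof -
  have [measurable]: "g \<in> borel_measurable borel" using g by simp
  have [measurable]: "(\<lambda>z::real \<times> 'a. b z) \<in> borel_measurable (borel \<Otimes>\<^sub>M borel)"
    using assms(2) by (simp add: borel_prod)
  have gs: "integrable lborel (\<lambda>x. g (x + a))" for a using g by (simp add: integrable_lborel_shift_iff)
  have dom: "integrable (lborel \<Otimes>\<^sub>M lborel) (\<lambda>(t, x). M * (indicator {0..1::real} t * g (x + t *\<^sub>R h)))"
  proof (rule lborel_pair.Fubini_integrable)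
    have "(LINT x|lborel. norm (M * (indicator {0..1} t * g (x + t *\<^sub>R h))))
        = indicator {0..1} t *\<^sub>R (\<bar>M\<bar> * (LINT x|lborel. \<bar>g x\<bar>))" for t :: real
    proof -
      have "(LINT x|lborel. norm (M * (indicator {0..1} t * g (x + t *\<^sub>R h))))
        = (LINT x|lborel. \<bar>M\<bar> * indicator {0..1} t * \<bar>g (x + t *\<^sub>R h)\<bar>)"
        by (simp add: abs_mult mult.assoc)
      also have "\<dots> = \<bar>M\<bar> * indicator {0..1} t * (LINT x|lborel. \<bar>g (x + t *\<^sub>R h)\<bar>)"
        by (rule integral_mult_right_zero)
      finally show ?thesis by (simp add: integral_lborel_shift[of "\<lambda>x. \<bar>g x\<bar>"])
    qed
    then show "integrable lborel (\<lambda>t::real. LINT x|lborel. norm (case (t, x) of (t, x) \<Rightarrow> M * (indicator {0..1} t * g (x + t *\<^sub>R h))))"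
      by (simp add: integrable_real_indicator)
    show "AE t in lborel. integrable lborel (\<lambda>x. case (t::real, x) of (t, x) \<Rightarrow> M * (indicator {0..1} t * g (x + t *\<^sub>R h)))"
      using gs by (intro AE_I2) auto
  qed measurable
  show ?thesis
  proof (rule Bochner_Integration.integrable_bound[OF dom])
    have "0 \<le> M" using M[of undefined undefined] by linarith
    then have "\<bar>g (x + t *\<^sub>R h)\<bar> * \<bar>b (t, x)\<bar> \<le> M * \<bar>g (x + t *\<^sub>R h)\<bar>" for t x
      using mult_left_mono[OF M[of t x], of "\<bar>g (x + t *\<^sub>R h)\<bar>"] by (simp add: mult.commute)
    then show "AE z in lborel \<Otimes>\<^sub>M lborel. norm (case z of (t, x) \<Rightarrow> indicator {0..1::real} t * (g (x + t *\<^sub>R h) * b (t, x)))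
        \<le> norm (case z of (t, x) \<Rightarrow> M * (indicator {0..1::real} t * g (x + t *\<^sub>R h)))"
      using \<open>0 \<le> M\<close> by (intro AE_I2) (auto simp: abs_mult split: split_indicator)
  qed measurable
qed

text \<open>The increment of \<open>\<phi>\<close> is the integral of its derivative along the segment from \<open>x\<close> to \<open>x - h\<close>.\<close>

lemma integral_times_translation_difference:
  fixes U :: "'a::euclidean_space \<Rightarrow> real"
  assumes U: "integrable lborel U" and \<phi>: "test_function S \<phi>"
  shows "(LINT x|lborel. U x * (\<phi> (x - h) - \<phi> x))
    = - (LINT t|lborel. indicator {0..1} t * (LINT x|lborel. U x * frechet_derivative \<phi> (at (x - t *\<^sub>R h)) h))"
proof -
  have [measurable]: "U \<in> borel_measurable borel" using U by simp
  let ?D = "\<lambda>x. frechet_derivative \<phi> (at x) h"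
  note [measurable] = borel_measurable_test_function_derivative[OF \<phi>, of h]
  obtain M where M: "\<And>x. \<bar>?D x\<bar> \<le> M" using test_function_derivative_bounded[OF \<phi>, of h] by blast
  have int: "integrable (lborel \<Otimes>\<^sub>M lborel) (\<lambda>(t, x). indicator {0..1::real} t * (U x * ?D (x - t *\<^sub>R h)))"
    using integrable_segment_average[OF U, of "\<lambda>(t, x). ?D (x - t *\<^sub>R h)" M 0] M
    by (simp add: borel_prod[symmetric])
  have ftc: "\<phi> (x - h) - \<phi> x = - (LINT t|lborel. indicator {0..1} t * ?D (x - t *\<^sub>R h))" for x
  proof -
    have "((\<lambda>t. \<phi> (x - t *\<^sub>R h)) has_derivative (\<lambda>s. ?D (x - t *\<^sub>R h) * - s)) (at t)" for t
    proof -
      have "((\<lambda>t. \<phi> (x - t *\<^sub>R h)) has_derivative (\<lambda>s. frechet_derivative \<phi> (at (x - t *\<^sub>R h)) (- (s *\<^sub>R h)))) (at t)"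
        by (rule has_derivative_compose[where f = "\<lambda>t. x - t *\<^sub>R h" and g = \<phi>, OF _ test_function_has_derivative[OF \<phi>]])
           (auto intro!: derivative_eq_intros)
      then show ?thesis
        by (simp add: linear_neg[OF test_function_linear[OF \<phi>]] linear_scale[OF test_function_linear[OF \<phi>]] mult.commute)
    qed
    then have "((\<lambda>t. \<phi> (x - t *\<^sub>R h)) has_field_derivative - ?D (x - t *\<^sub>R h)) (at t)" for t
      unfolding has_field_derivative_def
      by (rule has_derivative_eq_rhs) (simp add: fun_eq_iff)
    moreover have "isCont (\<lambda>t. - ?D (x - t *\<^sub>R h)) t" for t
    proof -
      have "continuous_on UNIV (\<lambda>t. - ?D (x - t *\<^sub>R h))"
        by (intro continuous_intros continuous_on_compose2[OF continuous_on_test_function_derivative[OF \<phi>, of UNIV]]) auto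
      then show ?thesis by (simp add: continuous_on_eq_continuous_at)
    qed
    ultimately have "(LINT t|lborel. - ?D (x - t *\<^sub>R h) * indicator {0..1} t) = \<phi> (x - 1 *\<^sub>R h) - \<phi> (x - 0 *\<^sub>R h)"
      by (intro integral_FTC_Icc_real) auto
    then show ?thesis by (simp add: mult.commute)
  qed
  have "(LINT x|lborel. U x * (\<phi> (x - h) - \<phi> x))
      = - (LINT x|lborel. LINT t|lborel. indicator {0..1} t * (U x * ?D (x - t *\<^sub>R h)))"
    unfolding ftc by (simp add: mult.left_commute)
  also have "\<dots> = - (LINT t|lborel. LINT x|lborel. indicator {0..1} t * (U x * ?D (x - t *\<^sub>R h)))"
    using lborel_pair.Fubini_integral[OF int] by simp
  finally show ?thesis by simp
qed

text \<open>Against a test function \<open>\<phi>\<close>, the difference of \<open>U\<close> can be moved to \<open>\<phi>\<close>, written as an integral of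
  derivatives of translates of \<open>\<phi>\<close>, and moved back by the weak equation; then the fundamental lemma removes
  \<open>\<phi>\<close>. Convexity keeps the translates supported in \<open>B\<close>.\<close>

lemma weak_derivative_difference:
  fixes U g :: "'a::euclidean_space \<Rightarrow> real"
  assumes U: "integrable lborel U" and g: "integrable lborel g" and B: "open B" "convex B"
    and weak: "\<And>\<phi>. test_function B \<phi> \<Longrightarrow>
      (LINT x|lborel. U x * frechet_derivative \<phi> (at x) h) = - (LINT x|lborel. g x * \<phi> x)"
  shows "AE x in lborel. x \<in> B \<and> x + h \<in> B \<longrightarrow>
      U (x + h) - U x = (LINT t|lborel. indicator {0..1} t * g (x + t *\<^sub>R h))"
proof -
  have [measurable]: "U \<in> borel_measurable borel" "g \<in> borel_measurable borel" using U g by auto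
  let ?T = "{x. x \<in> B \<and> x + h \<in> B}"
  let ?I = "\<lambda>x. LINT t|lborel. indicator {0..1::real} t * g (x + t *\<^sub>R h)"
  have int: "integrable (lborel \<Otimes>\<^sub>M lborel) (\<lambda>(t, x). indicator {0..1::real} t * g (x + t *\<^sub>R h))"
    using integrable_segment_average[OF g, of "\<lambda>_. 1" 1 h] by simp
  have intI: "integrable lborel ?I"
    using lborel_pair.integrable_snd[OF int] by simp
  have intU: "integrable lborel (\<lambda>x. U (x + h) - U x)" using U by (simp add: integrable_lborel_shift_iff)
  have "AE x in lborel. x \<in> ?T \<longrightarrow> (U (x + h) - U x) - ?I x = 0"
  proof (rule AE_zero_if_test_integrals_zero)
    show "integrable lborel (\<lambda>x. (U (x + h) - U x) - ?I x)" using intI intU by simp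
    have "open ((\<lambda>x. x + h) -` B)" using B by (intro continuous_open_vimage) (auto intro!: continuous_intros)
    then have "open (B \<inter> (\<lambda>x. x + h) -` B)" using B by blast
    then show "open ?T" by (simp add: Int_def vimage_def)
    fix \<phi> assume \<phi>: "test_function ?T \<phi>"
    note [measurable] = borel_measurable_test_function[OF \<phi>]
    obtain M where M: "\<And>x. \<bar>\<phi> x\<bar> \<le> M" using test_function_bounded[OF \<phi>] by blast
    have bd: "integrable lborel (\<lambda>x. f x * \<phi> (x - a))" if "integrable lborel f" for f a
    proof (rule Bochner_Integration.integrable_bound[where f = "\<lambda>x. M * f x"])
      show "(\<lambda>x. f x * \<phi> (x - a)) \<in> borel_measurable lborel" using that by measurable
      have "\<bar>f x\<bar> * \<bar>\<phi> (x - a)\<bar> \<le> \<bar>M\<bar> * \<bar>f x\<bar>" for x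
        using mult_right_mono[of "\<bar>\<phi> (x - a)\<bar>" "\<bar>M\<bar>" "\<bar>f x\<bar>"] M[of "x - a"] by (simp add: mult.commute)
      then show "AE x in lborel. norm (f x * \<phi> (x - a)) \<le> norm (M * f x)" by (simp add: abs_mult)
    qed (use that in auto)
    have shift: "(LINT x|lborel. U x * frechet_derivative \<phi> (at (x - t *\<^sub>R h)) h)
        = - (LINT x|lborel. g (x + t *\<^sub>R h) * \<phi> x)" if t: "t \<in> {0..1}" for t
    proof -
      have test: "test_function B (\<lambda>x. \<phi> (x - t *\<^sub>R h))"
      proof (rule test_function_shift[OF \<phi>], clarify)
        fix x assume "x \<in> closure {x. \<phi> x \<noteq> 0}"
        then have "x \<in> B" "x + h \<in> B" using \<phi> by (auto simp: test_function_def)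
        then have "(1 - t) *\<^sub>R x + t *\<^sub>R (x + h) \<in> B" using B t by (intro convexD) auto
        then show "x + t *\<^sub>R h \<in> B" by (simp add: algebra_simps)
      qed
      have "frechet_derivative (\<lambda>x. \<phi> (x - t *\<^sub>R h)) (at x) = frechet_derivative \<phi> (at (x - t *\<^sub>R h))" for x
        using frechet_derivative_at[OF has_derivative_frechet_shift[OF test_function_differentiable[OF \<phi>]]] by simp
      with weak[OF test] have "(LINT x|lborel. U x * frechet_derivative \<phi> (at (x - t *\<^sub>R h)) h)
          = - (LINT x|lborel. g x * \<phi> (x - t *\<^sub>R h))" by simp
      also have "(LINT x|lborel. g x * \<phi> (x - t *\<^sub>R h)) = (LINT x|lborel. g (x + t *\<^sub>R h) * \<phi> x)"
        using integral_lborel_shift[of "\<lambda>x. g x * \<phi> (x - t *\<^sub>R h)" "t *\<^sub>R h"] by simp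
      finally show ?thesis .
    qed
    have int2: "integrable (lborel \<Otimes>\<^sub>M lborel) (\<lambda>(t, x). indicator {0..1::real} t * (g (x + t *\<^sub>R h) * \<phi> x))"
      using integrable_segment_average[OF g, of "\<lambda>(t, x). \<phi> x" M h] M by (simp add: borel_prod[symmetric])
    have "(LINT x|lborel. U (x + h) * \<phi> x) = (LINT x|lborel. U x * \<phi> (x - h))"
      using integral_lborel_shift[of "\<lambda>x. U x * \<phi> (x - h)" h] by simp
    then have "(LINT x|lborel. (U (x + h) - U x) * \<phi> x) = (LINT x|lborel. U x * (\<phi> (x - h) - \<phi> x))"
      using bd[of "\<lambda>x. U (x + h)" 0] bd[OF U, of 0] bd[OF U, of h] U
      by (simp add: left_diff_distrib right_diff_distrib integrable_lborel_shift_iff)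
    also have "\<dots> = - (LINT t|lborel. indicator {0..1} t * (LINT x|lborel. U x * frechet_derivative \<phi> (at (x - t *\<^sub>R h)) h))"
      by (rule integral_times_translation_difference[OF U \<phi>])
    also have "\<dots> = (LINT t|lborel. LINT x|lborel. indicator {0..1} t * (g (x + t *\<^sub>R h) * \<phi> x))"
      unfolding integral_minus[symmetric] using shift
      by (intro Bochner_Integration.integral_cong) (auto split: split_indicator)
    also have "\<dots> = (LINT x|lborel. LINT t|lborel. indicator {0..1} t * (g (x + t *\<^sub>R h) * \<phi> x))"
      using lborel_pair.Fubini_integral[OF int2] by simp
    also have "\<dots> = (LINT x|lborel. ?I x * \<phi> x)"
      unfolding mult.assoc[symmetric] by simp
    finally show "(LINT x|lborel. ((U (x + h) - U x) - ?I x) * \<phi> x) = 0"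
      using bd[OF intU, of 0] bd[OF intI, of 0] by (simp add: left_diff_distrib)
  qed
  then show ?thesis by simp
qed

text \<open>The graph of \<open>a \<mapsto> a\<^sup>p\<close> lies above its tangent at \<open>m\<close>; this is Young's inequality for \<open>a\<close> and
  \<open>m\<^bsup>p-1\<^esup>\<close>.\<close>

lemma powr_tangent:
  fixes p m a :: real
  assumes p: "1 < p" and m: "0 \<le> m" and a: "0 \<le> a"
  shows "p * m powr (p - 1) * a \<le> a powr p + (p - 1) * m powr p"
proof -
  have q: "p / (p - 1) > 1" "1 / p + 1 / (p / (p - 1)) = 1" using p by (auto simp: field_simps)
  have "a * m powr (p - 1) \<le> a powr p / p + (m powr (p - 1)) powr (p / (p - 1)) / (p / (p - 1))"
    using p q a by (intro Youngs_inequality) auto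
  also have "(m powr (p - 1)) powr (p / (p - 1)) = m powr p" using p by (simp add: powr_powr)
  finally have "p * (a * m powr (p - 1)) \<le> p * (a powr p / p + m powr p / (p / (p - 1)))"
    using p by (intro mult_left_mono) auto
  moreover have "p * (A / p + B / (p / (p - 1))) = A + (p - 1) * B" for A B
    using p by (simp add: field_simps)
  ultimately have "p * (a * m powr (p - 1)) \<le> a powr p + (p - 1) * m powr p"
    by (simp only:)
  then show ?thesis by (simp add: mult_ac)
qed

text \<open>The tangent inequality at the mean is integrated over the unit interval.\<close>

lemma powr_Jensen_unit_interval:
  fixes f :: "real \<Rightarrow> real"
  assumes p: "1 < p" and [measurable]: "f \<in> borel_measurable borel"
  shows "ennreal (\<bar>LINT t|lborel. indicator {0..1} t * f t\<bar> powr p)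
    \<le> (\<integral>\<^sup>+t. indicator {0..1} t * ennreal (\<bar>f t\<bar> powr p) \<partial>lborel)" (is "_ \<le> ?X")
proof (cases "?X = \<infinity>")
  case False
  define m where "m = \<bar>LINT t|lborel. indicator {0..1} t * f t\<bar>"
  have Young: "p * m powr (p - 1) * \<bar>a\<bar> \<le> \<bar>a\<bar> powr p + (p - 1) * m powr p" for a
    using p by (intro powr_tangent) (auto simp: m_def)
  have le: "m \<le> (LINT t|lborel. \<bar>indicator {0..1} t * f t\<bar>)"
    unfolding m_def by (rule integral_abs_bound)
  have "ennreal (p * m powr (p - 1)) * ennreal m \<le> ennreal (p * m powr (p - 1)) * (\<integral>\<^sup>+t. ennreal \<bar>indicator {0..1} t * f t\<bar> \<partial>lborel)"
  proof (intro mult_left_mono)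
    show "ennreal m \<le> (\<integral>\<^sup>+t. ennreal \<bar>indicator {0..1} t * f t\<bar> \<partial>lborel)"
    proof (cases "integrable lborel (\<lambda>t. indicator {0..1} t * f t)")
      case True
      then have "(\<integral>\<^sup>+t. ennreal \<bar>indicator {0..1} t * f t\<bar> \<partial>lborel) = ennreal (LINT t|lborel. \<bar>indicator {0..1} t * f t\<bar>)"
        by (intro nn_integral_eq_integral) auto
      then show ?thesis using le by (simp add: ennreal_leI)
    next
      case False
      \<comment> \<open>the integral of a function that is not integrable is \<open>0\<close>\<close>
      then have "m = 0" by (simp add: m_def not_integrable_integral_eq)
      then show ?thesis by simp
    qed
  qed simp
  also have "\<dots> = (\<integral>\<^sup>+t. indicator {0..1} t * ennreal (p * m powr (p - 1) * \<bar>f t\<bar>) \<partial>lborel)"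
    using p by (subst nn_integral_cmult[symmetric])
       (auto intro!: nn_integral_cong simp: ennreal_mult split: split_indicator)
  also have "\<dots> \<le> (\<integral>\<^sup>+t. indicator {0..1} t * ennreal (\<bar>f t\<bar> powr p) + ennreal ((p - 1) * m powr p) * indicator {0..1} t \<partial>lborel)"
    using Young p by (intro nn_integral_mono)
       (auto simp: ennreal_plus[symmetric] simp del: ennreal_plus intro!: ennreal_leI split: split_indicator)
  also have "\<dots> = ?X + ennreal ((p - 1) * m powr p)"
    by (subst nn_integral_add) (auto simp: nn_integral_cmult_indicator)
  finally have *: "ennreal (p * m powr (p - 1)) * ennreal m \<le> ?X + ennreal ((p - 1) * m powr p)" .
  obtain X where X: "?X = ennreal X" "0 \<le> X" using False by (metis ennreal_cases infinity_ennreal_def)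
  have "0 \<le> m" by (simp add: m_def)
  then have "m powr (p - 1) * m = m powr p"
    using powr_add[of m "p - 1" 1] by (cases "m = 0") auto
  then have "p * m powr p \<le> X + (p - 1) * m powr p"
    using * X p \<open>0 \<le> m\<close>
    by (simp add: ennreal_mult[symmetric] mult.assoc ennreal_plus[symmetric] del: ennreal_plus)
  then have "m powr p \<le> X" by (simp add: algebra_simps)
  then show ?thesis using X m_def by (simp add: ennreal_leI)
qed simp

text \<open>Jensen's inequality on each segment, followed by translation invariance of the integral.\<close>

lemma weak_derivative_difference_Lp:
  fixes U g m :: "'a::euclidean_space \<Rightarrow> real"
  assumes U: "integrable lborel U" and g: "integrable lborel g" and B: "open B" "convex B"
    and weak: "\<And>\<phi>. test_function B \<phi> \<Longrightarrow>
      (LINT x|lborel. U x * frechet_derivative \<phi> (at x) h) = - (LINT x|lborel. g x * \<phi> x)"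
    and p: "1 < p" and gm: "AE x in lborel. \<bar>g x\<bar> \<le> norm h * m x" and [measurable]: "m \<in> borel_measurable borel"
  shows "(\<integral>\<^sup>+x. indicator B x * indicator B (x + h) * ennreal (\<bar>U (x + h) - U x\<bar> powr p) \<partial>lborel)
    \<le> ennreal (norm h powr p) * (\<integral>\<^sup>+x. ennreal (m x powr p) \<partial>lborel)"
proof -
  have [measurable]: "U \<in> borel_measurable borel" "g \<in> borel_measurable borel" "B \<in> sets borel" using U g B by auto
  have "(\<integral>\<^sup>+x. indicator B x * indicator B (x + h) * ennreal (\<bar>U (x + h) - U x\<bar> powr p) \<partial>lborel)
    \<le> (\<integral>\<^sup>+x. (\<integral>\<^sup>+t. indicator {0..1::real} t * ennreal (\<bar>g (x + t *\<^sub>R h)\<bar> powr p) \<partial>lborel) \<partial>lborel)"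
  proof (rule nn_integral_mono_AE)
    have "AE x in lborel. x \<in> B \<and> x + h \<in> B \<longrightarrow>
      U (x + h) - U x = (LINT t|lborel. indicator {0..1} t * g (x + t *\<^sub>R h))"
      by (rule weak_derivative_difference[OF U g B weak])
    then show "AE x in lborel. indicator B x * indicator B (x + h) * ennreal (\<bar>U (x + h) - U x\<bar> powr p)
      \<le> (\<integral>\<^sup>+t. indicator {0..1::real} t * ennreal (\<bar>g (x + t *\<^sub>R h)\<bar> powr p) \<partial>lborel)"
    proof eventually_elim
      case (elim x)
      have "ennreal (\<bar>LINT t|lborel. indicator {0..1} t * g (x + t *\<^sub>R h)\<bar> powr p)
        \<le> (\<integral>\<^sup>+t. indicator {0..1} t * ennreal (\<bar>g (x + t *\<^sub>R h)\<bar> powr p) \<partial>lborel)"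
        by (intro powr_Jensen_unit_interval p) measurable
      then show ?case using elim by (auto split: split_indicator)
    qed
  qed
  also have "\<dots> = (\<integral>\<^sup>+t. (\<integral>\<^sup>+x. indicator {0..1::real} t * ennreal (\<bar>g (x + t *\<^sub>R h)\<bar> powr p) \<partial>lborel) \<partial>lborel)"
    by (rule lborel_pair.Fubini') measurable
  also have "\<dots> = (\<integral>\<^sup>+t. indicator {0..1::real} t * (\<integral>\<^sup>+x. ennreal (\<bar>g x\<bar> powr p) \<partial>lborel) \<partial>lborel)"
    by (intro nn_integral_cong, subst nn_integral_cmult, measurable)
       (simp add: nn_integral_lborel_shift[of "\<lambda>x. ennreal (\<bar>g x\<bar> powr p)"])
  also have "\<dots> = (\<integral>\<^sup>+x. ennreal (\<bar>g x\<bar> powr p) \<partial>lborel)"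
    by (subst nn_integral_multc) auto
  also have "\<dots> \<le> (\<integral>\<^sup>+x. ennreal (norm h powr p) * ennreal (m x powr p) \<partial>lborel)"
  proof (rule nn_integral_mono_AE)
    show "AE x in lborel. ennreal (\<bar>g x\<bar> powr p) \<le> ennreal (norm h powr p) * ennreal (m x powr p)"
      using gm
    proof eventually_elim
      case (elim x)
      show ?case
      proof (cases "m x < 0")
        case True
        then have "norm h * m x \<le> 0" by (simp add: mult_nonneg_nonpos)
        then have "\<bar>g x\<bar> = 0" using elim by linarith
        then show ?thesis by simp
      next
        case False
        have "\<bar>g x\<bar> powr p \<le> (norm h * m x) powr p" using elim p by (intro powr_mono2) auto
        then show ?thesis using False by (simp add: powr_mult ennreal_mult'[symmetric] ennreal_leI)
      qed
    qed
  qed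
  also have "\<dots> = ennreal (norm h powr p) * (\<integral>\<^sup>+x. ennreal (m x powr p) \<partial>lborel)"
    by (rule nn_integral_cmult) measurable
  finally show ?thesis .
qed

section \<open>Integrals of power kernels\<close>

text \<open>A substitute for polar coordinates: a power of \<open>\<zeta>\<close> is comparable to an integral over
  \<open>[\<zeta>, 2 \<zeta>]\<close>. With \<open>\<zeta> = norm z\<close>, Tonelli's theorem then replaces the integral over \<open>z\<close> by volumes of balls.\<close>

lemma powr_le_nn_integral_dyadic:
  fixes a \<zeta> :: real
  assumes "0 < \<zeta>"
  shows "ennreal (\<zeta> powr a) \<le> ennreal (2 powr (\<bar>a\<bar> + 1)) * (\<integral>\<^sup>+t. ennreal (t powr (a - 1)) * indicator {\<zeta>..2 * \<zeta>} t \<partial>lborel)"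
proof -
  have *: "2 powr (- (\<bar>a\<bar> + 1)) * \<zeta> powr (a - 1) \<le> t powr (a - 1)" if "\<zeta> \<le> t" "t \<le> 2 * \<zeta>" for t
  proof (cases "1 \<le> a")
    case True
    have "2 powr (- (\<bar>a\<bar> + 1)) * \<zeta> powr (a - 1) \<le> 1 * \<zeta> powr (a - 1)"
      using powr_mono[of "- (\<bar>a\<bar> + 1)" 0 2] by (intro mult_right_mono) auto
    also have "\<dots> \<le> t powr (a - 1)" using True that assms by (auto intro: powr_mono2)
    finally show ?thesis .
  next
    case False
    have "2 powr (- (\<bar>a\<bar> + 1)) * \<zeta> powr (a - 1) \<le> 2 powr (a - 1) * \<zeta> powr (a - 1)"
      by (intro mult_right_mono powr_mono) auto
    also have "\<dots> = (2 * \<zeta>) powr (a - 1)" using assms by (simp add: powr_mult)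
    also have "\<dots> \<le> t powr (a - 1)" using False that assms by (intro powr_mono2') auto
    finally show ?thesis .
  qed
  have "ennreal (2 powr (- (\<bar>a\<bar> + 1)) * \<zeta> powr a) = (\<integral>\<^sup>+t. ennreal (2 powr (- (\<bar>a\<bar> + 1)) * \<zeta> powr (a - 1)) * indicator {\<zeta>..2 * \<zeta>} t \<partial>lborel)"
    using assms by (simp add: nn_integral_cmult_indicator ennreal_mult[symmetric] powr_diff mult.assoc)
  also have "\<dots> \<le> (\<integral>\<^sup>+t. ennreal (t powr (a - 1)) * indicator {\<zeta>..2 * \<zeta>} t \<partial>lborel)"
    by (intro nn_integral_mono) (use * in \<open>auto split: split_indicator intro!: ennreal_leI\<close>)
  finally have "ennreal (2 powr (\<bar>a\<bar> + 1)) * ennreal (2 powr (- (\<bar>a\<bar> + 1)) * \<zeta> powr a)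
    \<le> ennreal (2 powr (\<bar>a\<bar> + 1)) * (\<integral>\<^sup>+t. ennreal (t powr (a - 1)) * indicator {\<zeta>..2 * \<zeta>} t \<partial>lborel)"
    by (rule mult_left_mono) simp
  moreover
  have "2 powr (\<bar>a\<bar> + 1) * (2 powr (- (\<bar>a\<bar> + 1)) * \<zeta> powr a) = \<zeta> powr a"
    by (simp add: mult.assoc[symmetric] powr_add[symmetric])
  then have "ennreal (2 powr (\<bar>a\<bar> + 1)) * ennreal (2 powr (- (\<bar>a\<bar> + 1)) * \<zeta> powr a) = ennreal (\<zeta> powr a)"
    by (subst ennreal_mult'[symmetric]) simp_all
  ultimately show ?thesis by (simp only:)
qed

lemma nn_integral_norm_powr_le:
  fixes S :: "'a::euclidean_space set" and T :: "real set" and a :: real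
  assumes [measurable]: "S \<in> sets borel" "T \<in> sets borel"
    and T: "\<And>z t. z \<in> S \<Longrightarrow> z \<noteq> 0 \<Longrightarrow> norm z \<le> t \<Longrightarrow> t \<le> 2 * norm z \<Longrightarrow> t \<in> T"
  shows "(\<integral>\<^sup>+z. indicator S z * ennreal (norm z powr a) \<partial>lborel)
    \<le> ennreal (2 powr (\<bar>a\<bar> + 1) * unit_ball_vol DIM('a))
      * (\<integral>\<^sup>+t. ennreal (t powr (a + DIM('a) - 1)) * indicator T t \<partial>lborel)"
proof -
  let ?c = "ennreal (2 powr (\<bar>a\<bar> + 1))"
  have "(\<integral>\<^sup>+z. indicator S z * ennreal (norm z powr a) \<partial>lborel)
    \<le> (\<integral>\<^sup>+z. ?c * (\<integral>\<^sup>+t. ennreal (t powr (a - 1)) * indicator T t * indicator {z. norm z \<le> t} z * indicator {0<..} t \<partial>lborel) \<partial>(lborel :: 'a measure))"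
  proof (rule nn_integral_mono)
    fix z :: 'a
    show "indicator S z * ennreal (norm z powr a)
      \<le> ?c * (\<integral>\<^sup>+t. ennreal (t powr (a - 1)) * indicator T t * indicator {z. norm z \<le> t} z * indicator {0<..} t \<partial>lborel)"
    proof (cases "z \<in> S \<and> z \<noteq> 0")
      case True
      then have "ennreal (norm z powr a) \<le> ?c * (\<integral>\<^sup>+t. ennreal (t powr (a - 1)) * indicator {norm z..2 * norm z} t \<partial>lborel)"
        by (intro powr_le_nn_integral_dyadic) simp
      also have "\<dots> \<le> ?c * (\<integral>\<^sup>+t. ennreal (t powr (a - 1)) * indicator T t * indicator {z. norm z \<le> t} z * indicator {0<..} t \<partial>lborel)"
      proof (intro mult_left_mono nn_integral_mono)
        fix t :: real
        show "ennreal (t powr (a - 1)) * indicator {norm z..2 * norm z} t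
          \<le> ennreal (t powr (a - 1)) * indicator T t * indicator {z. norm z \<le> t} z * indicator {0<..} t"
        proof (cases "t \<in> {norm z..2 * norm z}")
          case t: True
          moreover have "0 < t" using t True by (metis atLeastAtMost_iff less_le_trans zero_less_norm_iff)
          ultimately show ?thesis using T[of z t] True by simp
        qed simp
      qed simp
      finally show ?thesis using True by simp
    qed auto
  qed
  also have "\<dots> = ?c * (\<integral>\<^sup>+z. (\<integral>\<^sup>+t. ennreal (t powr (a - 1)) * indicator T t * indicator {z. norm z \<le> t} z * indicator {0<..} t \<partial>lborel) \<partial>(lborel :: 'a measure))"
    by (intro nn_integral_cmult) measurable
  also have "\<dots> = ?c * (\<integral>\<^sup>+t. (\<integral>\<^sup>+z. ennreal (t powr (a - 1)) * indicator T t * indicator {z. norm z \<le> t} z * indicator {0<..} t \<partial>(lborel :: 'a measure)) \<partial>lborel)"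
    by (subst lborel_pair.Fubini') auto
  also have "\<dots> = ?c * (\<integral>\<^sup>+t. ennreal (unit_ball_vol DIM('a)) * (ennreal (t powr (a + DIM('a) - 1)) * indicator T t * indicator {0<..} t) \<partial>lborel)"
  proof (intro arg_cong2[where f = "(*)"] refl nn_integral_cong)
    fix t :: real
    show "(\<integral>\<^sup>+z. ennreal (t powr (a - 1)) * indicator T t * indicator {z. norm z \<le> t} z * indicator {0<..} t \<partial>(lborel :: 'a measure))
      = ennreal (unit_ball_vol DIM('a)) * (ennreal (t powr (a + DIM('a) - 1)) * indicator T t * indicator {0<..} t)"
    proof (cases "0 < t \<and> t \<in> T")
      case True
      have "{z. norm z \<le> t} = cball (0 :: 'a) t" by (auto simp: mem_cball_0)
      then have "(\<integral>\<^sup>+z. ennreal (t powr (a - 1)) * indicator T t * indicator {z. norm z \<le> t} z * indicator {0<..} t \<partial>(lborel :: 'a measure))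
        = ennreal (t powr (a - 1)) * emeasure lborel (cball (0 :: 'a) t)"
        using True by (simp add: nn_integral_cmult_indicator)
      also have "\<dots> = ennreal (t powr (a - 1)) * ennreal (unit_ball_vol DIM('a) * t ^ DIM('a))"
        using True by (simp add: emeasure_cball)
      also have "\<dots> = ennreal (unit_ball_vol DIM('a) * (t powr (a - 1) * t powr DIM('a)))"
        using True by (simp add: ennreal_mult[symmetric] powr_realpow mult_ac)
      also have "t powr (a - 1) * t powr DIM('a) = t powr (a + DIM('a) - 1)"
        by (simp add: powr_add[symmetric] algebra_simps)
      finally show ?thesis using True by (simp add: ennreal_mult)
    qed auto
  qed
  also have "\<dots> = ?c * (ennreal (unit_ball_vol DIM('a)) * (\<integral>\<^sup>+t. ennreal (t powr (a + DIM('a) - 1)) * indicator T t * indicator {0<..} t \<partial>lborel))"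
    by (subst nn_integral_cmult) auto
  also have "\<dots> \<le> ?c * (ennreal (unit_ball_vol DIM('a)) * (\<integral>\<^sup>+t. ennreal (t powr (a + DIM('a) - 1)) * indicator T t \<partial>lborel))"
    by (intro mult_left_mono nn_integral_mono) (auto split: split_indicator)
  finally show ?thesis by (simp add: ennreal_mult mult.assoc)
qed

lemma nn_integral_norm_powr_ball:
  fixes R q :: real
  assumes "0 < q" "0 < R"
  shows "(\<integral>\<^sup>+z. indicator (ball 0 R) z * ennreal (norm z powr (q - DIM('a))) \<partial>(lborel :: 'a::euclidean_space measure))
    \<le> ennreal (2 powr (DIM('a) + 2 * q + 1) * unit_ball_vol DIM('a) * (R powr q / q))"
proof -
  let ?a = "q - DIM('a)"
  have "((\<lambda>t. t powr (q - 1)) has_integral ((2 * R) powr q / q)) {0..2 * R}"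
    using has_integral_powr_from_0[of "q - 1" "2 * R"] assms by simp
  then have I: "(\<integral>\<^sup>+t. ennreal (t powr (q - 1)) * indicator {0..2 * R} t \<partial>lborel) = ennreal ((2 * R) powr q / q)"
    by (intro nn_integral_has_integral_lebesgue'[unfolded nn_integral_completion]) auto
  have "(\<integral>\<^sup>+z. indicator (ball 0 R) z * ennreal (norm z powr ?a) \<partial>(lborel :: 'a measure))
    \<le> ennreal (2 powr (\<bar>?a\<bar> + 1) * unit_ball_vol DIM('a)) * (\<integral>\<^sup>+t. ennreal (t powr (?a + DIM('a) - 1)) * indicator {0..2 * R} t \<partial>lborel)"
    by (rule nn_integral_norm_powr_le) (auto simp: mem_ball_0 intro: order_trans[OF norm_ge_zero])
  also have "\<dots> = ennreal (2 powr (\<bar>?a\<bar> + 1) * unit_ball_vol DIM('a) * ((2 * R) powr q / q))"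
    using I assms by (simp add: ennreal_mult[symmetric])
  also have "\<dots> \<le> ennreal (2 powr (DIM('a) + q + 1) * unit_ball_vol DIM('a) * ((2 * R) powr q / q))"
    using assms by (intro ennreal_leI mult_right_mono powr_mono) auto
  also have "2 powr (DIM('a) + q + 1) * unit_ball_vol DIM('a) * ((2 * R) powr q / q)
      = 2 powr (DIM('a) + q + 1) * 2 powr q * unit_ball_vol DIM('a) * (R powr q / q)"
    using assms by (simp add: powr_mult)
  also have "2 powr (DIM('a) + q + 1) * 2 powr q = 2 powr (DIM('a) + 2 * q + 1)"
    by (simp add: powr_add[symmetric] algebra_simps)
  finally show ?thesis .
qed

lemma nn_integral_norm_powr_outside_ball:
  fixes R q :: real
  assumes "0 < q" "0 < R"
  shows "(\<integral>\<^sup>+z. indicator (- ball 0 R) z * ennreal (norm z powr (- (DIM('a) + q))) \<partial>(lborel :: 'a::euclidean_space measure))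
    \<le> ennreal (2 powr (DIM('a) + q + 1) * unit_ball_vol DIM('a) * (R powr (- q) / q))"
proof -
  let ?a = "- (DIM('a) + q)"
  have "((\<lambda>t::real. t powr (- q)) \<longlongrightarrow> 0) at_top"
    using assms by (intro tendsto_neg_powr filterlim_ident) auto
  from tendsto_minus[OF tendsto_divide_zero[OF this]]
  have lim: "((\<lambda>t. - (t powr (- q) / q)) \<longlongrightarrow> 0) at_top" by simp
  have I: "(\<integral>\<^sup>+t. ennreal (t powr (- q - 1)) * indicator {R..} t \<partial>lborel) = ennreal (0 - - (R powr (- q) / q))"
    using assms by (intro nn_integral_FTC_atLeast lim) (auto intro!: derivative_eq_intros)
  have "(\<integral>\<^sup>+z. indicator (- ball 0 R) z * ennreal (norm z powr ?a) \<partial>(lborel :: 'a measure))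
    \<le> ennreal (2 powr (\<bar>?a\<bar> + 1) * unit_ball_vol DIM('a)) * (\<integral>\<^sup>+t. ennreal (t powr (?a + DIM('a) - 1)) * indicator {R..} t \<partial>lborel)"
    by (rule nn_integral_norm_powr_le) auto
  also have "?a + DIM('a) - 1 = - q - 1" by simp
  also have "\<bar>?a\<bar> = DIM('a) + q" using assms by simp
  finally show ?thesis using I assms by (simp add: ennreal_mult[symmetric])
qed

section \<open>Pointwise inequalities\<close>

text \<open>The left-hand side is at most the \<open>p\<close>-th power of the larger of \<open>X\<close> and \<open>Y\<close>. With \<open>X\<close> a
  weighted gradient or difference quotient this absorbs the mixed term in every Caccioppoli estimate below.\<close>

lemma powr_mult_le_add_powr:
  fixes X Y p :: real
  assumes "1 < p" "0 \<le> X" "0 \<le> Y"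
  shows "X powr (p - 1) * Y \<le> X powr p + Y powr p"
proof -
  have m: "Z powr (p - 1) * Z = Z powr p" if "0 \<le> Z" for Z :: real
    using that powr_add[of Z "p - 1" 1] by (cases "Z = 0") auto
  show ?thesis
  proof (cases "X \<le> Y")
    case True
    have "X powr (p - 1) * Y \<le> Y powr (p - 1) * Y"
      using True assms by (intro mult_right_mono powr_mono2) auto
    then show ?thesis using m[OF assms(3)] by (simp add: add_increasing)
  next
    case False
    have "X powr (p - 1) * Y \<le> X powr (p - 1) * X"
      using False assms by (intro mult_left_mono) auto
    then show ?thesis using m[OF assms(2)] by (simp add: add_increasing2)
  qed
qed

lemma abs_powr_mult_self: "\<bar>\<bar>d\<bar> powr (p - 2) * d\<bar> = \<bar>d\<bar> powr (p - 1)" for d p :: real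
proof -
  have "\<bar>d\<bar> powr (p - 2) * \<bar>d\<bar> = \<bar>d\<bar> powr (p - 1)"
    using powr_add[of "\<bar>d\<bar>" "p - 2" 1] by (cases "d = 0") auto
  then show ?thesis by (simp add: abs_mult)
qed

lemma powr_mult_self_square: "\<bar>d\<bar> powr (p - 2) * d * d = \<bar>d\<bar> powr p" for d p :: real
proof -
  have "\<bar>d\<bar> powr (p - 2) * (d * d) = \<bar>d\<bar> powr (p - 2) * (\<bar>d\<bar> * \<bar>d\<bar>)" by simp
  also have "\<dots> = \<bar>d\<bar> powr p"
    using powr_add[of "\<bar>d\<bar>" "p - 2" 1] powr_add[of "\<bar>d\<bar>" "p - 1" 1] by (cases "d = 0") auto
  finally show ?thesis by (simp add: mult.assoc)
qed

text \<open>If \<open>f2 \<le> f1\<close>, the product splits into \<open>(\<bar>a - b\<bar> f1)\<^sup>p\<close> and a remainder that is at most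
  \<open>(\<bar>a - b\<bar> f1)\<^bsup>p-1\<^esup> 2 k p (f1 - f2)\<close> in modulus by convexity of the power; the first absorbs the second up to
  \<open>(2 k p (f1 - f2))\<^sup>p\<close>. The other case is symmetric. The cutoff enters as a \<open>p\<close>-th power so that the weight of the remainder matches.\<close>

lemma Caccioppoli_pointwise:
  fixes a b f1 f2 k p :: real
  assumes p: "1 < p" and ab: "\<bar>a\<bar> \<le> 2 * k" "\<bar>b\<bar> \<le> 2 * k" and f: "0 \<le> f1" "0 \<le> f2"
  shows "- ((2 * k * p * \<bar>f1 - f2\<bar>) powr p)
    \<le> \<bar>a - b\<bar> powr (p - 2) * (a - b) * (a * f1 powr p - b * f2 powr p)"
proof -
  have main: "- ((2 * k * p * (f1 - f2)) powr p)
    \<le> \<bar>a - b\<bar> powr (p - 2) * (a - b) * (a * f1 powr p - b * f2 powr p)"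
    if b: "\<bar>b\<bar> \<le> 2 * k" and f: "f2 \<le> f1" "0 \<le> f2" for a b f1 f2 :: real
  proof -
    define d where "d = \<bar>a - b\<bar>"
    have k: "0 \<le> k" using b by linarith
    have tangent: "f1 powr p - f2 powr p \<le> p * f1 powr (p - 1) * (f1 - f2)"
      using powr_tangent[OF p, of f1 f2] f p powr_add[of f1 "p - 1" 1]
      by (cases "f1 = 0") (auto simp: algebra_simps)
    have nn: "0 \<le> f1 powr p - f2 powr p" using f p by (simp add: powr_mono2)
    have "\<bar>\<bar>a - b\<bar> powr (p - 2) * (a - b) * (b * (f1 powr p - f2 powr p))\<bar>
        = d powr (p - 1) * (\<bar>b\<bar> * (f1 powr p - f2 powr p))"
      unfolding abs_mult[of "\<bar>a - b\<bar> powr (p - 2) * (a - b)"] abs_powr_mult_self d_def using nn by (simp add: abs_mult)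
    also have "\<dots> \<le> d powr (p - 1) * (2 * k * (p * f1 powr (p - 1) * (f1 - f2)))"
      using b tangent nn k by (intro mult_left_mono mult_mono) auto
    also have "\<dots> = (d * f1) powr (p - 1) * (2 * k * p * (f1 - f2))"
      using f by (simp add: powr_mult d_def)
    finally have 1: "\<bar>\<bar>a - b\<bar> powr (p - 2) * (a - b) * (b * (f1 powr p - f2 powr p))\<bar>
      \<le> (d * f1) powr (p - 1) * (2 * k * p * (f1 - f2))" .
    have 2: "\<bar>a - b\<bar> powr (p - 2) * (a - b) * (a * f1 powr p - b * f2 powr p)
      = (d * f1) powr p + \<bar>a - b\<bar> powr (p - 2) * (a - b) * (b * (f1 powr p - f2 powr p))"
    proof -
      have "(d * f1) powr p = \<bar>a - b\<bar> powr (p - 2) * (a - b) * (a - b) * f1 powr p"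
        using f by (simp add: powr_mult_self_square powr_mult d_def)
      then show ?thesis by (simp add: algebra_simps)
    qed
    have "(d * f1) powr (p - 1) * (2 * k * p * (f1 - f2)) \<le> (d * f1) powr p + (2 * k * p * (f1 - f2)) powr p"
      using p f k by (intro powr_mult_le_add_powr) (auto simp: d_def)
    with 1 2 show ?thesis by linarith
  qed
  show ?thesis
  proof (cases "f2 \<le> f1")
    case True
    then show ?thesis using main[of b f2 f1 a] ab f by simp
  next
    case False
    have "\<bar>b - a\<bar> powr (p - 2) * (b - a) * (b * f2 powr p - a * f1 powr p)
      = \<bar>a - b\<bar> powr (p - 2) * (a - b) * (a * f1 powr p - b * f2 powr p)"
      by (simp add: abs_minus_commute algebra_simps)
    moreover have "- ((2 * k * p * (f2 - f1)) powr p)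
      \<le> \<bar>b - a\<bar> powr (p - 2) * (b - a) * (b * f2 powr p - a * f1 powr p)"
      using ab f False by (intro main) auto
    ultimately show ?thesis using False by (simp only: abs_of_neg) simp
  qed
qed

lemma add_powr_le:
  fixes a b q :: real
  assumes "0 \<le> a" "0 \<le> b" "0 \<le> q"
  shows "(a + b) powr q \<le> 2 powr q * (a powr q + b powr q)"
proof -
  have "(a + b) powr q \<le> (2 * max a b) powr q" using assms by (intro powr_mono2) auto
  also have "\<dots> = 2 powr q * max a b powr q" using assms by (simp add: powr_mult)
  also have "\<dots> \<le> 2 powr q * (a powr q + b powr q)" by (intro mult_left_mono) (auto simp: max_def)
  finally show ?thesis .
qed

text \<open>Here \<open>a\<close> is a value of \<open>u\<close> inside the ball and \<open>b\<close> one outside. For \<open>b > a\<close> both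
  factors are negative and the product is at least \<open>k (b - a)\<^bsup>p-1\<^esup>\<close>, where \<open>b - a \<ge> b/2\<close> as soon as
  \<open>b \<ge> 2 k\<close>; for smaller \<open>b\<close> the subtracted \<open>k\<^sup>p\<close> makes the inequality trivial. For \<open>b \<le> a\<close> the product
  is not positive, but \<open>a - b\<close> is at most \<open>k\<close> plus the negative part of \<open>b\<close>.\<close>

lemma cross_term_ge:
  fixes a b k p :: real
  assumes p: "1 < p" and a: "0 \<le> a" "a \<le> k" and k: "0 < k"
  shows "2 powr (1 - p) * k * max b 0 powr (p - 1) - (2 powr p + 1) * (k powr p + k * max (- b) 0 powr (p - 1))
    \<le> \<bar>a - b\<bar> powr (p - 2) * (a - b) * (a - 2 * k)"
proof -
  have kp: "k * k powr (p - 1) = k powr p" using k powr_add[of k 1 "p - 1"] by simp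
  have C: "k powr p \<le> (2 powr p + 1) * (k powr p + k * max (- b) 0 powr (p - 1))"
  proof -
    have "1 * k powr p \<le> (2 powr p + 1) * (k powr p + k * max (- b) 0 powr (p - 1))"
      using k by (intro mult_mono) auto
    then show ?thesis by simp
  qed
  show ?thesis
  proof (cases "a < b")
    case True
    have J: "\<bar>a - b\<bar> powr (p - 2) * (a - b) = - ((b - a) powr (p - 1))"
      using True abs_powr_mult_self[of "a - b" p] by (smt (verit) mult_nonneg_nonpos powr_ge_zero)
    have "(b - a) powr (p - 1) * k \<le> (b - a) powr (p - 1) * (2 * k - a)"
      using a by (intro mult_left_mono) auto
    also have "\<dots> = \<bar>a - b\<bar> powr (p - 2) * (a - b) * (a - 2 * k)"
      unfolding J by (simp add: algebra_simps)
    finally have 1: "(b - a) powr (p - 1) * k \<le> \<bar>a - b\<bar> powr (p - 2) * (a - b) * (a - 2 * k)" .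
    show ?thesis
    proof (cases "2 * k \<le> b")
      case True
      have "2 powr (1 - p) * b powr (p - 1) = (b / 2) powr (p - 1)"
        using True k by (simp add: powr_divide powr_diff)
      also have "\<dots> \<le> (b - a) powr (p - 1)" using True a k p by (intro powr_mono2) auto
      finally have "2 powr (1 - p) * b powr (p - 1) * k \<le> (b - a) powr (p - 1) * k"
        using k by (intro mult_right_mono) auto
      moreover have "0 \<le> k powr p" by simp
      moreover have "2 powr (1 - p) * k * b powr (p - 1) = 2 powr (1 - p) * b powr (p - 1) * k"
        by (simp only: mult_ac)
      moreover have b: "max b 0 = b" using True k by simp
      ultimately show ?thesis using 1 C unfolding b by linarith
    next
      case False
      have "2 powr (1 - p) * max b 0 powr (p - 1) \<le> 2 powr (1 - p) * (2 * k) powr (p - 1)"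
        using False \<open>a < b\<close> a k p by (intro mult_left_mono powr_mono2) auto
      also have "\<dots> = k powr (p - 1)" using k by (simp add: powr_mult powr_diff)
      finally have "2 powr (1 - p) * max b 0 powr (p - 1) * k \<le> k powr p"
        using k kp by (metis less_imp_le mult.commute mult_right_mono)
      moreover have "0 \<le> (b - a) powr (p - 1) * k" using k by simp
      moreover have "2 powr (1 - p) * k * max b 0 powr (p - 1) = 2 powr (1 - p) * max b 0 powr (p - 1) * k"
        by (simp only: mult_ac)
      ultimately show ?thesis using 1 C by linarith
    qed
  next
    case False
    have J: "\<bar>a - b\<bar> powr (p - 2) * (a - b) = (a - b) powr (p - 1)"
      using False abs_powr_mult_self[of "a - b" p] by simp
    have "(a - b) powr (p - 1) \<le> (k + max (- b) 0) powr (p - 1)" using False a p by (intro powr_mono2) auto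
    also have "\<dots> \<le> 2 powr (p - 1) * (k powr (p - 1) + max (- b) 0 powr (p - 1))"
      using k p by (intro add_powr_le) auto
    finally have "(a - b) powr (p - 1) * (2 * k - a) \<le> 2 powr (p - 1) * (k powr (p - 1) + max (- b) 0 powr (p - 1)) * (2 * k)"
      using a k by (intro mult_mono) auto
    also have "\<dots> = 2 powr p * (k * k powr (p - 1) + k * max (- b) 0 powr (p - 1))"
      by (simp add: powr_diff algebra_simps)
    finally have 1: "(a - b) powr (p - 1) * (2 * k - a) \<le> 2 powr p * (k powr p + k * max (- b) 0 powr (p - 1))"
      unfolding kp .
    have "2 powr (1 - p) * max b 0 powr (p - 1) \<le> 1 * k powr (p - 1)"
      using False a k p powr_mono[of "1 - p" 0 2] by (intro mult_mono powr_mono2) auto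
    then have "2 powr (1 - p) * max b 0 powr (p - 1) * k \<le> k powr p"
      using k kp by (metis less_imp_le mult.commute mult_1 mult_right_mono)
    moreover have "0 \<le> k * max (- b) 0 powr (p - 1)" using k by simp
    ultimately show ?thesis unfolding J using 1 by (simp add: algebra_simps)
  qed
qed

lemma cross_term_abs_le:
  fixes a b k p :: real
  assumes p: "1 < p" and a: "0 \<le> a" "a \<le> k" and k: "0 < k"
  shows "\<bar>\<bar>a - b\<bar> powr (p - 2) * (a - b) * (a - 2 * k)\<bar> \<le> 2 powr p * (k powr p + k * \<bar>b\<bar> powr (p - 1))"
proof -
  have kp: "k * k powr (p - 1) = k powr p" using k powr_add[of k 1 "p - 1"] by simp
  have "\<bar>a - b\<bar> powr (p - 1) \<le> (k + \<bar>b\<bar>) powr (p - 1)" using a p by (intro powr_mono2) auto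
  also have "\<dots> \<le> 2 powr (p - 1) * (k powr (p - 1) + \<bar>b\<bar> powr (p - 1))"
    using k p by (intro add_powr_le) auto
  finally have "\<bar>a - b\<bar> powr (p - 1) * \<bar>a - 2 * k\<bar> \<le> 2 powr (p - 1) * (k powr (p - 1) + \<bar>b\<bar> powr (p - 1)) * (2 * k)"
    using a k by (intro mult_mono) auto
  also have "\<dots> = 2 powr p * (k * k powr (p - 1) + k * \<bar>b\<bar> powr (p - 1))"
    by (simp add: powr_diff algebra_simps)
  finally show ?thesis unfolding kp abs_mult[of _ "a - 2 * k"] abs_powr_mult_self .
qed

text \<open>With \<open>G\<close> the gradient of \<open>w\<close> and \<open>D\<close> that of \<open>f\<^sup>p\<close>, the vector paired with \<open>G\<close> is the gradient of
  \<open>w f\<^sup>p\<close>. The bound on \<open>D\<close> is what differentiating a \<open>p\<close>-th power gives, and \<open>(norm G * f)\<^sup>p\<close> absorbs the mixed term.\<close>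

lemma local_term_ge:
  fixes G D :: "'a::euclidean_space" and w f k p L :: real
  assumes p: "1 < p" and w: "\<bar>w\<bar> \<le> 2 * k" and f: "0 \<le> f" and L: "0 \<le> L" and D: "norm D \<le> L * f powr (p - 1)"
  shows "- ((2 * k * L) powr p) \<le> norm G powr (p - 2) * (G \<bullet> (f powr p *\<^sub>R G + w *\<^sub>R D))"
proof -
  have k: "0 \<le> k" using w by linarith
  have "norm G powr (p - 2) * (norm G * norm G) = norm G powr p"
    using powr_mult_self_square[of "norm G" p] by (simp add: mult.assoc)
  then have 1: "norm G powr (p - 2) * (G \<bullet> G) * f powr p = (norm G * f) powr p"
    using f by (simp add: powr_mult power2_norm_eq_inner[symmetric] power2_eq_square)
  have "\<bar>norm G powr (p - 2) * (w * (G \<bullet> D))\<bar> \<le> norm G powr (p - 2) * (2 * k * (norm G * (L * f powr (p - 1))))"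
    unfolding abs_mult using w D k L
    by (intro mult_mono order_trans[OF Cauchy_Schwarz_ineq2] mult_nonneg_nonneg) auto
  also have "\<dots> = (norm G * f) powr (p - 1) * (2 * k * L)"
    using abs_powr_mult_self[of "norm G" p] f by (simp add: powr_mult)
  finally have 2: "- ((norm G * f) powr (p - 1) * (2 * k * L)) \<le> norm G powr (p - 2) * (w * (G \<bullet> D))"
    by linarith
  have "(norm G * f) powr (p - 1) * (2 * k * L) \<le> (norm G * f) powr p + (2 * k * L) powr p"
    using p f k L by (intro powr_mult_le_add_powr) auto
  then have "- ((2 * k * L) powr p) \<le> norm G powr (p - 2) * (G \<bullet> G) * f powr p + norm G powr (p - 2) * (w * (G \<bullet> D))"
    using 1 2 by linarith
  then show ?thesis by (simp add: inner_add_right algebra_simps)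
qed

text \<open>The distances from \<open>y\<close> to \<open>x\<close> and to the centre differ by a factor of at most two. The bound
  \<open>E\<close> on the exponent makes the comparison uniform in the order of the kernel.\<close>

lemma kernel_comparison:
  fixes x y x0 :: "'a::real_normed_vector"
  assumes x: "norm (x - x0) < r / 2" and y: "r \<le> norm (y - x0)" and e: "0 \<le> e" "e \<le> E"
  shows "2 powr (- E) * norm (y - x0) powr (- e) \<le> norm (x - y) powr (- e)"
    and "norm (x - y) powr (- e) \<le> 2 powr E * norm (y - x0) powr (- e)"
proof -
  have r: "0 < r" using x norm_ge_zero[of "x - x0"] by linarith
  have d: "norm (y - x0) > 0" using r y by linarith
  have t: "norm (y - x0) \<le> norm (x - y) + norm (x - x0)" "norm (x - y) \<le> norm (y - x0) + norm (x - x0)"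
    using norm_triangle_ineq4[of "x - x0" "x - y"] norm_triangle_ineq4[of "x - x0" "y - x0"]
    by (auto simp: norm_minus_commute)
  then have u: "norm (x - y) \<le> 2 * norm (y - x0)" and l: "norm (y - x0) / 2 \<le> norm (x - y)"
    using x y by linarith+
  have "2 powr (- E) * norm (y - x0) powr (- e) \<le> 2 powr (- e) * norm (y - x0) powr (- e)"
    using e by (intro mult_right_mono powr_mono) auto
  also have "\<dots> = (2 * norm (y - x0)) powr (- e)" by (simp add: powr_mult)
  also have "\<dots> \<le> norm (x - y) powr (- e)" using l u d e by (intro powr_mono2') auto
  finally show "2 powr (- E) * norm (y - x0) powr (- e) \<le> norm (x - y) powr (- e)" .
  have "norm (x - y) powr (- e) \<le> (norm (y - x0) / 2) powr (- e)" using l d e by (intro powr_mono2') auto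
  also have "\<dots> = 2 powr e * norm (y - x0) powr (- e)" by (simp add: powr_divide powr_minus field_simps)
  also have "\<dots> \<le> 2 powr E * norm (y - x0) powr (- e)"
    using e by (intro mult_right_mono powr_mono) auto
  finally show "norm (x - y) powr (- e) \<le> 2 powr E * norm (y - x0) powr (- e)" .
qed

section \<open>The radial cutoff\<close>

text \<open>With the profile \<open>exp (-1/t)\<close> the \<open>p\<close>-th root of a cutoff is again a cutoff, with \<open>c\<close> replaced
  by \<open>p c\<close>. Hence \<open>cutoff 1\<close> can be the weight in the test function while its \<open>p\<close>-th root \<open>cutoff p\<close>, to which
  the Caccioppoli inequality applies, is Lipschitz.\<close>

definition cutoff :: "real \<Rightarrow> 'a::euclidean_space \<Rightarrow> real \<Rightarrow> 'a \<Rightarrow> real" where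
  "cutoff c x0 \<rho> x = flat 0 (c * (1 - (norm (x - x0) / \<rho>)\<^sup>2))"

lemma flat_2_le: "flat 2 t \<le> 4"
proof (cases "0 < t")
  case True
  have "(1 / t / 2)\<^sup>2 \<le> (exp (1 / t / 2))\<^sup>2"
  proof (rule power_mono)
    show "1 / t / 2 \<le> exp (1 / t / 2)" using exp_ge_add_one_self[of "1 / t / 2"] by linarith
  qed (use True in simp)
  also have "(exp (1 / t / 2))\<^sup>2 = exp (1 / t)" by (simp add: power2_eq_square exp_add[symmetric])
  finally have "(1 / t)\<^sup>2 \<le> 4 * exp (1 / t)" by (simp add: power_divide)
  then have "(1 / t)\<^sup>2 * exp (- (1 / t)) \<le> 4 * exp (1 / t) * exp (- (1 / t))" by (intro mult_right_mono) auto
  also have "\<dots> = 4" by (simp add: mult.assoc exp_add[symmetric])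
  finally show ?thesis using True by (simp add: flat_def)
qed (simp add: flat_def)

lemma flat_0_Lipschitz: "\<bar>flat 0 s - flat 0 t\<bar> \<le> 4 * \<bar>s - t\<bar>"
proof -
  have "(flat 0 has_field_derivative flat 2 t) (at t)" for t
    using flat_has_derivative[of 0 t] by (simp add: numeral_2_eq_2)
  then have "(flat 0 has_field_derivative flat 2 t) (at t within UNIV)" for t by simp
  then have "norm (flat 0 s - flat 0 t) \<le> 4 * norm (s - t)"
    by (intro field_differentiable_bound[of UNIV "flat 0" "flat 2"]) (auto simp: flat_2_le)
  then show ?thesis by simp
qed

lemma cutoff_nonneg: "0 \<le> cutoff c x0 \<rho> x"
  and cutoff_le_1: "cutoff c x0 \<rho> x \<le> 1"
  by (auto simp: cutoff_def flat_0_le_1)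

lemma cutoff_powr: "0 < p \<Longrightarrow> cutoff p x0 \<rho> x powr p = cutoff 1 x0 \<rho> x"
  by (auto simp: cutoff_def flat_def zero_less_mult_iff powr_def)

lemma cutoff_nonzero_iff:
  assumes "0 < \<rho>" "0 < c" shows "cutoff c x0 \<rho> x \<noteq> 0 \<longleftrightarrow> x \<in> ball x0 \<rho>"
proof -
  have "(norm (x - x0) / \<rho>)\<^sup>2 < 1 \<longleftrightarrow> norm (x - x0) < \<rho>"
    using assms by (simp add: power_less_one_iff)
  then show ?thesis using assms
    by (auto simp: cutoff_def flat_def dist_norm norm_minus_commute zero_less_mult_iff)
qed

lemma cutoff_Lipschitz:
  assumes \<rho>: "0 < \<rho>" and c: "0 < c" and x: "x \<in> ball x0 (2 * \<rho>)" and y: "y \<in> ball x0 (2 * \<rho>)"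
  shows "\<bar>cutoff c x0 \<rho> x - cutoff c x0 \<rho> y\<bar> \<le> 16 * c / \<rho> * norm (x - y)"
proof -
  let ?X = "norm (x - x0)" and ?Y = "norm (y - x0)"
  have "\<bar>cutoff c x0 \<rho> x - cutoff c x0 \<rho> y\<bar> \<le> 4 * \<bar>c * (1 - (?X / \<rho>)\<^sup>2) - c * (1 - (?Y / \<rho>)\<^sup>2)\<bar>"
    unfolding cutoff_def by (rule flat_0_Lipschitz)
  also have "c * (1 - (?X / \<rho>)\<^sup>2) - c * (1 - (?Y / \<rho>)\<^sup>2) = c / \<rho>\<^sup>2 * ((?Y - ?X) * (?Y + ?X))"
    using \<rho> by (simp add: field_simps power2_eq_square)
  also have "\<bar>\<dots>\<bar> = c / \<rho>\<^sup>2 * (\<bar>?Y - ?X\<bar> * (?Y + ?X))" using c by (simp add: abs_mult)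
  also have "4 * \<dots> \<le> 4 * (c / \<rho>\<^sup>2 * (norm (x - y) * (4 * \<rho>)))"
  proof (intro mult_left_mono mult_mono)
    show "\<bar>?Y - ?X\<bar> \<le> norm (x - y)"
      using norm_triangle_ineq3[of "y - x0" "x - x0"] by (simp add: norm_minus_commute)
    show "?Y + ?X \<le> 4 * \<rho>" using x y by (simp add: dist_norm norm_minus_commute)
  qed (use c \<rho> in auto)
  also have "\<dots> = 16 * c / \<rho> * norm (x - y)" using \<rho> by (simp add: field_simps power2_eq_square)
  finally show ?thesis .
qed

lemma cutoff_ge:
  assumes \<rho>: "0 < \<rho>" and x: "x \<in> ball x0 (\<rho> / 2)"
  shows "exp (- 2) \<le> cutoff 1 x0 \<rho> x"
proof -
  have "norm (x - x0) / \<rho> \<le> 1 / 2" using x \<rho> by (simp add: dist_norm norm_minus_commute field_simps)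
  then have "(norm (x - x0) / \<rho>)\<^sup>2 \<le> (1 / 2)\<^sup>2" using \<rho> by (intro power_mono) auto
  also have "(1 / 2 :: real)\<^sup>2 \<le> 1 / 2" by (simp add: power2_eq_square)
  finally have t: "1 / 2 \<le> 1 - (norm (x - x0) / \<rho>)\<^sup>2" by linarith
  then have "1 / (1 - (norm (x - x0) / \<rho>)\<^sup>2) \<le> 2" by (simp add: field_simps)
  then show ?thesis using t by (simp add: cutoff_def flat_def)
qed

lemma norm_square_has_derivative:
  fixes x :: "'a::euclidean_space"
  shows "((\<lambda>x. 1 * (1 - (norm (x - x0) / \<rho>)\<^sup>2)) has_derivative (\<lambda>h. - (2 / \<rho>\<^sup>2) * ((x - x0) \<bullet> h))) (at x)"
proof -
  have "((\<lambda>x. 1 - ((x - x0) \<bullet> (x - x0)) / \<rho>\<^sup>2) has_derivative (\<lambda>h. - ((x - x0) \<bullet> h + h \<bullet> (x - x0)) / \<rho>\<^sup>2)) (at x)"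
    by (auto intro!: derivative_eq_intros simp: divide_inverse algebra_simps)
  then show ?thesis
    by (simp add: power_divide power2_norm_eq_inner inner_commute divide_inverse power_inverse algebra_simps)
qed

lemma cutoff_has_derivative:
  "(cutoff 1 x0 \<rho> has_derivative
    (\<lambda>h. flat 2 (1 - (norm (x - x0) / \<rho>)\<^sup>2) * (- (2 / \<rho>\<^sup>2) * ((x - x0) \<bullet> h)))) (at x)"
proof -
  have "(flat 0 has_field_derivative flat 2 t) (at t)" for t
    using flat_has_derivative[of 0 t] by (simp add: numeral_2_eq_2)
  from has_derivative_compose[OF norm_square_has_derivative this[unfolded has_field_derivative_def]]
  show ?thesis unfolding cutoff_def[abs_def] by simp
qed

lemma C_k_cutoff: "C_k k (cutoff c x0 \<rho>)"
proof -
  have "C_k k (\<lambda>x. c * (1 - (1 / \<rho>\<^sup>2) * (\<Sum>b\<in>Basis. (x - x0) \<bullet> b * ((x - x0) \<bullet> b))))" for k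
    by (intro C_k_mult C_k_diff C_k_const C_k_sum C_k_shift[where f = "\<lambda>x. x \<bullet> _"] C_k_inner_left)
  moreover have "(norm (x - x0) / \<rho>)\<^sup>2 = (1 / \<rho>\<^sup>2) * (\<Sum>b\<in>Basis. (x - x0) \<bullet> b * ((x - x0) \<bullet> b))" for x
    unfolding euclidean_inner[symmetric] by (simp add: power_divide power2_norm_eq_inner)
  ultimately have "C_k k (\<lambda>x. c * (1 - (norm (x - x0) / \<rho>)\<^sup>2))" for k
    by simp
  then show ?thesis unfolding cutoff_def[abs_def] by (rule C_k_flat_compose)
qed

lemma test_function_cutoff:
  assumes "0 < \<rho>" "0 < c" "cball x0 \<rho> \<subseteq> S"
  shows "test_function S (cutoff c x0 \<rho>)"
proof -
  have "closure {x. cutoff c x0 \<rho> x \<noteq> 0} \<subseteq> cball x0 \<rho>"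
    using cutoff_nonzero_iff[OF assms(1,2), of x0] by (intro closure_minimal) auto
  moreover from this have "bounded (closure {x. cutoff c x0 \<rho> x \<noteq> 0})"
    using bounded_cball bounded_subset by blast
  ultimately show ?thesis unfolding test_function_def using assms(3)
    by (auto simp: C_k_cutoff compact_eq_bounded_closed)
qed

text \<open>The derivative of the profile is \<open>t\<^sup>-\<^sup>2 exp (-1/t)\<close>. Splitting off the fraction
  \<open>exp (-1/(p t))\<close> of the exponential bounds \<open>t\<^sup>-\<^sup>2\<close> and leaves the power \<open>(p-1)/p\<close> of the cutoff.\<close>

lemma cutoff_derivative_le:
  assumes \<rho>: "0 < \<rho>" and p: "1 < p"
  shows "\<bar>frechet_derivative (cutoff 1 x0 \<rho>) (at x) h\<bar> \<le> 8 * p\<^sup>2 / \<rho> * cutoff p x0 \<rho> x powr (p - 1) * norm h"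
proof -
  define t where "t = 1 - (norm (x - x0) / \<rho>)\<^sup>2"
  have eq: "frechet_derivative (cutoff 1 x0 \<rho>) (at x) h = flat 2 t * (- (2 / \<rho>\<^sup>2) * ((x - x0) \<bullet> h))"
    using frechet_derivative_at[OF cutoff_has_derivative] unfolding t_def by metis
  show ?thesis
  proof (cases "0 < t")
    case True
    then have "(norm (x - x0) / \<rho>)\<^sup>2 < 1" by (simp add: t_def)
    then have x: "norm (x - x0) \<le> \<rho>" using \<rho> by (simp add: power_less_one_iff)
    have pt: "0 < p * t" using True p by simp
    have "exp (- (1 / t)) = exp (- (1 / (p * t))) * exp (- (1 / (p * t)) * (p - 1))"
      using True p by (simp add: exp_add[symmetric] field_simps)
    then have "flat 2 t = p\<^sup>2 * flat 2 (p * t) * flat 0 (p * t) powr (p - 1)"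
      using True pt p by (simp add: flat_def powr_def field_simps power2_eq_square)
    also have "\<dots> \<le> p\<^sup>2 * 4 * flat 0 (p * t) powr (p - 1)"
      by (intro mult_right_mono mult_left_mono flat_2_le) auto
    finally have f: "flat 2 t \<le> 4 * p\<^sup>2 * cutoff p x0 \<rho> x powr (p - 1)"
      by (simp add: cutoff_def t_def mult_ac)
    have "\<bar>frechet_derivative (cutoff 1 x0 \<rho>) (at x) h\<bar> = flat 2 t * (2 / \<rho>\<^sup>2 * \<bar>(x - x0) \<bullet> h\<bar>)"
      unfolding eq by (simp add: abs_mult)
    also have "\<dots> \<le> 4 * p\<^sup>2 * cutoff p x0 \<rho> x powr (p - 1) * (2 / \<rho>\<^sup>2 * (\<rho> * norm h))"
      using x \<rho> f
      by (intro mult_mono mult_left_mono order_trans[OF Cauchy_Schwarz_ineq2] mult_right_mono mult_nonneg_nonneg) auto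
    also have "\<dots> = 8 * p\<^sup>2 / \<rho> * cutoff p x0 \<rho> x powr (p - 1) * norm h"
      using \<rho> by (simp add: field_simps power2_eq_square)
    finally show ?thesis .
  next
    case False
    then show ?thesis unfolding eq using \<rho> p by (simp add: flat_def)
  qed
qed

section \<open>The test function\<close>

lemma sets_borel_ball [measurable]: "ball x r \<in> sets borel" and sets_borel_cball [measurable]: "cball x r \<in> sets borel"
  by simp_all

lemma
  fixes f :: "'a::euclidean_space \<Rightarrow> 'b::euclidean_space"
  assumes "S \<in> sets lebesgue"
  shows integrable_lebesgue_on_iff: "integrable (lebesgue_on S) f \<longleftrightarrow> integrable lebesgue (\<lambda>x. indicator S x *\<^sub>R f x)"
    and integral_lebesgue_on_eq: "integral\<^sup>L (lebesgue_on S) f = (LINT x|lebesgue. indicator S x *\<^sub>R f x)"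
    and borel_measurable_lebesgue_on_iff:
      "f \<in> borel_measurable (lebesgue_on S) \<longleftrightarrow> (\<lambda>x. indicator S x *\<^sub>R f x) \<in> borel_measurable lebesgue"
  using assms by (simp_all add: integrable_restrict_space integral_restrict_space borel_measurable_restrict_space_iff)

lemma L_p_1_iff: "L_p 1 S f \<longleftrightarrow> integrable (lebesgue_on S) f"
  for f :: "'a::euclidean_space \<Rightarrow> 'b::euclidean_space"
  unfolding L_p_def by (auto simp: integrable_norm_iff)

lemma L_p_dominated:
  fixes f :: "'a::euclidean_space \<Rightarrow> 'b::euclidean_space"
  assumes f: "f \<in> borel_measurable lebesgue" and g: "integrable lebesgue g"
    and le: "AE x in lebesgue. norm (f x) powr q \<le> g x" and S: "S \<in> sets lebesgue"
  shows "L_p q S f"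
proof -
  have "integrable lebesgue (\<lambda>x. norm (f x) powr q)"
    by (rule Bochner_Integration.integrable_bound[OF g]) (use f le in auto)
  then have "integrable lebesgue (\<lambda>x. indicator S x *\<^sub>R (norm (f x) powr q))"
    using S by (rule integrable_mult_indicator[rotated])
  moreover have "(\<lambda>x. indicator S x *\<^sub>R f x) \<in> borel_measurable lebesgue" using f S by measurable
  ultimately show ?thesis
    using S by (simp add: L_p_def integrable_lebesgue_on_iff borel_measurable_lebesgue_on_iff)
qed

lemma integrable_mult_bounded_support:
  fixes w \<beta> :: "'a::euclidean_space \<Rightarrow> real"
  assumes w: "integrable (lebesgue_on K) w" and K: "K \<in> sets lebesgue" and \<beta>: "\<beta> \<in> borel_measurable borel"
    and M: "\<And>x. \<bar>\<beta> x\<bar> \<le> M" and zero: "\<And>x. x \<notin> K \<Longrightarrow> \<beta> x = 0"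
  shows "integrable lebesgue (\<lambda>x. w x * \<beta> x)"
proof -
  have [measurable]: "\<beta> \<in> borel_measurable lebesgue" using \<beta> by (simp add: measurable_completion)
  have w': "integrable lebesgue (\<lambda>x. indicator K x * w x)"
    using w K by (simp add: integrable_lebesgue_on_iff)
  have [measurable]: "(\<lambda>x. indicator K x * w x) \<in> borel_measurable lebesgue" using w' by auto
  have "integrable lebesgue (\<lambda>x. (indicator K x * w x) * \<beta> x)"
  proof (rule Bochner_Integration.integrable_bound)
    show "integrable lebesgue (\<lambda>x. M * (indicator K x * w x))" using w' by simp
    have "\<bar>indicator K x * w x\<bar> * \<bar>\<beta> x\<bar> \<le> \<bar>M\<bar> * \<bar>indicator K x * w x\<bar>" for x
      using mult_left_mono[of "\<bar>\<beta> x\<bar>" "\<bar>M\<bar>" "\<bar>indicator K x * w x\<bar>"] M[of x] by (simp add: mult.commute)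
    then show "AE x in lebesgue. norm ((indicator K x * w x) * \<beta> x) \<le> norm (M * (indicator K x * w x))"
      by (intro AE_I2) (simp only: real_norm_def abs_mult[of _ "\<beta> _"] abs_mult[of M])
  qed measurable
  moreover have "(indicator K x * w x) * \<beta> x = w x * \<beta> x" for x
    using zero[of x] by (auto split: split_indicator)
  ultimately show ?thesis by simp
qed

text \<open>Translating a test function does not change its integral, while the difference is an average of
  integrals of the derivative, all equal. The function \<open>U\<close> below is \<open>1\<close> on every support that occurs.\<close>

lemma integral_test_function_derivative:
  assumes \<psi>: "test_function S \<psi>"
  shows "(LINT x|lebesgue. frechet_derivative \<psi> (at x) h) = 0"
proof -
  let ?D = "\<lambda>x. frechet_derivative \<psi> (at x) h"
  note [measurable] = borel_measurable_test_function_derivative[OF \<psi>, of h] borel_measurable_test_function[OF \<psi>]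
  obtain M where M: "closure {x. \<psi> x \<noteq> 0} \<subseteq> ball 0 M"
    using \<psi> unfolding test_function_def by (metis bounded_subset_ballD compact_imp_bounded)
  \<comment> \<open>the translates of the support by \<open>t h\<close> with \<open>t \<le> 1\<close> stay in this ball\<close>
  define U where "U = (indicator (ball 0 (M + norm h)) :: 'a \<Rightarrow> real)"
  have U1: "U x * f (x - t *\<^sub>R h) = f (x - t *\<^sub>R h)"
    if f: "\<And>x. x \<notin> closure {x. \<psi> x \<noteq> 0} \<Longrightarrow> f x = 0" and t: "t \<in> {0..1}" for t x and f :: "'a \<Rightarrow> real"
  proof (cases "x - t *\<^sub>R h \<in> closure {x. \<psi> x \<noteq> 0}")
    case True
    then have "norm (x - t *\<^sub>R h) < M" using M by auto
    moreover have "norm x \<le> norm (x - t *\<^sub>R h) + norm (t *\<^sub>R h)" using norm_triangle_ineq[of "x - t *\<^sub>R h" "t *\<^sub>R h"] by simp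
    moreover have "norm (t *\<^sub>R h) \<le> norm h" using t by (simp add: mult_left_le_one_le)
    ultimately have "norm x < M + norm h" by linarith
    then show ?thesis by (simp add: U_def)
  next
    case False then show ?thesis using f by simp
  qed
  have z: "x \<notin> closure {x. \<psi> x \<noteq> 0} \<Longrightarrow> \<psi> x = 0" "x \<notin> closure {x. \<psi> x \<noteq> 0} \<Longrightarrow> ?D x = 0" for x
    by (rule test_function_zero[OF \<psi>] test_function_derivative_zero[OF \<psi>], assumption)+
  obtain B where B: "\<And>x. \<bar>\<psi> x\<bar> \<le> B" using test_function_bounded[OF \<psi>] by blast
  have int: "integrable lborel \<psi>"
  proof (rule Bochner_Integration.integrable_bound[where f = "\<lambda>x. B * indicator (ball 0 M) x"])
    show "integrable lborel (\<lambda>x. B * indicator (ball 0 M) x)"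
      by (intro integrable_mult_right integrable_real_indicator) (use emeasure_bounded_finite[OF bounded_ball] in auto)
    show "\<psi> \<in> borel_measurable lborel" using borel_measurable_test_function[OF \<psi>] by simp
    show "AE x in lborel. norm (\<psi> x) \<le> norm (B * indicator (ball 0 M) x)"
    proof (intro AE_I2)
      fix x
      show "norm (\<psi> x) \<le> norm (B * indicator (ball 0 M) x)"
      proof (cases "x \<in> ball 0 M")
        case True
        then show ?thesis using order_trans[OF B[of x] abs_ge_self] by simp
      next
        case False
        then have "x \<notin> closure {x. \<psi> x \<noteq> 0}" using M by blast
        then have "\<psi> x = 0" by (rule z(1))
        then show ?thesis by simp
      qed
    qed
  qed
  have U: "integrable lborel U"
    unfolding U_def by (intro integrable_real_indicator) (use emeasure_bounded_finite[OF bounded_ball] in auto)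
  have Uh: "U x * \<psi> (x - h) = \<psi> (x - h)" and U0: "U x * \<psi> x = \<psi> x" for x
    using U1[of \<psi> 1, OF z(1)] U1[of \<psi> 0, OF z(1)] by simp_all
  have "(LINT x|lborel. U x * (\<psi> (x - h) - \<psi> x)) = (LINT x|lborel. \<psi> (x - h) - \<psi> x)"
    by (simp only: right_diff_distrib Uh U0)
  also have "\<dots> = (LINT x|lborel. \<psi> (x - h)) - (LINT x|lborel. \<psi> x)"
    using int integrable_lborel_shift_iff[of \<psi> "-h"] borel_measurable_test_function[OF \<psi>] by (intro Bochner_Integration.integral_diff) auto
  also have "\<dots> = 0"
    using integral_lborel_shift[of \<psi> "- h"] borel_measurable_test_function[OF \<psi>] by simp
  finally have "0 = (LINT t|lborel. indicator {0..1} t * (LINT x|lborel. U x * ?D (x - t *\<^sub>R h)))"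
    using integral_times_translation_difference[OF U \<psi>, of h] by simp
  also have "\<dots> = (LINT t|lborel. indicator {0..1::real} t * (LINT x|lborel. ?D x))"
  proof (intro Bochner_Integration.integral_cong refl)
    fix t :: real
    show "indicator {0..1} t * (LINT x|lborel. U x * ?D (x - t *\<^sub>R h)) = indicator {0..1} t * (LINT x|lborel. ?D x)"
    proof (cases "t \<in> {0..1}")
      case True
      have "U x * ?D (x - t *\<^sub>R h) = ?D (x - t *\<^sub>R h)" for x
        by (rule U1[of ?D t, OF z(2) True])
      then have "(LINT x|lborel. U x * ?D (x - t *\<^sub>R h)) = (LINT x|lborel. ?D (x - t *\<^sub>R h))"
        by (simp only:)
      also have "\<dots> = (LINT x|lborel. ?D x)"
        using integral_lborel_shift[of ?D "- t *\<^sub>R h"] borel_measurable_test_function_derivative[OF \<psi>] by simp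
      finally show ?thesis by simp
    qed simp
  qed
  also have "\<dots> = (LINT x|lborel. ?D x)" by simp
  finally show ?thesis by (simp add: integral_completion)
qed

context
  fixes \<Omega> :: "'a::euclidean_space set" and u :: "'a \<Rightarrow> real" and G :: "'a \<Rightarrow> 'a" and x0 :: 'a and r :: real
  assumes \<Omega>: "open \<Omega>" "cball x0 r \<subseteq> \<Omega>" and grad: "has_weak_gradient \<Omega> u G"
begin

lemma weak_gradient_integrable:
  "integrable (lebesgue_on (cball x0 r)) u" "integrable (lebesgue_on (cball x0 r)) (\<lambda>x. G x \<bullet> h)"
proof -
  have "L_p 1 (cball x0 r) u" "L_p 1 (cball x0 r) G"
    using grad \<Omega> unfolding has_weak_gradient_def L_p_loc_def by auto
  then show "integrable (lebesgue_on (cball x0 r)) u" "integrable (lebesgue_on (cball x0 r)) (\<lambda>x. G x \<bullet> h)"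
    by (auto simp: L_p_1_iff)
qed

lemma weak_gradient_direction:
  assumes \<phi>: "test_function (cball x0 r) \<phi>"
  shows "integrable lebesgue (\<lambda>x. u x * frechet_derivative \<phi> (at x) h)" (is ?iu)
    and "integrable lebesgue (\<lambda>x. (G x \<bullet> h) * \<phi> x)" (is ?ig)
    and "(LINT x|lebesgue. u x * frechet_derivative \<phi> (at x) h) = - (LINT x|lebesgue. (G x \<bullet> h) * \<phi> x)" (is ?eq)
proof -
  have \<phi>\<Omega>: "test_function \<Omega> \<phi>" using \<phi> \<Omega>(2) by (rule test_function_mono)
  have supp: "closure {x. \<phi> x \<noteq> 0} \<subseteq> cball x0 r" using \<phi> by (simp add: test_function_def)
  have zero: "\<phi> x = 0" "frechet_derivative \<phi> (at x) h = 0" if "x \<notin> cball x0 r" for x h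
    using that supp test_function_zero[OF \<phi>] test_function_derivative_zero[OF \<phi>] by blast+
  have iu: "integrable lebesgue (\<lambda>x. u x * frechet_derivative \<phi> (at x) h)" for h
  proof -
    obtain M where "\<And>x. \<bar>frechet_derivative \<phi> (at x) h\<bar> \<le> M" using test_function_derivative_bounded[OF \<phi>] by blast
    then show ?thesis
      using zero by (intro integrable_mult_bounded_support[OF weak_gradient_integrable(1)] borel_measurable_test_function_derivative[OF \<phi>]) auto
  qed
  have ig: "integrable lebesgue (\<lambda>x. (G x \<bullet> h) * \<phi> x)" for h
  proof -
    obtain M where "\<And>x. \<bar>\<phi> x\<bar> \<le> M" using test_function_bounded[OF \<phi>] by blast
    then show ?thesis
      using zero by (intro integrable_mult_bounded_support[OF weak_gradient_integrable(2)] borel_measurable_test_function[OF \<phi>]) auto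
  qed
  show ?iu ?ig by (rule iu ig)+
  have \<Omega>m: "\<Omega> \<in> sets lebesgue" using \<Omega>(1) by auto
  have basis: "(LINT x|lebesgue. u x * frechet_derivative \<phi> (at x) b) = - (LINT x|lebesgue. (G x \<bullet> b) * \<phi> x)"
    if b: "b \<in> Basis" for b
  proof -
    have "(LINT x|lebesgue_on \<Omega>. u x * frechet_derivative \<phi> (at x) b) = - (LINT x|lebesgue_on \<Omega>. (G x \<bullet> b) * \<phi> x)"
      using grad \<phi>\<Omega> b by (simp add: has_weak_gradient_def)
    moreover have "indicator \<Omega> x *\<^sub>R (u x * frechet_derivative \<phi> (at x) b) = u x * frechet_derivative \<phi> (at x) b"
      "indicator \<Omega> x *\<^sub>R ((G x \<bullet> b) * \<phi> x) = (G x \<bullet> b) * \<phi> x" for x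
      using zero[of x] \<Omega>(2) by (cases "x \<in> \<Omega>"; force)+
    ultimately show ?thesis by (simp only: integral_lebesgue_on_eq[OF \<Omega>m])
  qed
  have Gh: "G x \<bullet> h = (\<Sum>b\<in>Basis. (h \<bullet> b) * (G x \<bullet> b))" for x
    by (subst euclidean_inner) (simp add: mult.commute)
  have "(LINT x|lebesgue. u x * frechet_derivative \<phi> (at x) h)
    = (LINT x|lebesgue. (\<Sum>b\<in>Basis. (h \<bullet> b) * (u x * frechet_derivative \<phi> (at x) b)))"
    by (subst test_function_derivative_eq_sum[OF \<phi>]) (simp add: sum_distrib_left mult.left_commute)
  also have "\<dots> = (\<Sum>b\<in>Basis. (h \<bullet> b) * (LINT x|lebesgue. u x * frechet_derivative \<phi> (at x) b))"
    using iu by (subst Bochner_Integration.integral_sum) auto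
  also have "\<dots> = - (\<Sum>b\<in>Basis. (h \<bullet> b) * (LINT x|lebesgue. (G x \<bullet> b) * \<phi> x))"
    using basis by (simp add: sum_negf)
  also have "(\<Sum>b\<in>Basis. (h \<bullet> b) * (LINT x|lebesgue. (G x \<bullet> b) * \<phi> x))
     = (LINT x|lebesgue. (\<Sum>b\<in>Basis. (h \<bullet> b) * ((G x \<bullet> b) * \<phi> x)))"
    using ig by (subst Bochner_Integration.integral_sum) auto
  also have "\<dots> = (LINT x|lebesgue. (G x \<bullet> h) * \<phi> x)"
    by (simp add: Gh sum_distrib_right mult.assoc)
  finally show ?eq .
qed

text \<open>This is the embedding of \<open>W\<^bsup>1,p\<^esup>\<close> into all \<open>W\<^bsup>s,p\<^esup>\<close> at once: integrating over \<open>h\<close> against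
  \<open>norm h\<close> to the power \<open>-(N + s p)\<close> gives the seminorm of order \<open>s\<close>, and \<open>E\<close> depends neither on \<open>h\<close> nor on \<open>s\<close>.\<close>

lemma weak_gradient_difference_Lp:
  assumes p: "1 < p" and Gp: "L_p p (cball x0 r) G" and u': "u' \<in> borel_measurable borel" "AE x in lborel. u x = u' x"
  shows "\<exists>E<\<infinity>. \<forall>h. (\<integral>\<^sup>+x. indicator (ball x0 r) x * indicator (ball x0 r) (x + h) * ennreal (\<bar>u' (x + h) - u' x\<bar> powr p) \<partial>lborel)
    \<le> ennreal (norm h powr p) * E"
proof -
  let ?K = "cball x0 r" and ?B = "ball x0 r"
  have KB: "indicator ?B x * (indicator ?K x * c) = indicator ?B x * c" for x and c :: real
    by (auto split: split_indicator)
  have Km: "?K \<in> sets lebesgue" by simp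
  have "(\<lambda>x. indicator ?K x *\<^sub>R G x) \<in> borel_measurable lebesgue"
    using Gp Km by (simp add: L_p_def borel_measurable_lebesgue_on_iff)
  then have nm: "(\<lambda>x. norm (indicator ?K x *\<^sub>R G x)) \<in> borel_measurable lebesgue" by measurable
  obtain m where m: "m \<in> borel_measurable borel" and mAE: "AE x in lborel. norm (indicator ?K x *\<^sub>R G x) = m x"
    using completion_ex_borel_measurable_real[OF nm] by auto
  define E where "E = (\<integral>\<^sup>+x. ennreal (m x powr p) \<partial>lborel)"
  have "E = (\<integral>\<^sup>+x. ennreal (norm (indicator ?K x *\<^sub>R G x) powr p) \<partial>lebesgue)"
    unfolding E_def nn_integral_completion using mAE by (intro nn_integral_cong_AE) auto
  also have "\<dots> = (\<integral>\<^sup>+x. ennreal (norm (indicator ?K x *\<^sub>R (norm (G x) powr p))) \<partial>lebesgue)"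
    by (intro nn_integral_cong) (auto split: split_indicator)
  also have "\<dots> < \<infinity>"
  proof -
    have "integrable (lebesgue_on ?K) (\<lambda>x. norm (G x) powr p)" using Gp by (simp add: L_p_def)
    then have "integrable lebesgue (\<lambda>x. indicator ?K x *\<^sub>R (norm (G x) powr p))"
      by (simp only: integrable_lebesgue_on_iff[OF Km])
    then show ?thesis unfolding integrable_iff_bounded by blast
  qed
  finally have E: "E < \<infinity>" .
  define U where "U = (\<lambda>x. indicator ?B x * u' x)"
  have AEU: "AE x in lebesgue. indicator ?B x * u x = U x"
    using u'(2)[THEN AE_completion] unfolding U_def by eventually_elim simp
  note [measurable] = u'(1)
  have Um[measurable]: "U \<in> borel_measurable borel" unfolding U_def by measurable
  have iB: "integrable lebesgue (\<lambda>x. indicator ?B x * f x)" if "integrable (lebesgue_on ?K) f" for f :: "'a \<Rightarrow> real"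
  proof -
    have "integrable lebesgue (\<lambda>x. indicator ?K x *\<^sub>R f x)"
      using that by (simp only: integrable_lebesgue_on_iff[OF Km])
    then have "integrable lebesgue (\<lambda>x. indicator ?B x *\<^sub>R (indicator ?K x *\<^sub>R f x))"
      by (rule integrable_mult_indicator[rotated]) simp
    then show ?thesis by (simp add: KB)
  qed
  have "integrable lebesgue U"
    using iB[OF weak_gradient_integrable(1)] AEU Um
    by (subst integrable_cong_AE[where g = "\<lambda>x. indicator ?B x * u x"])
      (auto simp: measurable_completion intro: borel_measurable_integrable)
  then have U: "integrable lborel U" using Um by (simp add: integrable_completion)
  have main: "(\<integral>\<^sup>+x. indicator ?B x * indicator ?B (x + h) * ennreal (\<bar>U (x + h) - U x\<bar> powr p) \<partial>lborel)
    \<le> ennreal (norm h powr p) * (\<integral>\<^sup>+x. ennreal (m x powr p) \<partial>lborel)" for h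
  proof -
    have gi: "integrable lebesgue (\<lambda>x. indicator ?B x * (G x \<bullet> h))"
      using iB[OF weak_gradient_integrable(2)] .
    then have gm: "(\<lambda>x. indicator ?B x * (G x \<bullet> h)) \<in> borel_measurable lebesgue" by auto
    obtain g where g[measurable]: "g \<in> borel_measurable borel" and gAE: "AE x in lborel. indicator ?B x * (G x \<bullet> h) = g x"
      using completion_ex_borel_measurable_real[OF gm] by auto
    have "integrable lebesgue g"
      using gi gAE[THEN AE_completion] g
      by (subst integrable_cong_AE[where g = "\<lambda>x. indicator ?B x * (G x \<bullet> h)"])
        (auto simp: measurable_completion)
    then have gint: "integrable lborel g" using g by (simp add: integrable_completion)
    show ?thesis
    proof (rule weak_derivative_difference_Lp[OF U gint _ _ _ p _ m])
      show "AE x in lborel. \<bar>g x\<bar> \<le> norm h * m x"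
        using gAE mAE
      proof eventually_elim
        case (elim x)
        have "\<bar>g x\<bar> \<le> norm (indicator ?B x *\<^sub>R G x) * norm h"
          using Cauchy_Schwarz_ineq2[of "indicator ?B x *\<^sub>R G x" h] elim(1) by simp
        also have "\<dots> \<le> norm (indicator ?K x *\<^sub>R G x) * norm h"
          by (intro mult_right_mono) (auto split: split_indicator)
        finally show ?case using elim(2) by (simp add: mult.commute)
      qed
      fix \<phi> assume \<phi>: "test_function ?B \<phi>"
      then have \<phi>K: "test_function ?K \<phi>" by (rule test_function_mono) auto
      note [measurable] = borel_measurable_test_function[OF \<phi>] borel_measurable_test_function_derivative[OF \<phi>, of h]
      have supp: "closure {x. \<phi> x \<noteq> 0} \<subseteq> ?B" using \<phi> by (simp add: test_function_def)
      have zero: "\<phi> x = 0" "frechet_derivative \<phi> (at x) h = 0" if "x \<notin> ?B" for x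
        using that supp test_function_zero[OF \<phi>] test_function_derivative_zero[OF \<phi>] by blast+
      have i1: "indicator ?B x * u x * frechet_derivative \<phi> (at x) h = u x * frechet_derivative \<phi> (at x) h"
        and i2: "indicator ?B x * (G x \<bullet> h) * \<phi> x = (G x \<bullet> h) * \<phi> x" for x
        using zero[of x] by (auto split: split_indicator)
      have "(LINT x|lborel. U x * frechet_derivative \<phi> (at x) h) = (LINT x|lebesgue. U x * frechet_derivative \<phi> (at x) h)"
        by (intro integral_completion[symmetric]) measurable
      also have "\<dots> = (LINT x|lebesgue. u x * frechet_derivative \<phi> (at x) h)"
      proof (rule integral_cong_AE)
        show "AE x in lebesgue. U x * frechet_derivative \<phi> (at x) h = u x * frechet_derivative \<phi> (at x) h"
          using AEU by eventually_elim (metis i1)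
        show "(\<lambda>x. U x * frechet_derivative \<phi> (at x) h) \<in> borel_measurable lebesgue"
          by (intro measurable_completion) measurable
      qed (use weak_gradient_direction(1)[OF \<phi>K] in blast)
      also have "\<dots> = - (LINT x|lebesgue. (G x \<bullet> h) * \<phi> x)"
        by (rule weak_gradient_direction(3)[OF \<phi>K])
      also have "(LINT x|lebesgue. (G x \<bullet> h) * \<phi> x) = (LINT x|lebesgue. g x * \<phi> x)"
      proof (rule integral_cong_AE)
        show "AE x in lebesgue. (G x \<bullet> h) * \<phi> x = g x * \<phi> x"
          using gAE[THEN AE_completion] by eventually_elim (metis i2)
        show "(\<lambda>x. g x * \<phi> x) \<in> borel_measurable lebesgue"
          by (intro measurable_completion) measurable
      qed (use weak_gradient_direction(2)[OF \<phi>K] in blast)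
      also have "\<dots> = (LINT x|lborel. g x * \<phi> x)"
        by (intro integral_completion) measurable
      finally show "(LINT x|lborel. U x * frechet_derivative \<phi> (at x) h) = - (LINT x|lborel. g x * \<phi> x)" .
    qed auto
  qed
  have "(\<integral>\<^sup>+x. indicator ?B x * indicator ?B (x + h) * ennreal (\<bar>u' (x + h) - u' x\<bar> powr p) \<partial>lborel)
    = (\<integral>\<^sup>+x. indicator ?B x * indicator ?B (x + h) * ennreal (\<bar>U (x + h) - U x\<bar> powr p) \<partial>lborel)" for h
    unfolding U_def by (intro nn_integral_cong) (auto split: split_indicator)
  then show ?thesis using main E by (intro exI[of _ E] conjI allI) (simp_all add: E_def)
qed

end

text \<open>If \<open>f\<close> is not integrable, its integral is \<open>0\<close> by convention and the bound still holds, so the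
  integrability of the gradient term never has to be discussed.\<close>

lemma integral_ge_neg:
  fixes f g :: "'a \<Rightarrow> real"
  assumes g: "integrable M g" "\<And>x. 0 \<le> g x" and le: "AE x in M. - g x \<le> f x"
  shows "- (LINT x|M. g x) \<le> (LINT x|M. f x)"
proof (cases "integrable M f")
  case True
  have "(LINT x|M. - g x) \<le> (LINT x|M. f x)" using True g le by (intro integral_mono_AE) auto
  then show ?thesis by simp
next
  case False
  then show ?thesis using g by (simp add: not_integrable_integral_eq integral_nonneg)
qed

definition cutoff_gradient :: "'a::euclidean_space \<Rightarrow> real \<Rightarrow> 'a \<Rightarrow> 'a" where
  "cutoff_gradient x0 \<rho> x = (\<Sum>b\<in>Basis. frechet_derivative (cutoff 1 x0 \<rho>) (at x) b *\<^sub>R b)"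

lemma
  assumes \<rho>: "0 < \<rho>"
  shows cutoff_gradient_inner: "cutoff_gradient x0 \<rho> x \<bullet> h = frechet_derivative (cutoff 1 x0 \<rho>) (at x) h"
    and norm_cutoff_gradient_le:
      "1 < p \<Longrightarrow> norm (cutoff_gradient x0 \<rho> x) \<le> 8 * p\<^sup>2 / \<rho> * cutoff p x0 \<rho> x powr (p - 1)"
    and cutoff_gradient_eq_0: "x \<notin> ball x0 \<rho> \<Longrightarrow> cutoff_gradient x0 \<rho> x = 0"
    and borel_measurable_cutoff_gradient: "cutoff_gradient x0 \<rho> \<in> borel_measurable borel"
proof -
  have t: "test_function UNIV (cutoff 1 x0 \<rho>)" using \<rho> by (intro test_function_cutoff) auto
  show inner: "cutoff_gradient x0 \<rho> x \<bullet> h = frechet_derivative (cutoff 1 x0 \<rho>) (at x) h" for x h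
    unfolding cutoff_gradient_def inner_sum_left
    by (subst test_function_derivative_eq_sum[OF t]) (simp add: inner_commute mult.commute)
  show norm: "norm (cutoff_gradient x0 \<rho> x) \<le> 8 * p\<^sup>2 / \<rho> * cutoff p x0 \<rho> x powr (p - 1)"
    if p: "1 < p" for x p
  proof -
    let ?D = "cutoff_gradient x0 \<rho> x"
    have "norm ?D * norm ?D = \<bar>?D \<bullet> ?D\<bar>" by (simp add: power2_norm_eq_inner[symmetric] power2_eq_square)
    also have "\<dots> \<le> 8 * p\<^sup>2 / \<rho> * cutoff p x0 \<rho> x powr (p - 1) * norm ?D"
      unfolding inner by (rule cutoff_derivative_le[OF \<rho> p])
    finally have "norm ?D * norm ?D \<le> 8 * p\<^sup>2 / \<rho> * cutoff p x0 \<rho> x powr (p - 1) * norm ?D" .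
    then show ?thesis using \<rho> by (cases "?D = 0") (simp, auto intro: mult_right_le_imp_le[of _ "norm ?D"])
  qed
  show "cutoff_gradient x0 \<rho> x = 0" if "x \<notin> ball x0 \<rho>" for x
    using norm[of 2 x] cutoff_nonzero_iff[OF \<rho>, of 2 x0 x] that by simp
  show "cutoff_gradient x0 \<rho> \<in> borel_measurable borel"
    unfolding cutoff_gradient_def[abs_def]
    by (intro borel_measurable_sum borel_measurable_scaleR borel_measurable_test_function_derivative[OF t] borel_measurable_const)
qed

context
  fixes \<Omega> :: "'a::euclidean_space set" and u :: "'a \<Rightarrow> real" and G :: "'a \<Rightarrow> 'a" and x0 :: 'a and r k p :: real
  assumes \<Omega>: "open \<Omega>" "cball x0 r \<subseteq> \<Omega>" and grad: "has_weak_gradient \<Omega> u G"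
    and p: "1 < p" and r: "0 < r" and k: "0 < k"
    and Gp: "L_p p (cball x0 r) G"
    and um: "u \<in> borel_measurable lebesgue"
    and uk: "AE x in lebesgue. x \<in> ball x0 r \<longrightarrow> 0 \<le> u x \<and> u x \<le> k"
begin

private abbreviation (input) "\<eta> \<equiv> cutoff 1 x0 (r / 2)"
private abbreviation (input) "D\<eta> \<equiv> cutoff_gradient x0 (r / 2)"
private abbreviation (input) "v \<equiv> (\<lambda>x. (u x - 2 * k) * \<eta> x)"
private abbreviation (input) "H \<equiv> (\<lambda>x. \<eta> x *\<^sub>R G x + (u x - 2 * k) *\<^sub>R D\<eta> x)"

lemma \<eta>_test: "test_function (cball x0 r) \<eta>"
  using r by (intro test_function_cutoff) auto

lemma \<eta>_zero: "x \<notin> ball x0 (r / 2) \<Longrightarrow> \<eta> x = 0"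
  using cutoff_nonzero_iff[of "r / 2" 1 x0 x] r by simp

lemma half_ball_subset: "x \<in> ball x0 (r / 2) \<Longrightarrow> x \<in> ball x0 r"
  using r by auto

lemma cutoff_product_L_p: "S \<in> sets lebesgue \<Longrightarrow> 0 < q \<Longrightarrow> L_p q S v"
proof (rule L_p_dominated[where g = "\<lambda>x. (2 * k) powr q * indicator (ball x0 (r / 2)) x"])
  assume q: "0 < q"
  have "\<eta> \<in> borel_measurable lebesgue"
    using borel_measurable_test_function[OF \<eta>_test] by (simp add: measurable_completion)
  then show "v \<in> borel_measurable lebesgue" using um by measurable
  show "integrable lebesgue (\<lambda>x. (2 * k) powr q * indicator (ball x0 (r / 2)) x)"
    by (intro integrable_mult_right integrable_real_indicator) (use emeasure_bounded_finite[OF bounded_ball] in auto)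
  show "AE x in lebesgue. norm (v x) powr q \<le> (2 * k) powr q * indicator (ball x0 (r / 2)) x"
    using uk
  proof eventually_elim
    case (elim x)
    show ?case
    proof (cases "x \<in> ball x0 (r / 2)")
      case True
      then have "0 \<le> u x" "u x \<le> k" using elim half_ball_subset by blast+
      then have "\<bar>u x - 2 * k\<bar> * \<bar>\<eta> x\<bar> \<le> 2 * k * 1"
        using k cutoff_nonneg[of 1 x0 "r/2" x] cutoff_le_1[of 1 x0 "r/2" x] by (intro mult_mono) auto
      then have "norm (v x) \<le> 2 * k" by (simp add: abs_mult)
      then have "norm (v x) powr q \<le> (2 * k) powr q" using q by (intro powr_mono2) auto
      then show ?thesis using True by simp
    next
      case False
      then show ?thesis by (simp add: \<eta>_zero)
    qed
  qed
qed

lemma cutoff_product_gradient_L_p: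
  assumes S: "S \<in> sets lebesgue" and q: "0 < q" and Gq: "L_p q (cball x0 r) G"
  shows "L_p q S H"
proof -
  let ?K = "cball x0 r" and ?L = "2 * k * (8 * p\<^sup>2 / (r / 2))"
  have Km: "?K \<in> sets lebesgue" by simp
  have Gm: "(\<lambda>x. indicator ?K x *\<^sub>R G x) \<in> borel_measurable lebesgue"
    using Gq unfolding L_p_def borel_measurable_lebesgue_on_iff[OF Km] by blast
  have \<eta>m: "\<eta> \<in> borel_measurable lebesgue"
    using borel_measurable_test_function[OF \<eta>_test] by (simp add: measurable_completion)
  have Dm: "D\<eta> \<in> borel_measurable lebesgue"
    using borel_measurable_cutoff_gradient[of "r / 2" x0] r by (simp add: measurable_completion)
  have eq: "H x = \<eta> x *\<^sub>R (indicator ?K x *\<^sub>R G x) + (u x - 2 * k) *\<^sub>R D\<eta> x" for x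
    using \<eta>_zero[of x] half_ball_subset[of x] by (cases "x \<in> ball x0 (r / 2)") auto
  have Hm: "H \<in> borel_measurable lebesgue"
    unfolding eq using Gm \<eta>m Dm um by measurable
  have "integrable (lebesgue_on ?K) (\<lambda>x. norm (G x) powr q)" using Gq by (simp add: L_p_def)
  then have Gi: "integrable lebesgue (\<lambda>x. indicator ?K x *\<^sub>R (norm (G x) powr q))"
    by (simp only: integrable_lebesgue_on_iff[OF Km])
  have ci: "integrable lebesgue (\<lambda>x. ?L powr q * indicator ?K x)"
    by (intro integrable_mult_right integrable_real_indicator) (use emeasure_bounded_finite[OF bounded_cball] in auto)
  show ?thesis
  proof (rule L_p_dominated[OF Hm _ _ S])
    show "integrable lebesgue (\<lambda>x. 2 powr q * (indicator ?K x *\<^sub>R (norm (G x) powr q) + ?L powr q * indicator ?K x))"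
      by (intro integrable_mult_right Bochner_Integration.integrable_add Gi ci)
    show "AE x in lebesgue. norm (H x) powr q \<le> 2 powr q * (indicator ?K x *\<^sub>R (norm (G x) powr q) + ?L powr q * indicator ?K x)"
      using uk
    proof eventually_elim
      case (elim x)
      show ?case
      proof (cases "x \<in> ball x0 (r / 2)")
        case True
        then have b: "0 \<le> u x" "u x \<le> k" "x \<in> ?K" using elim half_ball_subset[of x] by auto
        have "cutoff p x0 (r / 2) x powr (p - 1) \<le> 1"
          using cutoff_nonneg[of p x0 "r/2" x] cutoff_le_1[of p x0 "r/2" x] p by (intro powr_le1) auto
        then have "norm (D\<eta> x) \<le> 8 * p\<^sup>2 / (r / 2)"
          using norm_cutoff_gradient_le[of "r / 2" p x0 x] r p
          by (intro order_trans[OF norm_cutoff_gradient_le[of "r / 2" p x0 x]] mult_left_le) auto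
        then have "\<bar>u x - 2 * k\<bar> * norm (D\<eta> x) \<le> ?L" using b k by (intro mult_mono) auto
        moreover have "\<bar>\<eta> x\<bar> * norm (G x) \<le> 1 * norm (G x)"
          using cutoff_nonneg[of 1 x0 "r/2" x] cutoff_le_1[of 1 x0 "r/2" x] by (intro mult_right_mono) auto
        ultimately have "norm (H x) \<le> norm (G x) + ?L"
          by (intro order_trans[OF norm_triangle_ineq]) (simp add: add_mono)
        then have "norm (H x) powr q \<le> (norm (G x) + ?L) powr q" using q by (intro powr_mono2) auto
        also have "\<dots> \<le> 2 powr q * (norm (G x) powr q + ?L powr q)" using q k r by (intro add_powr_le) auto
        finally show ?thesis using b by simp
      next
        case False
        then have "H x = 0" using \<eta>_zero cutoff_gradient_eq_0[of "r / 2" x x0] r by simp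
        then show ?thesis by simp
      qed
    qed
  qed
qed

text \<open>For a test function \<open>\<phi>\<close> the product \<open>\<eta> \<phi>\<close> is one for \<open>u\<close>; the constant \<open>2 k\<close> contributes the
  integral of a derivative of \<open>\<eta> \<phi>\<close>, which vanishes.\<close>

lemma cutoff_product_has_weak_gradient: "has_weak_gradient UNIV v H"
  unfolding has_weak_gradient_def
proof (intro conjI allI impI ballI)
  have G1: "L_p 1 (cball x0 r) G"
    using grad \<Omega> unfolding has_weak_gradient_def L_p_loc_def by auto
  have 1: "L_p 1 S v" "L_p 1 S H" if "S \<in> sets lebesgue" for S
    using that cutoff_product_L_p[of S 1] cutoff_product_gradient_L_p[OF _ _ G1, of S] by auto
  have comp: "K \<in> sets lebesgue" if "compact K" for K :: "'a set"
    using that by (intro lmeasurable_compact fmeasurableD)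
  show "L_p_loc 1 UNIV v" "L_p_loc 1 UNIV H"
    unfolding L_p_loc_def using 1 comp by (auto simp: L_p_def)
  fix \<phi> :: "'a \<Rightarrow> real" and b
  assume \<phi>: "test_function UNIV \<phi>" and "b \<in> (Basis :: 'a set)"
  let ?K = "cball x0 r"
  let ?D = "\<lambda>f x. frechet_derivative f (at x) b"
  note gi = weak_gradient_integrable[OF \<Omega> grad]
  have prod: "test_function ?K (\<lambda>x. \<eta> x * \<phi> x)" using test_function_mult[OF \<eta>_test \<phi>] by simp
  have deriv: "?D (\<lambda>x. \<eta> x * \<phi> x) x = \<eta> x * ?D \<phi> x + ?D \<eta> x * \<phi> x" for x
    by (simp add: frechet_derivative_mult test_function_differentiable[OF \<phi>] test_function_differentiable[OF \<eta>_test])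
  have zero: "\<eta> x = 0" "?D \<eta> x = 0" if "x \<notin> ?K" for x
  proof -
    have "x \<notin> ball x0 (r / 2)" using that half_ball_subset[of x] by auto
    then show "\<eta> x = 0" "?D \<eta> x = 0"
      using \<eta>_zero cutoff_gradient_eq_0[of "r / 2" x x0] cutoff_gradient_inner[of "r / 2" x0 x b] r by auto
  qed
  obtain A1 where A1: "0 < A1" "\<And>x. \<bar>\<phi> x\<bar> \<le> A1" using test_function_bounded[OF \<phi>] by blast
  obtain A2 where A2: "0 < A2" "\<And>x. \<bar>?D \<phi> x\<bar> \<le> A2" using test_function_derivative_bounded[OF \<phi>] by blast
  obtain A3 where A3: "0 < A3" "\<And>x. \<bar>?D \<eta> x\<bar> \<le> A3" using test_function_derivative_bounded[OF \<eta>_test] by blast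
  note [measurable] = borel_measurable_test_function[OF \<phi>] borel_measurable_test_function[OF \<eta>_test]
    borel_measurable_test_function_derivative[OF \<phi>, of b] borel_measurable_test_function_derivative[OF \<eta>_test, of b]
  have \<eta>1: "\<bar>\<eta> x\<bar> \<le> 1" for x using cutoff_nonneg[of 1 x0 "r/2" x] cutoff_le_1[of 1 x0 "r/2" x] by simp
  have m1: "\<bar>\<eta> x * ?D \<phi> x\<bar> \<le> 1 * A2" for x
    unfolding abs_mult using \<eta>1 A2 by (intro mult_mono) auto
  have i1: "integrable lebesgue (\<lambda>x. w x * (\<eta> x * ?D \<phi> x))" if "integrable (lebesgue_on ?K) w" for w
    by (rule integrable_mult_bounded_support[OF that, where M = "1 * A2"])
       (use m1 zero in auto)
  have i2: "integrable lebesgue (\<lambda>x. w x * (?D \<eta> x * \<phi> x))" if "integrable (lebesgue_on ?K) w" for w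
    by (rule integrable_mult_bounded_support[OF that, where M = "A3 * A1"])
       (use A3 A1 zero in \<open>auto simp: abs_mult intro!: mult_mono\<close>)
  have c1: "integrable (lebesgue_on ?K) (\<lambda>x. 1 :: real)"
    by (auto intro!: finite_measure.integrable_const simp: finite_measure_lebesgue_on)
  have "(LINT x|lebesgue. v x * ?D \<phi> x) = (LINT x|lebesgue. u x * (\<eta> x * ?D \<phi> x)) - 2 * k * (LINT x|lebesgue. 1 * (\<eta> x * ?D \<phi> x))"
    using i1[OF gi(1)] i1[OF c1] by (simp add: left_diff_distrib mult.assoc)
  also have "(LINT x|lebesgue. 1 * (\<eta> x * ?D \<phi> x)) = - (LINT x|lebesgue. 1 * (?D \<eta> x * \<phi> x))"
    using integral_test_function_derivative[OF prod, of b] i1[OF c1] i2[OF c1] by (simp add: deriv)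
  also have "(LINT x|lebesgue. u x * (\<eta> x * ?D \<phi> x)) = - (LINT x|lebesgue. (G x \<bullet> b) * (\<eta> x * \<phi> x)) - (LINT x|lebesgue. u x * (?D \<eta> x * \<phi> x))"
    using weak_gradient_direction(3)[OF \<Omega> grad prod, of b] i1[OF gi(1)] i2[OF gi(1)]
    by (simp add: deriv distrib_left)
  finally have "(LINT x|lebesgue. v x * ?D \<phi> x)
    = - ((LINT x|lebesgue. (G x \<bullet> b) * (\<eta> x * \<phi> x)) + ((LINT x|lebesgue. u x * (?D \<eta> x * \<phi> x)) - 2 * k * (LINT x|lebesgue. 1 * (?D \<eta> x * \<phi> x))))"
    by simp
  also have "\<dots> = - (LINT x|lebesgue. (G x \<bullet> b) * (\<eta> x * \<phi> x) + (u x * (?D \<eta> x * \<phi> x) - 2 * k * (1 * (?D \<eta> x * \<phi> x))))"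
    using weak_gradient_direction(2)[OF \<Omega> grad prod, of b] i2[OF gi(1)] i2[OF c1] by simp
  also have "\<dots> = - (LINT x|lebesgue. (H x \<bullet> b) * \<phi> x)"
    using cutoff_gradient_inner[of "r / 2" x0 _ b] r
    by (simp add: inner_add_left algebra_simps)
  finally show "(LINT x|lebesgue_on UNIV. v x * ?D \<phi> x) = - (LINT x|lebesgue_on UNIV. (H x \<bullet> b) * \<phi> x)"
    by (simp add: integral_lebesgue_on_eq)
qed

lemma cutoff_product_in_W1p_0: "v \<in> W1p_0 p (ball x0 (r / 2))"
proof -
  have "L_p p UNIV v" "L_p p UNIV H"
    using p Gp by (auto intro: cutoff_product_L_p cutoff_product_gradient_L_p)
  then show ?thesis
    using cutoff_product_has_weak_gradient \<eta>_zero unfolding W1p_0_def W1p_def by auto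
qed

text \<open>The base of the power is \<open>2 k\<close> times the bound \<open>8 p\<^sup>2 / (r / 2)\<close> for the gradient of the cutoff.\<close>

lemma local_form_ge:
  "- ((32 * k * p\<^sup>2 / r) powr p * measure lborel (ball x0 r))
    \<le> (LINT x|lebesgue_on \<Omega>. norm (G x) powr (p - 2) * (G x \<bullet> H x))"
proof -
  let ?A = "(32 * k * p\<^sup>2 / r) powr p"
  have \<Omega>m: "\<Omega> \<in> sets lebesgue" using \<Omega>(1) by auto
  have gi: "integrable lebesgue (\<lambda>x. ?A * indicator (ball x0 r) x)"
    by (intro integrable_mult_right integrable_real_indicator) (use emeasure_bounded_finite[OF bounded_ball] in auto)
  have AE: "AE x in lebesgue. - (?A * indicator (ball x0 r) x) \<le> indicator \<Omega> x *\<^sub>R (norm (G x) powr (p - 2) * (G x \<bullet> H x))"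
    using uk
  proof eventually_elim
    case (elim x)
    show ?case
    proof (cases "x \<in> ball x0 (r / 2)")
      case True
      then have b: "0 \<le> u x" "u x \<le> k" "x \<in> ball x0 r" "x \<in> \<Omega>" using elim half_ball_subset[of x] \<Omega>(2) by auto
      have "- ((2 * k * (8 * p\<^sup>2 / (r / 2))) powr p)
        \<le> norm (G x) powr (p - 2) * (G x \<bullet> (cutoff p x0 (r / 2) x powr p *\<^sub>R G x + (u x - 2 * k) *\<^sub>R D\<eta> x))"
        using b p k r norm_cutoff_gradient_le[of "r / 2" p x0 x] cutoff_nonneg[of p x0 "r/2" x]
        by (intro local_term_ge) auto
      moreover have "2 * k * (8 * p\<^sup>2 / (r / 2)) = 32 * k * p\<^sup>2 / r" by simp
      ultimately have "- ((32 * k * p\<^sup>2 / r) powr p)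
        \<le> norm (G x) powr (p - 2) * (G x \<bullet> (cutoff p x0 (r / 2) x powr p *\<^sub>R G x + (u x - 2 * k) *\<^sub>R D\<eta> x))"
        by (simp only:)
      then show ?thesis using b p by (simp add: cutoff_powr del: mult.assoc)
    next
      case False
      then have "H x = 0" using \<eta>_zero cutoff_gradient_eq_0[of "r / 2" x x0] r by simp
      then show ?thesis by simp
    qed
  qed
  have "- (LINT x|lebesgue. ?A * indicator (ball x0 r) x) \<le> (LINT x|lebesgue. indicator \<Omega> x *\<^sub>R (norm (G x) powr (p - 2) * (G x \<bullet> H x)))"
    by (rule integral_ge_neg[OF gi _ AE]) auto
  then show ?thesis unfolding integral_lebesgue_on_eq[OF \<Omega>m] by simp
qed

end

section \<open>The nonlocal form for one order of differentiation\<close>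

lemma nn_integral_lborel_pair:
  fixes f :: "'a::euclidean_space \<times> 'b::euclidean_space \<Rightarrow> ennreal"
  assumes "f \<in> borel_measurable borel"
  shows "(\<integral>\<^sup>+z. f z \<partial>lborel) = (\<integral>\<^sup>+x. \<integral>\<^sup>+y. f (x, y) \<partial>lborel \<partial>lborel)"
  using lborel.nn_integral_fst[of f lborel] assms by (simp add: lborel_prod)

text \<open>The constants in the kernel integrals over the inner and the outer region, after the singular factors
  \<open>1/(1-s)\<close> and \<open>1/s\<close> have been split off.\<close>

definition near_const :: "nat \<Rightarrow> real \<Rightarrow> real" where
  "near_const N p = 2 powr (N + 3 * p + 1) * unit_ball_vol N / p"

definition far_const :: "nat \<Rightarrow> real \<Rightarrow> real" where
  "far_const N p = 2 powr (N + p + 1) * unit_ball_vol N / p"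

lemma near_const_nonneg: "0 < p \<Longrightarrow> 0 \<le> near_const N p"
  and far_const_nonneg: "0 < p \<Longrightarrow> 0 \<le> far_const N p"
  by (auto simp: near_const_def far_const_def)

text \<open>In the variables \<open>x\<close> and \<open>h = y - x\<close> the numerator supplies \<open>norm h\<close> to the power \<open>p\<close>, which leaves the
  exponent \<open>p (1 - s) - N\<close>; its integral near \<open>0\<close> is of order \<open>1/(1-s)\<close>. The numerator \<open>D\<close> will be a
  \<open>p\<close>-th power of a difference of \<open>u\<close> or of the distance.\<close>

lemma nn_integral_near_kernel:
  fixes D :: "'a::euclidean_space \<times> 'a \<Rightarrow> ennreal" and p s r :: real
  assumes D: "D \<in> borel_measurable borel" and p: "1 < p" and s: "0 < s" "s < 1" and r: "0 < r" "r \<le> 1"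
    and E: "\<And>h. (\<integral>\<^sup>+x. indicator (ball x0 r) x * indicator (ball x0 r) (x + h) * D (x, x + h) \<partial>lborel) \<le> ennreal (norm h powr p) * E"
  shows "(\<integral>\<^sup>+x. \<integral>\<^sup>+y. indicator (ball x0 r) x * indicator (ball x0 r) y * (D (x, y) * ennreal (norm (x - y) powr (- (DIM('a) + s * p)))) \<partial>lborel \<partial>lborel)
    \<le> ennreal (near_const DIM('a) p / (1 - s)) * E"
proof -
  let ?B = "ball x0 r" and ?e = "DIM('a) + s * p" and ?q = "p * (1 - s)"
  have [measurable]: "D \<in> borel_measurable (borel \<Otimes>\<^sub>M borel)" using D by (simp add: borel_prod)
  have q: "0 < ?q" "?q \<le> p" using p s by (auto simp: mult_left_le)
  have "(\<integral>\<^sup>+x. \<integral>\<^sup>+y. indicator ?B x * indicator ?B y * (D (x, y) * ennreal (norm (x - y) powr (- ?e))) \<partial>lborel \<partial>lborel)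
    = (\<integral>\<^sup>+x. \<integral>\<^sup>+h. indicator ?B x * indicator ?B (x + h) * (D (x, x + h) * ennreal (norm h powr (- ?e))) \<partial>lborel \<partial>lborel)"
  proof (rule nn_integral_cong)
    fix x
    show "(\<integral>\<^sup>+y. indicator ?B x * indicator ?B y * (D (x, y) * ennreal (norm (x - y) powr (- ?e))) \<partial>lborel)
      = (\<integral>\<^sup>+h. indicator ?B x * indicator ?B (x + h) * (D (x, x + h) * ennreal (norm h powr (- ?e))) \<partial>lborel)"
      using nn_integral_lborel_shift[of "\<lambda>y. indicator ?B x * indicator ?B y * (D (x, y) * ennreal (norm (x - y) powr (- ?e)))" x]
      by (simp add: add.commute)
  qed
  also have "\<dots> = (\<integral>\<^sup>+h. \<integral>\<^sup>+x. indicator ?B x * indicator ?B (x + h) * (D (x, x + h) * ennreal (norm h powr (- ?e))) \<partial>lborel \<partial>lborel)"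
    by (rule lborel_pair.Fubini') measurable
  also have "\<dots> \<le> (\<integral>\<^sup>+h. E * (indicator (ball 0 (2 * r)) h * ennreal (norm h powr (?q - DIM('a)))) \<partial>(lborel :: 'a measure))"
  proof (rule nn_integral_mono)
    fix h :: 'a
    have "(\<integral>\<^sup>+x. indicator ?B x * indicator ?B (x + h) * (D (x, x + h) * ennreal (norm h powr (- ?e))) \<partial>lborel)
      = (\<integral>\<^sup>+x. indicator (ball 0 (2 * r)) h * ennreal (norm h powr (- ?e)) * (indicator ?B x * indicator ?B (x + h) * D (x, x + h)) \<partial>lborel)"
    proof (rule nn_integral_cong)
      fix x :: 'a
      have "h \<in> ball 0 (2 * r)" if "x \<in> ?B" "x + h \<in> ?B"
        using that norm_triangle_ineq4[of "x + h - x0" "x - x0"] by (simp add: dist_norm norm_minus_commute)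
      then show "indicator ?B x * indicator ?B (x + h) * (D (x, x + h) * ennreal (norm h powr (- ?e)))
        = indicator (ball 0 (2 * r)) h * ennreal (norm h powr (- ?e)) * (indicator ?B x * indicator ?B (x + h) * D (x, x + h))"
        by (cases "x \<in> ?B \<and> x + h \<in> ?B") (auto simp: mult.commute)
    qed
    also have "\<dots> = indicator (ball 0 (2 * r)) h * ennreal (norm h powr (- ?e)) * (\<integral>\<^sup>+x. indicator ?B x * indicator ?B (x + h) * D (x, x + h) \<partial>lborel)"
      by (rule nn_integral_cmult) measurable
    also have "\<dots> \<le> indicator (ball 0 (2 * r)) h * ennreal (norm h powr (- ?e)) * (ennreal (norm h powr p) * E)"
      by (intro mult_left_mono E) simp
    also have "\<dots> = E * (indicator (ball 0 (2 * r)) h * (ennreal (norm h powr (- ?e)) * ennreal (norm h powr p)))"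
      by (simp add: mult_ac)
    also have "ennreal (norm h powr (- ?e)) * ennreal (norm h powr p) = ennreal (norm h powr (?q - DIM('a)))"
    proof -
      have "- ?e + p = ?q - DIM('a)" by (simp add: algebra_simps)
      then show ?thesis by (simp only: ennreal_mult'[symmetric] powr_ge_zero powr_add[symmetric])
    qed
    finally show "(\<integral>\<^sup>+x. indicator ?B x * indicator ?B (x + h) * (D (x, x + h) * ennreal (norm h powr (- ?e))) \<partial>lborel)
      \<le> E * (indicator (ball 0 (2 * r)) h * ennreal (norm h powr (?q - DIM('a))))" .
  qed
  also have "\<dots> = E * (\<integral>\<^sup>+h. indicator (ball 0 (2 * r)) h * ennreal (norm h powr (?q - DIM('a))) \<partial>(lborel :: 'a measure))"
    by (rule nn_integral_cmult) measurable
  also have "\<dots> \<le> E * ennreal (2 powr (DIM('a) + 2 * ?q + 1) * unit_ball_vol DIM('a) * ((2 * r) powr ?q / ?q))"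
    using q r by (intro mult_left_mono nn_integral_norm_powr_ball) auto
  also have "\<dots> \<le> E * ennreal (2 powr (DIM('a) + 3 * p + 1) * unit_ball_vol DIM('a) / p / (1 - s))"
  proof (intro mult_left_mono ennreal_leI)
    have "(2 * r) powr ?q \<le> 2 powr ?q" using r q by (intro powr_mono2) auto
    also have "\<dots> \<le> 2 powr p" using q by (intro powr_mono) auto
    finally have "2 powr (DIM('a) + 2 * ?q + 1) * unit_ball_vol DIM('a) * ((2 * r) powr ?q / ?q)
      \<le> 2 powr (DIM('a) + 2 * p + 1) * unit_ball_vol DIM('a) * (2 powr p / ?q)"
      using q by (intro mult_mono powr_mono divide_right_mono) auto
    also have "\<dots> = (2 powr (DIM('a) + 2 * p + 1) * 2 powr p) * unit_ball_vol DIM('a) / p / (1 - s)" by simp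
    also have "2 powr (DIM('a) + 2 * p + 1) * 2 powr p = 2 powr (DIM('a) + 3 * p + 1)"
      by (simp add: powr_add[symmetric] algebra_simps)
    finally show "2 powr (DIM('a) + 2 * ?q + 1) * unit_ball_vol DIM('a) * ((2 * r) powr ?q / ?q)
      \<le> 2 powr (DIM('a) + 3 * p + 1) * unit_ball_vol DIM('a) / p / (1 - s)" .
  qed simp
  finally show ?thesis unfolding near_const_def by (simp only: mult.commute)
qed

lemma nn_integral_far_kernel:
  fixes x0 :: "'a::euclidean_space" and p s r :: real
  assumes p: "1 < p" and s: "0 < s" "s < 1" and r: "0 < r" "r \<le> 1"
  shows "(\<integral>\<^sup>+y. indicator (- ball x0 r) y * ennreal (norm (y - x0) powr (- (DIM('a) + s * p))) \<partial>lborel)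
    \<le> ennreal (far_const DIM('a) p * r powr (- p) / s)"
proof -
  have q: "0 < s * p" "s * p \<le> p" using p s by (auto simp: mult_left_le_one_le)
  have "(\<integral>\<^sup>+y. indicator (- ball x0 r) y * ennreal (norm (y - x0) powr (- (DIM('a) + s * p))) \<partial>lborel)
    = (\<integral>\<^sup>+z. indicator (- ball x0 r) (z + x0) * ennreal (norm (z + x0 - x0) powr (- (DIM('a) + s * p))) \<partial>(lborel :: 'a measure))"
    by (rule nn_integral_lborel_shift[symmetric]) measurable
  also have "\<dots> = (\<integral>\<^sup>+z. indicator (- ball 0 r) z * ennreal (norm z powr (- (DIM('a) + s * p))) \<partial>(lborel :: 'a measure))"
    by (intro nn_integral_cong) (simp add: dist_norm indicator_def)
  also have "\<dots> \<le> ennreal (2 powr (DIM('a) + s * p + 1) * unit_ball_vol DIM('a) * (r powr (- (s * p)) / (s * p)))"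
    using q r by (intro nn_integral_norm_powr_outside_ball) auto
  also have "\<dots> \<le> ennreal (2 powr (DIM('a) + p + 1) * unit_ball_vol DIM('a) * (r powr (- p) / (s * p)))"
  proof (intro ennreal_leI mult_mono divide_right_mono)
    show "r powr (- (s * p)) \<le> r powr (- p)" using r q by (intro powr_mono') auto
  qed (use q in \<open>auto intro: powr_mono\<close>)
  finally show ?thesis by (simp add: far_const_def mult_ac)
qed

text \<open>A pair with both points outside \<open>B\<close> does not interact, since the test function vanishes at both.\<close>

lemma nn_integral_three_regions:
  fixes B :: "'a::euclidean_space set" and n :: "'a \<times> 'a \<Rightarrow> ennreal"
  assumes [measurable]: "B \<in> sets borel" "Z \<in> borel_measurable borel" and n: "n \<in> borel_measurable borel"
  shows "(\<integral>\<^sup>+z. indicator B (fst z) * indicator B (snd z) * n z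
      + indicator B (fst z) * (indicator (- B) (snd z) * Z (snd z)) + indicator B (snd z) * (indicator (- B) (fst z) * Z (fst z)) \<partial>lborel)
    = (\<integral>\<^sup>+x. \<integral>\<^sup>+y. indicator B x * indicator B y * n (x, y) \<partial>lborel \<partial>lborel)
      + 2 * emeasure lborel B * (\<integral>\<^sup>+y. indicator (- B) y * Z y \<partial>lborel)"
proof -
  have [measurable]: "n \<in> borel_measurable (borel \<Otimes>\<^sub>M borel)" using n by (simp add: borel_prod)
  have "(\<integral>\<^sup>+z. indicator B (fst z) * indicator B (snd z) * n z
      + indicator B (fst z) * (indicator (- B) (snd z) * Z (snd z)) + indicator B (snd z) * (indicator (- B) (fst z) * Z (fst z)) \<partial>lborel)
    = (\<integral>\<^sup>+z. indicator B (fst z) * indicator B (snd z) * n z \<partial>lborel)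
      + (\<integral>\<^sup>+z. indicator B (fst z) * (indicator (- B) (snd z) * Z (snd z)) \<partial>lborel)
      + (\<integral>\<^sup>+z. indicator B (snd z) * (indicator (- B) (fst z) * Z (fst z)) \<partial>lborel)"
    unfolding lborel_prod[symmetric]
    by (subst nn_integral_add, measurable)+
  also have "(\<integral>\<^sup>+z. indicator B (fst z) * indicator B (snd z) * n z \<partial>lborel)
    = (\<integral>\<^sup>+x. \<integral>\<^sup>+y. indicator B x * indicator B y * n (x, y) \<partial>lborel \<partial>lborel)"
    by (subst nn_integral_lborel_pair) (simp_all add: borel_prod[symmetric])
  also have "(\<integral>\<^sup>+z. indicator B (fst z) * (indicator (- B) (snd z) * Z (snd z)) \<partial>lborel)
    = emeasure lborel B * (\<integral>\<^sup>+y. indicator (- B) y * Z y \<partial>lborel)"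
    by (subst nn_integral_lborel_pair)
       (simp_all add: borel_prod[symmetric] nn_integral_cmult nn_integral_multc)
  also have "(\<integral>\<^sup>+z. indicator B (snd z) * (indicator (- B) (fst z) * Z (fst z)) \<partial>lborel)
    = emeasure lborel B * (\<integral>\<^sup>+y. indicator (- B) y * Z y \<partial>lborel)"
    by (subst nn_integral_lborel_pair)
       (simp_all add: borel_prod[symmetric] nn_integral_cmult nn_integral_multc)
  finally show ?thesis by (simp add: mult_2 distrib_right add.assoc)
qed

definition pair_form :: "real \<Rightarrow> real \<Rightarrow> ('a::euclidean_space \<Rightarrow> real) \<Rightarrow> ('a \<Rightarrow> real) \<Rightarrow> 'a \<Rightarrow> 'a \<Rightarrow> real" where
  "pair_form p e u v x y = \<bar>u x - u y\<bar> powr (p - 2) * (u x - u y) * (v x - v y) / norm (x - y) powr e"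

lemma pair_form_commute: "pair_form p e u v x y = pair_form p e u v y x"
  by (simp add: pair_form_def norm_minus_commute abs_minus_commute algebra_simps)

lemma pair_form_eq: "pair_form p e u v x y = \<bar>u x - u y\<bar> powr (p - 2) * (u x - u y) * (v x - v y) * norm (x - y) powr (- e)"
  by (simp add: pair_form_def powr_minus divide_inverse)

text \<open>The inequality \<open>g1 - g2 \<le> f\<close>, written without subtraction so that \<open>g1\<close> and \<open>g2\<close> may be infinite.
  The hypothesis and the conclusion have the same shape, and the lemma is used twice: for pairs of points, then for orders.\<close>

lemma nn_lower_bound_integral:
  fixes f :: "'b \<Rightarrow> real"
  assumes f: "integrable M f" and [measurable]: "g1 \<in> borel_measurable M" "g2 \<in> borel_measurable M"
    and le: "AE x in M. g1 x + ennreal (- f x) \<le> ennreal (f x) + g2 x"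
  shows "(\<integral>\<^sup>+x. g1 x \<partial>M) + ennreal (- (LINT x|M. f x)) \<le> ennreal (LINT x|M. f x) + (\<integral>\<^sup>+x. g2 x \<partial>M)"
proof (cases "(\<integral>\<^sup>+x. g2 x \<partial>M) = \<infinity>")
  case False
  have [measurable]: "f \<in> borel_measurable M" using f by auto
  obtain P N where PN: "(\<integral>\<^sup>+x. ennreal (f x) \<partial>M) = ennreal P" "0 \<le> P" "(\<integral>\<^sup>+x. ennreal (- f x) \<partial>M) = ennreal N" "0 \<le> N"
    using f unfolding real_integrable_def by (metis ennreal_cases infinity_ennreal_def)
  have I: "(LINT x|M. f x) = P - N" using f PN by (simp add: real_lebesgue_integral_def)
  have "(\<integral>\<^sup>+x. g1 x + ennreal (- f x) \<partial>M) \<le> (\<integral>\<^sup>+x. ennreal (f x) + g2 x \<partial>M)"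
    using le by (rule nn_integral_mono_AE)
  then have *: "(\<integral>\<^sup>+x. g1 x \<partial>M) + ennreal N \<le> ennreal P + (\<integral>\<^sup>+x. g2 x \<partial>M)"
    using PN by (simp add: nn_integral_add)
  obtain Y where Y: "(\<integral>\<^sup>+x. g2 x \<partial>M) = ennreal Y" "0 \<le> Y" using False by (metis ennreal_cases infinity_ennreal_def)
  have "(\<integral>\<^sup>+x. g1 x \<partial>M) \<noteq> \<infinity>" using * Y PN by (auto simp: ennreal_plus[symmetric] top_unique simp del: ennreal_plus)
  then obtain X where X: "(\<integral>\<^sup>+x. g1 x \<partial>M) = ennreal X" "0 \<le> X" by (metis ennreal_cases infinity_ennreal_def)
  have "X + N \<le> P + Y" using * X Y PN by (simp add: ennreal_plus[symmetric] del: ennreal_plus)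
  then show ?thesis unfolding I X Y using X Y
    by (cases "N \<le> P") (simp_all add: ennreal_neg ennreal_plus[symmetric] ennreal_leI del: ennreal_plus)
qed simp

lemma ennreal_lower_bound:
  assumes "a - b \<le> f" "0 \<le> a" "0 \<le> b"
  shows "ennreal a + ennreal (- f) \<le> ennreal f + ennreal b"
  using assms
  by (cases "0 \<le> f") (simp_all add: ennreal_neg ennreal_plus[symmetric] ennreal_leI del: ennreal_plus)

context
  fixes u :: "'a::euclidean_space \<Rightarrow> real" and x0 :: 'a and r k p s e E :: real
  assumes e: "e = DIM('a) + s * p" and E: "E = DIM('a) + p"
    and p: "1 < p" and r: "0 < r" "r \<le> 1" and k: "0 < k" and s: "0 < s" "s < 1"
    and um[measurable]: "u \<in> borel_measurable borel"
    and uk: "\<And>x. x \<in> ball x0 r \<Longrightarrow> 0 \<le> u x \<and> u x \<le> k"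
begin

private abbreviation (input) "\<psi> \<equiv> cutoff 1 x0 (r / 2)"
private abbreviation (input) "B \<equiv> ball x0 r"
private abbreviation (input) "F \<equiv> pair_form p e u (\<lambda>x. (u x - 2 * k) * \<psi> x)"

lemma exponent_bounds: "0 \<le> e" "e \<le> E"
  using p s by (auto simp: e E mult_left_le_one_le)

text \<open>The constant is \<open>2 k p\<close> times the Lipschitz constant \<open>32 p / r\<close> of \<open>cutoff p\<close>.\<close>

lemma pair_form_near_ge:
  assumes x: "x \<in> B" and y: "y \<in> B"
  shows "- ((64 * k * p\<^sup>2 / r) powr p * norm (x - y) powr p * norm (x - y) powr (- e)) \<le> F x y"
proof -
  have b: "0 \<le> u x" "u x \<le> k" "0 \<le> u y" "u y \<le> k" using uk x y by auto
  let ?f = "cutoff p x0 (r / 2)"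
  have "\<bar>?f x - ?f y\<bar> \<le> 16 * p / (r / 2) * norm (x - y)"
    using x y r p by (intro cutoff_Lipschitz) auto
  then have "2 * k * p * \<bar>?f x - ?f y\<bar> \<le> 2 * k * p * (16 * p / (r / 2) * norm (x - y))"
    using k p by (intro mult_left_mono) auto
  also have "\<dots> = 64 * k * p\<^sup>2 / r * norm (x - y)" using r by (simp add: power2_eq_square)
  finally have "(2 * k * p * \<bar>?f x - ?f y\<bar>) powr p \<le> (64 * k * p\<^sup>2 / r * norm (x - y)) powr p"
    using k p by (intro powr_mono2) auto
  also have "\<dots> = (64 * k * p\<^sup>2 / r) powr p * norm (x - y) powr p" using k p r by (subst powr_mult) auto
  finally have 1: "(2 * k * p * \<bar>?f x - ?f y\<bar>) powr p \<le> (64 * k * p\<^sup>2 / r) powr p * norm (x - y) powr p" .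
  have "- ((2 * k * p * \<bar>?f x - ?f y\<bar>) powr p)
    \<le> \<bar>(u x - 2 * k) - (u y - 2 * k)\<bar> powr (p - 2) * ((u x - 2 * k) - (u y - 2 * k)) * ((u x - 2 * k) * ?f x powr p - (u y - 2 * k) * ?f y powr p)"
    using b k p by (intro Caccioppoli_pointwise) (auto simp: cutoff_nonneg)
  then have "- ((2 * k * p * \<bar>?f x - ?f y\<bar>) powr p)
    \<le> \<bar>u x - u y\<bar> powr (p - 2) * (u x - u y) * ((u x - 2 * k) * \<psi> x - (u y - 2 * k) * \<psi> y)"
    using p by (simp add: cutoff_powr)
  then have "- ((64 * k * p\<^sup>2 / r) powr p * norm (x - y) powr p)
    \<le> \<bar>u x - u y\<bar> powr (p - 2) * (u x - u y) * ((u x - 2 * k) * \<psi> x - (u y - 2 * k) * \<psi> y)"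
    using 1 by linarith
  from mult_right_mono[OF this, of "norm (x - y) powr (- e)"] show ?thesis
    unfolding pair_form_eq by simp
qed

lemma pair_form_near_abs_le:
  assumes x: "x \<in> B" and y: "y \<in> B"
  shows "\<bar>F x y\<bar> \<le> (2 * \<bar>u x - u y\<bar> powr p + (64 * k / r) powr p * norm (x - y) powr p) * norm (x - y) powr (- e)"
proof -
  let ?d = "\<bar>u x - u y\<bar>"
  have b: "0 \<le> u x" "u x \<le> k" "0 \<le> u y" "u y \<le> k" using uk x y by auto
  have "\<bar>\<psi> x - \<psi> y\<bar> \<le> 16 * 1 / (r / 2) * norm (x - y)"
    using x y r by (intro cutoff_Lipschitz) auto
  then have L: "2 * k * \<bar>\<psi> x - \<psi> y\<bar> \<le> 64 * k / r * norm (x - y)"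
    using k mult_left_mono[of "\<bar>\<psi> x - \<psi> y\<bar>" "16 * 1 / (r / 2) * norm (x - y)" "2 * k"] by simp
  have "(u x - 2 * k) * \<psi> x - (u y - 2 * k) * \<psi> y = (u x - u y) * \<psi> x + (u y - 2 * k) * (\<psi> x - \<psi> y)"
    by (simp add: algebra_simps)
  then have "\<bar>(u x - 2 * k) * \<psi> x - (u y - 2 * k) * \<psi> y\<bar> \<le> ?d * \<psi> x + \<bar>u y - 2 * k\<bar> * \<bar>\<psi> x - \<psi> y\<bar>"
    using abs_triangle_ineq[of "(u x - u y) * \<psi> x" "(u y - 2 * k) * (\<psi> x - \<psi> y)"]
    by (simp add: abs_mult cutoff_nonneg)
  also have "\<dots> \<le> ?d * 1 + 2 * k * \<bar>\<psi> x - \<psi> y\<bar>"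
    using b k by (intro add_mono mult_mono cutoff_le_1) (auto simp: cutoff_nonneg)
  also have "\<dots> \<le> ?d + 64 * k / r * norm (x - y)" using L by simp
  finally have "?d powr (p - 1) * \<bar>(u x - 2 * k) * \<psi> x - (u y - 2 * k) * \<psi> y\<bar> \<le> ?d powr (p - 1) * (?d + 64 * k / r * norm (x - y))"
    by (rule mult_left_mono) simp
  also have "\<dots> = ?d powr (p - 1) * ?d + ?d powr (p - 1) * (64 * k / r * norm (x - y))" by (simp add: distrib_left)
  also have "?d powr (p - 1) * ?d = ?d powr p"
    using powr_add[of ?d "p - 1" 1] by (cases "u x = u y") auto
  also have "?d powr (p - 1) * (64 * k / r * norm (x - y)) \<le> ?d powr p + (64 * k / r * norm (x - y)) powr p"
    using p k r by (intro powr_mult_le_add_powr) auto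
  also have "(64 * k / r * norm (x - y)) powr p = (64 * k / r) powr p * norm (x - y) powr p" using k r by (subst powr_mult) auto
  finally have "?d powr (p - 1) * \<bar>(u x - 2 * k) * \<psi> x - (u y - 2 * k) * \<psi> y\<bar> \<le> 2 * ?d powr p + (64 * k / r) powr p * norm (x - y) powr p"
    by simp
  then have "\<bar>\<bar>u x - u y\<bar> powr (p - 2) * (u x - u y) * ((u x - 2 * k) * \<psi> x - (u y - 2 * k) * \<psi> y)\<bar> * norm (x - y) powr (- e)
    \<le> (2 * ?d powr p + (64 * k / r) powr p * norm (x - y) powr p) * norm (x - y) powr (- e)"
    unfolding abs_mult[of "\<bar>u x - u y\<bar> powr (p - 2) * (u x - u y)"] abs_powr_mult_self by (intro mult_right_mono) auto
  then show ?thesis unfolding pair_form_eq by (simp add: abs_mult)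
qed

lemma cutoff_outside: "x \<notin> ball x0 (r / 2) \<Longrightarrow> \<psi> x = 0"
  using cutoff_nonzero_iff[of "r / 2" 1 x0 x] r by simp

text \<open>The cutoff kills the term at the outer point, so \<open>cross_term_ge\<close> decides the sign. The lower bound
  \<open>exp (-2)\<close> of the cutoff on \<open>B\<^bsub>r/4\<^esub>\<close> keeps the good part, the upper bound \<open>1\<close> controls the bad one.\<close>

lemma pair_form_cross:
  assumes x: "x \<in> B" and y: "y \<notin> B"
  shows pair_form_cross_ge: "indicator (ball x0 (r / 4)) x * (exp (- 2) * 2 powr (- E) * 2 powr (1 - p) * k * (max (u y) 0 powr (p - 1) * norm (y - x0) powr (- e)))
      - 2 powr E * (2 powr p + 1) * (k powr p + k * max (- u y) 0 powr (p - 1)) * norm (y - x0) powr (- e) \<le> F x y"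
    and pair_form_cross_abs_le: "\<bar>F x y\<bar> \<le> 2 powr E * 2 powr p * (k powr p + k * \<bar>u y\<bar> powr (p - 1)) * norm (y - x0) powr (- e)"
proof -
  let ?K = "norm (x - y) powr (- e)" and ?d = "norm (y - x0) powr (- e)"
  let ?J = "\<bar>u x - u y\<bar> powr (p - 2) * (u x - u y) * (u x - 2 * k)"
  let ?P = "max (u y) 0 powr (p - 1)" and ?Q = "(2 powr p + 1) * (k powr p + k * max (- u y) 0 powr (p - 1))"
  have b: "0 \<le> u x" "u x \<le> k" using uk x by auto
  have y': "\<psi> y = 0" using y r by (intro cutoff_outside) auto
  have F: "F x y = ?J * (\<psi> x * ?K)" by (simp add: pair_form_eq y' mult_ac)
  have Q0: "0 \<le> ?Q" using k by simp
  have neg: "- (2 powr E * ?Q * ?d) \<le> 0" using Q0 by simp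
  have R0: "0 \<le> 2 powr E * 2 powr p * (k powr p + k * \<bar>u y\<bar> powr (p - 1)) * ?d" using k by simp
  consider "x \<in> ball x0 (r / 2)" | "x \<notin> ball x0 (r / 2)" by blast
  then have "indicator (ball x0 (r / 4)) x * (exp (- 2) * 2 powr (- E) * 2 powr (1 - p) * k * (?P * ?d)) - 2 powr E * ?Q * ?d \<le> F x y
    \<and> \<bar>F x y\<bar> \<le> 2 powr E * 2 powr p * (k powr p + k * \<bar>u y\<bar> powr (p - 1)) * ?d"
  proof cases
    case 1
    have "norm (x - x0) < r / 2" "r \<le> norm (y - x0)" using 1 y by (auto simp: dist_norm norm_minus_commute)
    note K = kernel_comparison[OF this exponent_bounds]
    have \<psi>: "0 \<le> \<psi> x" "\<psi> x \<le> 1" by (rule cutoff_nonneg cutoff_le_1)+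
    have upper: "\<psi> x * ?K \<le> 2 powr E * ?d"
      using mult_mono[OF \<psi>(2) K(2)] \<psi> by simp
    have lower: "indicator (ball x0 (r / 4)) x * (exp (- 2) * (2 powr (- E) * ?d)) \<le> \<psi> x * ?K"
    proof (cases "x \<in> ball x0 (r / 4)")
      case True
      then have "exp (- 2) \<le> \<psi> x" using r by (intro cutoff_ge) auto
      from mult_mono[OF this K(1)] show ?thesis using True \<psi> by simp
    qed (use \<psi> in simp)
    have "indicator (ball x0 (r / 4)) x * (exp (- 2) * (2 powr (- E) * ?d)) * (2 powr (1 - p) * k * ?P) - ?Q * (2 powr E * ?d)
      \<le> (\<psi> x * ?K) * (2 powr (1 - p) * k * ?P) - ?Q * (\<psi> x * ?K)"
      using k by (intro diff_mono mult_right_mono lower mult_left_mono upper Q0) auto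
    also have "\<dots> = (2 powr (1 - p) * k * ?P - ?Q) * (\<psi> x * ?K)" by (simp add: algebra_simps)
    also have "\<dots> \<le> ?J * (\<psi> x * ?K)"
      using \<psi> by (intro mult_right_mono cross_term_ge p b k) auto
    finally have A: "indicator (ball x0 (r / 4)) x * (exp (- 2) * 2 powr (- E) * 2 powr (1 - p) * k * (?P * ?d)) - 2 powr E * ?Q * ?d \<le> F x y"
      unfolding F by (simp add: mult_ac)
    have "\<bar>?J * (\<psi> x * ?K)\<bar> = \<bar>?J\<bar> * (\<psi> x * ?K)" using \<psi> by (simp only: abs_mult) simp
    also have "\<dots> \<le> 2 powr p * (k powr p + k * \<bar>u y\<bar> powr (p - 1)) * (2 powr E * ?d)"
      using \<psi> k by (intro mult_mono cross_term_abs_le p b k upper) auto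
    finally have "\<bar>F x y\<bar> \<le> 2 powr E * 2 powr p * (k powr p + k * \<bar>u y\<bar> powr (p - 1)) * ?d"
      unfolding F by (simp add: mult_ac)
    with A show ?thesis by blast
  next
    case 2
    then have "x \<notin> ball x0 (r / 4)" using r by auto
    then show ?thesis using cutoff_outside[OF 2] R0 neg by (simp add: F)
  qed
  then show "indicator (ball x0 (r / 4)) x * (exp (- 2) * 2 powr (- E) * 2 powr (1 - p) * k * (?P * ?d))
      - 2 powr E * (2 powr p + 1) * (k powr p + k * max (- u y) 0 powr (p - 1)) * ?d \<le> F x y"
    and "\<bar>F x y\<bar> \<le> 2 powr E * 2 powr p * (k powr p + k * \<bar>u y\<bar> powr (p - 1)) * ?d"
    by (simp_all add: mult.assoc)
qed

lemma pair_form_outside: "x \<notin> B \<Longrightarrow> y \<notin> B \<Longrightarrow> F x y = 0"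
  using cutoff_outside[of x] cutoff_outside[of y] r by (auto simp: pair_form_def)

private abbreviation (input) "tail f \<equiv> \<integral>\<^sup>+y. indicator (- B) y * ennreal (f y * norm (y - x0) powr (- e)) \<partial>lborel"

lemma borel_measurable_pair_form: "(\<lambda>z. F (fst z) (snd z)) \<in> borel_measurable borel"
proof -
  have "test_function UNIV \<psi>" using r by (intro test_function_cutoff) auto
  note [measurable] = borel_measurable_test_function[OF this]
  show ?thesis unfolding pair_form_def borel_prod[symmetric] by measurable
qed

lemma nn_integral_far_part:
  assumes c: "0 \<le> c" and f: "f \<in> borel_measurable borel" "\<And>y. 0 \<le> f y"
  shows "(\<integral>\<^sup>+y. indicator (- B) y * ennreal (c * (k powr p + k * f y) * norm (y - x0) powr (- e)) \<partial>lborel)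
    \<le> ennreal (c * k powr p) * ennreal (far_const DIM('a) p * r powr (- p) / s) + ennreal (c * k) * tail f"
proof -
  note [measurable] = f(1)
  have "(\<integral>\<^sup>+y. indicator (- B) y * ennreal (c * (k powr p + k * f y) * norm (y - x0) powr (- e)) \<partial>lborel)
    = (\<integral>\<^sup>+y. ennreal (c * k powr p) * (indicator (- B) y * ennreal (norm (y - x0) powr (- e)))
        + ennreal (c * k) * (indicator (- B) y * ennreal (f y * norm (y - x0) powr (- e))) \<partial>lborel)"
    using c k f
    by (intro nn_integral_cong)
       (auto simp: indicator_def ennreal_mult[symmetric] ennreal_plus[symmetric] algebra_simps simp del: ennreal_plus)
  also have "\<dots> = ennreal (c * k powr p) * (\<integral>\<^sup>+y. indicator (- B) y * ennreal (norm (y - x0) powr (- e)) \<partial>lborel)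
      + ennreal (c * k) * tail f"
    by (simp add: nn_integral_add nn_integral_cmult)
  also have "\<dots> \<le> ennreal (c * k powr p) * ennreal (far_const DIM('a) p * r powr (- p) / s) + ennreal (c * k) * tail f"
    unfolding e using p s r by (intro add_right_mono mult_left_mono nn_integral_far_kernel) auto
  finally show ?thesis .
qed

text \<open>Absolute convergence for one order: \<open>Eu\<close> controls pairs inside the ball, the tail of \<open>u\<close> the
  mixed pairs.\<close>

lemma nn_integral_pair_form_le:
  assumes Eu: "\<And>h. (\<integral>\<^sup>+x. indicator B x * indicator B (x + h) * ennreal (\<bar>u (x + h) - u x\<bar> powr p) \<partial>lborel) \<le> ennreal (norm h powr p) * Eu"
  shows "(\<integral>\<^sup>+z. ennreal \<bar>F (fst z) (snd z)\<bar> \<partial>lborel)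
    \<le> ennreal (near_const DIM('a) p / (1 - s)) * (2 * Eu + ennreal ((64 * k / r) powr p) * emeasure lborel B)
      + 2 * emeasure lborel B * (ennreal (2 powr E * 2 powr p * k powr p) * ennreal (far_const DIM('a) p * r powr (- p) / s)
        + ennreal (2 powr E * 2 powr p * k) * tail (\<lambda>y. \<bar>u y\<bar> powr (p - 1)))"
proof -
  let ?A = "(64 * k / r) powr p"
  let ?D = "\<lambda>z. ennreal (2 * \<bar>u (fst z) - u (snd z)\<bar> powr p + ?A * norm (fst z - snd z) powr p)"
  let ?n = "\<lambda>z. ?D z * ennreal (norm (fst z - snd z) powr (- e))"
  let ?Z = "\<lambda>y. ennreal (2 powr E * 2 powr p * (k powr p + k * \<bar>u y\<bar> powr (p - 1)) * norm (y - x0) powr (- e))"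
  have Dm[measurable]: "?D \<in> borel_measurable borel" unfolding borel_prod[symmetric] by measurable
  have nm: "?n \<in> borel_measurable borel" unfolding borel_prod[symmetric] by measurable
  have ptw: "ennreal \<bar>F x y\<bar> \<le> indicator B x * indicator B y * ?n (x, y)
      + indicator B x * (indicator (- B) y * ?Z y) + indicator B y * (indicator (- B) x * ?Z x)" for x y
  proof (cases "x \<in> B"; cases "y \<in> B")
    assume xy: "x \<in> B" "y \<in> B"
    then show ?thesis
      using pair_form_near_abs_le[OF xy]
      by (simp add: ennreal_mult''[symmetric] ennreal_leI del: ennreal_plus)
  next
    assume xy: "x \<in> B" "y \<notin> B"
    then show ?thesis
      using pair_form_cross_abs_le[OF xy] by (simp add: ennreal_leI)
  next
    assume xy: "x \<notin> B" "y \<in> B"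
    then show ?thesis
      using pair_form_cross_abs_le[OF xy(2,1)] by (simp add: ennreal_leI pair_form_commute[of _ _ _ _ x y])
  next
    assume xy: "x \<notin> B" "y \<notin> B"
    then show ?thesis using pair_form_outside[OF xy] by simp
  qed
  have "(\<integral>\<^sup>+z. ennreal \<bar>F (fst z) (snd z)\<bar> \<partial>lborel)
    \<le> (\<integral>\<^sup>+z. indicator B (fst z) * indicator B (snd z) * ?n z
      + indicator B (fst z) * (indicator (- B) (snd z) * ?Z (snd z)) + indicator B (snd z) * (indicator (- B) (fst z) * ?Z (fst z)) \<partial>lborel)"
    by (intro nn_integral_mono) (use ptw in auto)
  also have "\<dots> = (\<integral>\<^sup>+x. \<integral>\<^sup>+y. indicator B x * indicator B y * ?n (x, y) \<partial>lborel \<partial>lborel)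
      + 2 * emeasure lborel B * (\<integral>\<^sup>+y. indicator (- B) y * ?Z y \<partial>lborel)"
    by (rule nn_integral_three_regions[OF _ _ nm]) measurable
  also have "\<dots> \<le> ennreal (near_const DIM('a) p / (1 - s)) * (2 * Eu + ennreal ?A * emeasure lborel B)
      + 2 * emeasure lborel B * (ennreal (2 powr E * 2 powr p * k powr p) * ennreal (far_const DIM('a) p * r powr (- p) / s)
        + ennreal (2 powr E * 2 powr p * k) * tail (\<lambda>y. \<bar>u y\<bar> powr (p - 1)))"
  proof (intro add_mono mult_left_mono)
    have "(\<integral>\<^sup>+x. indicator B x * indicator B (x + h) * ?D (x, x + h) \<partial>lborel) \<le> ennreal (norm h powr p) * (2 * Eu + ennreal ?A * emeasure lborel B)" for h
    proof -
      have "(\<integral>\<^sup>+x. indicator B x * indicator B (x + h) * ?D (x, x + h) \<partial>lborel)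
        \<le> (\<integral>\<^sup>+x. 2 * (indicator B x * indicator B (x + h) * ennreal (\<bar>u (x + h) - u x\<bar> powr p)) + ennreal (?A * norm h powr p) * indicator B x \<partial>lborel)"
      proof (rule nn_integral_mono)
        fix x
        have "?D (x, x + h) = 2 * ennreal (\<bar>u (x + h) - u x\<bar> powr p) + ennreal (?A * norm h powr p)"
          by (simp add: abs_minus_commute ennreal_mult)
        then show "indicator B x * indicator B (x + h) * ?D (x, x + h)
          \<le> 2 * (indicator B x * indicator B (x + h) * ennreal (\<bar>u (x + h) - u x\<bar> powr p)) + ennreal (?A * norm h powr p) * indicator B x"
          by (auto simp: indicator_def)
      qed
      also have "\<dots> = 2 * (\<integral>\<^sup>+x. indicator B x * indicator B (x + h) * ennreal (\<bar>u (x + h) - u x\<bar> powr p) \<partial>lborel) + ennreal (?A * norm h powr p) * emeasure lborel B"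
        by (simp add: nn_integral_add nn_integral_cmult nn_integral_cmult_indicator)
      also have "\<dots> \<le> 2 * (ennreal (norm h powr p) * Eu) + ennreal (?A * norm h powr p) * emeasure lborel B"
        by (intro add_right_mono mult_left_mono Eu) simp
      also have "\<dots> = ennreal (norm h powr p) * (2 * Eu + ennreal ?A * emeasure lborel B)"
        by (simp add: ennreal_mult distrib_left mult_ac)
      finally show ?thesis .
    qed
    from nn_integral_near_kernel[OF Dm p s r this, folded e]
    show "(\<integral>\<^sup>+x. \<integral>\<^sup>+y. indicator B x * indicator B y * ?n (x, y) \<partial>lborel \<partial>lborel)
      \<le> ennreal (near_const DIM('a) p / (1 - s)) * (2 * Eu + ennreal ?A * emeasure lborel B)"
      by simp
    show "(\<integral>\<^sup>+y. indicator (- B) y * ?Z y \<partial>lborel)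
      \<le> ennreal (2 powr E * 2 powr p * k powr p) * ennreal (far_const DIM('a) p * r powr (- p) / s)
        + ennreal (2 powr E * 2 powr p * k) * tail (\<lambda>y. \<bar>u y\<bar> powr (p - 1))"
      by (rule nn_integral_far_part) auto
  qed simp
  finally show ?thesis .
qed

text \<open>Integration of the three pointwise bounds. Mixed pairs are counted in both orders in the bad part, but
  only in one in the good part, which is enough.\<close>

lemma integral_pair_form_ge:
  assumes int: "integrable lborel (\<lambda>z. F (fst z) (snd z))"
  shows "ennreal (exp (- 2) * 2 powr (- E) * 2 powr (1 - p) * k) * emeasure lborel (ball x0 (r / 4)) * tail (\<lambda>y. max (u y) 0 powr (p - 1))
      + ennreal (- (LINT z|lborel. F (fst z) (snd z)))
    \<le> ennreal (LINT z|lborel. F (fst z) (snd z))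
      + (ennreal (near_const DIM('a) p / (1 - s)) * (ennreal ((64 * k * p\<^sup>2 / r) powr p) * emeasure lborel B)
      + 2 * emeasure lborel B * (ennreal (2 powr E * (2 powr p + 1) * k powr p) * ennreal (far_const DIM('a) p * r powr (- p) / s)
        + ennreal (2 powr E * (2 powr p + 1) * k) * tail (\<lambda>y. max (- u y) 0 powr (p - 1))))"
proof -
  let ?A = "(64 * k * p\<^sup>2 / r) powr p" and ?c = "exp (- 2) * 2 powr (- E) * 2 powr (1 - p) * k"
  let ?P = "\<lambda>y. max (u y) 0 powr (p - 1) * norm (y - x0) powr (- e)"
  let ?D = "\<lambda>z :: 'a \<times> 'a. ennreal (?A * norm (fst z - snd z) powr p)"
  let ?n = "\<lambda>z :: 'a \<times> 'a. ?D z * ennreal (norm (fst z - snd z) powr (- e))"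
  let ?Z = "\<lambda>y. ennreal (2 powr E * (2 powr p + 1) * (k powr p + k * max (- u y) 0 powr (p - 1)) * norm (y - x0) powr (- e))"
  let ?g1 = "\<lambda>z. indicator (ball x0 (r / 4)) (fst z) * (indicator (- B) (snd z) * ennreal (?c * ?P (snd z)))"
  let ?g2 = "\<lambda>z. indicator B (fst z) * indicator B (snd z) * ?n z
      + indicator B (fst z) * (indicator (- B) (snd z) * ?Z (snd z)) + indicator B (snd z) * (indicator (- B) (fst z) * ?Z (fst z))"
  have Dm[measurable]: "?D \<in> borel_measurable borel" unfolding borel_prod[symmetric] by measurable
  have nm: "?n \<in> borel_measurable borel" unfolding borel_prod[symmetric] by measurable
  have Z0: "0 \<le> 2 powr E * (2 powr p + 1) * (k powr p + k * max (- u y) 0 powr (p - 1)) * norm (y - x0) powr (- e)" for y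
    using k by (intro mult_nonneg_nonneg add_nonneg_nonneg) auto
  have ptw: "?g1 (x, y) + ennreal (- F x y) \<le> ennreal (F x y) + ?g2 (x, y)" for x y
  proof (cases "x \<in> B"; cases "y \<in> B")
    assume xy: "x \<in> B" "y \<in> B"
    have "0 - ?A * norm (x - y) powr p * norm (x - y) powr (- e) \<le> F x y"
      using pair_form_near_ge[OF xy] by simp
    from ennreal_lower_bound[OF this] show ?thesis
      using xy by (simp add: ennreal_mult[symmetric])
  next
    assume xy: "x \<in> B" "y \<notin> B"
    have "ennreal (indicator (ball x0 (r / 4)) x * (?c * ?P y)) + ennreal (- F x y)
      \<le> ennreal (F x y) + ?Z y"
      using k by (intro ennreal_lower_bound[OF pair_form_cross_ge[OF xy]] Z0) auto
    then show ?thesis using xy by (cases "x \<in> ball x0 (r / 4)") simp_all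
  next
    assume xy: "x \<notin> B" "y \<in> B"
    have "ennreal (indicator (ball x0 (r / 4)) y * (?c * ?P x)) + ennreal (- F y x)
      \<le> ennreal (F y x) + ?Z x"
      using k by (intro ennreal_lower_bound[OF pair_form_cross_ge[OF xy(2,1)]] Z0) auto
    then have "ennreal (- F y x) \<le> ennreal (F y x) + ?Z x" by (rule order_trans[rotated]) simp
    then show ?thesis using xy by (simp add: pair_form_commute[of _ _ _ _ x y])
  next
    assume xy: "x \<notin> B" "y \<notin> B"
    have "x \<notin> ball x0 (r / 4)" using xy r by auto
    then show ?thesis using pair_form_outside[OF xy] by simp
  qed
  have le: "(\<integral>\<^sup>+z. ?g1 z \<partial>lborel) + ennreal (- (LINT z|lborel. F (fst z) (snd z)))
    \<le> ennreal (LINT z|lborel. F (fst z) (snd z)) + (\<integral>\<^sup>+z. ?g2 z \<partial>lborel)"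
  proof (rule nn_lower_bound_integral[OF int])
    show "?g1 \<in> borel_measurable lborel" "?g2 \<in> borel_measurable lborel"
      unfolding lborel_prod[symmetric] by measurable
    show "AE z in lborel. ?g1 z + ennreal (- F (fst z) (snd z)) \<le> ennreal (F (fst z) (snd z)) + ?g2 z"
    proof (intro AE_I2)
      fix z
      show "?g1 z + ennreal (- F (fst z) (snd z)) \<le> ennreal (F (fst z) (snd z)) + ?g2 z"
        using ptw[of "fst z" "snd z"] by (simp only: fst_conv snd_conv)
    qed
  qed
  have g1: "(\<integral>\<^sup>+z. ?g1 z \<partial>lborel) = ennreal ?c * emeasure lborel (ball x0 (r / 4)) * tail (\<lambda>y. max (u y) 0 powr (p - 1))"
  proof -
    have "(\<integral>\<^sup>+z. ?g1 z \<partial>lborel) = (\<integral>\<^sup>+x. \<integral>\<^sup>+y. ?g1 (x, y) \<partial>lborel \<partial>lborel)"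
      by (rule nn_integral_lborel_pair) (simp add: borel_prod[symmetric])
    also have "\<dots> = emeasure lborel (ball x0 (r / 4)) * (\<integral>\<^sup>+y. indicator (- B) y * ennreal (?c * ?P y) \<partial>lborel)"
      by (simp add: nn_integral_cmult nn_integral_multc)
    also have "(\<integral>\<^sup>+y. indicator (- B) y * ennreal (?c * ?P y) \<partial>lborel) = (\<integral>\<^sup>+y. ennreal ?c * (indicator (- B) y * ennreal (?P y)) \<partial>lborel)"
      using k by (intro nn_integral_cong) (auto simp: indicator_def ennreal_mult[symmetric])
    also have "\<dots> = ennreal ?c * tail (\<lambda>y. max (u y) 0 powr (p - 1))"
      by (rule nn_integral_cmult) measurable
    finally show ?thesis by (simp add: mult_ac)
  qed
  have g2: "(\<integral>\<^sup>+z. ?g2 z \<partial>lborel) \<le> ennreal (near_const DIM('a) p / (1 - s)) * (ennreal ?A * emeasure lborel B)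
      + 2 * emeasure lborel B * (ennreal (2 powr E * (2 powr p + 1) * k powr p) * ennreal (far_const DIM('a) p * r powr (- p) / s)
        + ennreal (2 powr E * (2 powr p + 1) * k) * tail (\<lambda>y. max (- u y) 0 powr (p - 1)))"
  proof -
    have "(\<integral>\<^sup>+z. ?g2 z \<partial>lborel) = (\<integral>\<^sup>+x. \<integral>\<^sup>+y. indicator B x * indicator B y * ?n (x, y) \<partial>lborel \<partial>lborel)
      + 2 * emeasure lborel B * (\<integral>\<^sup>+y. indicator (- B) y * ?Z y \<partial>lborel)"
      by (rule nn_integral_three_regions[OF _ _ nm]) measurable
    also have "\<dots> \<le> ennreal (near_const DIM('a) p / (1 - s)) * (ennreal ?A * emeasure lborel B)
      + 2 * emeasure lborel B * (ennreal (2 powr E * (2 powr p + 1) * k powr p) * ennreal (far_const DIM('a) p * r powr (- p) / s)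
        + ennreal (2 powr E * (2 powr p + 1) * k) * tail (\<lambda>y. max (- u y) 0 powr (p - 1)))"
    proof (intro add_mono mult_left_mono)
      have "(\<integral>\<^sup>+x. indicator B x * indicator B (x + h) * ?D (x, x + h) \<partial>lborel) \<le> ennreal (norm h powr p) * (ennreal ?A * emeasure lborel B)" for h
      proof -
        have "(\<integral>\<^sup>+x. indicator B x * indicator B (x + h) * ?D (x, x + h) \<partial>lborel)
          \<le> (\<integral>\<^sup>+x. ennreal (?A * norm h powr p) * indicator B x \<partial>lborel)"
          by (intro nn_integral_mono) (auto simp: indicator_def)
        also have "\<dots> = ennreal (norm h powr p) * (ennreal ?A * emeasure lborel B)"
          by (subst nn_integral_cmult_indicator) (simp_all add: ennreal_mult mult_ac)
        finally show ?thesis .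
      qed
      from nn_integral_near_kernel[OF Dm p s r this, folded e]
      show "(\<integral>\<^sup>+x. \<integral>\<^sup>+y. indicator B x * indicator B y * ?n (x, y) \<partial>lborel \<partial>lborel)
        \<le> ennreal (near_const DIM('a) p / (1 - s)) * (ennreal ?A * emeasure lborel B)"
        by simp
      show "(\<integral>\<^sup>+y. indicator (- B) y * ?Z y \<partial>lborel)
        \<le> ennreal (2 powr E * (2 powr p + 1) * k powr p) * ennreal (far_const DIM('a) p * r powr (- p) / s)
          + ennreal (2 powr E * (2 powr p + 1) * k) * tail (\<lambda>y. max (- u y) 0 powr (p - 1))"
        by (rule nn_integral_far_part) auto
    qed simp
    finally show ?thesis .
  qed
  from order_trans[OF le add_left_mono[OF g2]] show ?thesis unfolding g1 .
qed

end

section \<open>Integration over the orders of differentiation\<close>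

lemma C_Nps_pos: "0 < N \<Longrightarrow> 1 < p \<Longrightarrow> 0 < s \<Longrightarrow> s < 1 \<Longrightarrow> 0 < C_Nps N p s"
  unfolding C_Nps_def by (intro mult_pos_pos divide_pos_pos Gamma_real_pos add_pos_pos) auto

lemma continuous_on_C_Nps_factor:
  assumes "0 < N" "1 < p"
  shows "continuous_on {0..1} (\<lambda>s. (p / 2 * 2 powr (2 * s - 1)) / pi powr ((real N - 1) / 2) *
     (Gamma ((real N + p * s) / 2) / (Gamma ((p + 1) / 2) * Gamma (2 - s))))"
proof -
  have pos: "x \<notin> \<int>\<^sub>\<le>\<^sub>0" if "0 < x" for x :: real
    using that by (auto dest: nonpos_Ints_nonpos)
  have "continuous_on {0..1} (\<lambda>s. Gamma ((real N + p * s) / 2))"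
    using assms by (intro continuous_on_compose2[OF continuous_on_Gamma[of "{0<..}"]] continuous_intros)
      (auto intro!: add_pos_nonneg dest: pos)
  moreover have "continuous_on {0..1} (\<lambda>s::real. Gamma (2 - s))"
    by (intro continuous_on_compose2[OF continuous_on_Gamma[of "{0<..}"]] continuous_intros) (auto dest: pos)
  moreover have "Gamma (2 - s) \<noteq> 0" if "s \<in> {0..1}" for s :: real
  proof -
    have "0 < 2 - s" using that by auto
    then have "0 < Gamma (2 - s)" by (rule Gamma_real_pos)
    then show ?thesis by simp
  qed
  moreover have "Gamma ((p + 1) / 2) \<noteq> 0"
    using assms by (intro less_imp_neq[THEN not_sym] Gamma_real_pos) auto
  ultimately show ?thesis by (intro continuous_intros) auto
qed

text \<open>The Gamma factors are continuous on the compact interval \<open>[0, 1]\<close>, and the remaining factor is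
  \<open>s (1 - s)\<close>.\<close>

lemma C_Nps_bounded:
  assumes N: "0 < N" and p: "1 < p"
  obtains M where "0 < M"
    "\<And>s. 0 < s \<Longrightarrow> s < 1 \<Longrightarrow> C_Nps N p s / s \<le> M" "\<And>s. 0 < s \<Longrightarrow> s < 1 \<Longrightarrow> C_Nps N p s / (1 - s) \<le> M"
proof -
  let ?f = "\<lambda>s. (p / 2 * 2 powr (2 * s - 1)) / pi powr ((real N - 1) / 2) *
     (Gamma ((real N + p * s) / 2) / (Gamma ((p + 1) / 2) * Gamma (2 - s)))"
  have eq: "C_Nps N p s = s * (1 - s) * ?f s" for s by (simp add: C_Nps_def)
  have "compact (?f ` {0..1})"
    by (intro compact_continuous_image continuous_on_C_Nps_factor N p) simp
  from compact_imp_bounded[OF this] obtain M where M: "0 < M" "\<forall>y\<in>?f ` {0..1}. norm y \<le> M"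
    unfolding bounded_pos by blast
  have f: "c * ?f s \<le> M" if "0 < s" "s < 1" "0 \<le> c" "c \<le> 1" for s c
  proof -
    have "norm (?f s) \<le> M" by (rule bspec[OF M(2) imageI]) (use that in simp)
    then have "?f s \<le> M" unfolding real_norm_def by (rule order_trans[OF abs_ge_self])
    then have "c * ?f s \<le> c * M" using that(3) by (rule mult_left_mono)
    also have "\<dots> \<le> 1 * M" using that M(1) by (intro mult_right_mono) auto
    finally show ?thesis by simp
  qed
  show ?thesis
  proof (rule that[OF M(1)])
    fix s :: real assume s: "0 < s" "s < 1"
    have "C_Nps N p s / s = (1 - s) * ?f s" unfolding eq using s by (simp add: mult.assoc)
    also have "\<dots> \<le> M" by (rule f) (use s in auto)
    finally show "C_Nps N p s / s \<le> M" .
    have "C_Nps N p s / (1 - s) = s * ?f s" unfolding eq using s by (simp add: mult.left_commute mult.assoc)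
    also have "\<dots> \<le> M" by (rule f) (use s in auto)
    finally show "C_Nps N p s / (1 - s) \<le> M" .
  qed
qed

text \<open>Extension by zero makes the weight Borel on the whole line, so the integrals over \<open>\<mu>\<close> need no
  restriction to the open interval.\<close>

definition order_weight :: "nat \<Rightarrow> real \<Rightarrow> real \<Rightarrow> real" where
  "order_weight N p s = indicator {0<..<1} s * C_Nps N p s"

lemma order_weight_nonneg: "0 < N \<Longrightarrow> 1 < p \<Longrightarrow> 0 \<le> order_weight N p s"
  using C_Nps_pos[of N p s] by (auto simp: order_weight_def indicator_def)

lemma borel_measurable_order_weight:
  assumes "0 < N" "1 < p"
  shows "order_weight N p \<in> borel_measurable borel"
proof -
  let ?f = "\<lambda>s. (p / 2 * 2 powr (2 * s - 1)) / pi powr ((real N - 1) / 2) *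
     (Gamma ((real N + p * s) / 2) / (Gamma ((p + 1) / 2) * Gamma (2 - s)))"
  have "continuous_on {0<..<1} ?f"
    by (rule continuous_on_subset[OF continuous_on_C_Nps_factor[OF assms]]) auto
  then have "continuous_on {0<..<1} (\<lambda>s. s * (1 - s) * ?f s)"
    by (rule continuous_on_mult[rotated]) (intro continuous_intros)
  then have "(\<lambda>s. indicator {0<..<1} s *\<^sub>R (s * (1 - s) * ?f s)) \<in> borel_measurable borel"
    by (rule borel_measurable_continuous_on_indicator[rotated]) simp
  moreover have "indicator {0<..<1} s *\<^sub>R (s * (1 - s) * ?f s) = order_weight N p s" for s
    by (simp add: order_weight_def C_Nps_def)
  ultimately show ?thesis by (simp only:)
qed

definition tail_at :: "real \<Rightarrow> real \<Rightarrow> ('a::euclidean_space \<Rightarrow> real) \<Rightarrow> 'a \<Rightarrow> real \<Rightarrow> ennreal" where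
  "tail_at p s f x0 r =
    (\<integral>\<^sup>+y. indicator (- ball x0 r) y * ennreal (f y * norm (y - x0) powr (- (real DIM('a) + s * p))) \<partial>lborel)"

lemma borel_measurable_tail_at:
  fixes f :: "'a::euclidean_space \<Rightarrow> real"
  assumes [measurable]: "f \<in> borel_measurable borel"
  shows "(\<lambda>s. tail_at p s f x0 r) \<in> borel_measurable borel"
  unfolding tail_at_def by measurable

lemma borel_measurable_on_interval:
  assumes "sets \<mu> = sets (restrict_space borel A)" "f \<in> borel_measurable borel"
  shows "f \<in> borel_measurable \<mu>"
  using measurable_restrict_space1[OF assms(2), of A] assms(1) by (simp cong: measurable_cong_sets)

lemma Tail_integral_eq:
  fixes w w' :: "'a::euclidean_space \<Rightarrow> real"
  assumes p: "1 < p" and sets: "sets \<mu> = sets (restrict_space borel {0..1})"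
    and w': "w' \<in> borel_measurable borel" "AE x in lborel. w x = w' x"
  shows "Tail_integral \<mu> p w x0 r
    = ennreal (r powr p) * (\<integral>\<^sup>+s. ennreal (order_weight DIM('a) p s) * tail_at p s (\<lambda>y. \<bar>w' y\<bar> powr (p - 1)) x0 r \<partial>\<mu>)"
proof -
  note [measurable] = w'(1)
  have "(\<lambda>s. ennreal (order_weight DIM('a) p s) * tail_at p s (\<lambda>y. \<bar>w' y\<bar> powr (p - 1)) x0 r) \<in> borel_measurable borel"
    using borel_measurable_order_weight[of "DIM('a)" p] borel_measurable_tail_at[of "\<lambda>y. \<bar>w' y\<bar> powr (p - 1)" p x0 r] p by measurable
  then have m: "(\<lambda>s. ennreal (order_weight DIM('a) p s) * tail_at p s (\<lambda>y. \<bar>w' y\<bar> powr (p - 1)) x0 r) \<in> borel_measurable \<mu>"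
    by (rule borel_measurable_on_interval[OF sets])
  have "(\<integral>\<^sup>+y\<in>- ball x0 r. ennreal (\<bar>w y\<bar> powr (p - 1) / norm (y - x0) powr (real DIM('a) + s * p)) \<partial>lebesgue)
    = tail_at p s (\<lambda>y. \<bar>w' y\<bar> powr (p - 1)) x0 r" for s
  proof -
    have "a / b powr c = a * b powr (- c)" for a b c :: real by (simp add: powr_minus divide_inverse)
    then show ?thesis
      unfolding tail_at_def nn_integral_completion using w'(2)
      by (intro nn_integral_cong_AE) (auto simp: mult.commute)
  qed
  then have "Tail_integral \<mu> p w x0 r
    = (\<integral>\<^sup>+s. ennreal (r powr p) * (ennreal (order_weight DIM('a) p s) * tail_at p s (\<lambda>y. \<bar>w' y\<bar> powr (p - 1)) x0 r) \<partial>\<mu>)"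
    unfolding Tail_integral_def
    by (intro nn_integral_cong)
       (auto simp: order_weight_def indicator_def ennreal_mult' ennreal_mult'' mult_ac)
  also have "\<dots> = ennreal (r powr p) * (\<integral>\<^sup>+s. ennreal (order_weight DIM('a) p s) * tail_at p s (\<lambda>y. \<bar>w' y\<bar> powr (p - 1)) x0 r \<partial>\<mu>)"
    by (rule nn_integral_cmult[OF m])
  finally show ?thesis .
qed

lemma AE_lborel_imp_AE_lborel_pair:
  fixes N :: "'a::euclidean_space \<Rightarrow> bool"
  assumes "AE x in lborel. N x"
  shows "AE z in (lborel :: ('a \<times> 'a) measure). N (fst z) \<and> N (snd z)"
proof -
  obtain A where A: "A \<in> null_sets lborel" "{x. \<not> N x} \<subseteq> A"
    using assms by (auto elim!: AE_E intro: that simp: null_sets_def)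
  have [measurable]: "A \<in> sets borel" using A by auto
  have a: "AE x in lborel. x \<notin> A" by (rule AE_not_in[OF A(1)])
  have "AE z in lborel \<Otimes>\<^sub>M lborel. fst z \<notin> A \<and> snd z \<notin> A"
  proof (rule lborel_pair.AE_pair_measure)
    show "AE x in lborel. AE y in lborel. fst (x, y) \<notin> A \<and> snd (x, y) \<notin> A"
      using a by eventually_elim (use a in simp)
  qed measurable
  then show ?thesis unfolding lborel_prod by eventually_elim (use A in blast)
qed

text \<open>Replacing \<open>u\<close> and \<open>v\<close> by Borel representatives turns the integral over the completed product
  into one over the product measure, where Tonelli's theorem applies.\<close>

lemma nonlocal_form_eq:
  fixes u u' v v' :: "'a::euclidean_space \<Rightarrow> real" and p :: real
  assumes sets: "sets \<mu> = sets (restrict_space borel {0..1})"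
    and u: "u' \<in> borel_measurable borel" "AE x in lborel. u x = u' x"
    and v: "v' \<in> borel_measurable borel" "AE x in lborel. v x = v' x"
  shows "nonlocal_form \<mu> p u v
    = (LINT s|\<mu>. order_weight DIM('a) p s * (LINT z|lborel. pair_form p (real DIM('a) + s * p) u' v' (fst z) (snd z)))"
proof -
  note [measurable] = u(1) v(1)
  have "AE x in lborel. u x = u' x \<and> v x = v' x" using u(2) v(2) by eventually_elim simp
  from AE_lborel_imp_AE_lborel_pair[OF this]
  have ae: "AE z in (lebesgue :: ('a \<times> 'a) measure). (u (fst z) = u' (fst z) \<and> v (fst z) = v' (fst z)) \<and> (u (snd z) = u' (snd z) \<and> v (snd z) = v' (snd z))"
    by (rule AE_completion)
  have inner: "(LINT (x, y)|(lebesgue :: ('a \<times> 'a) measure). \<bar>u x - u y\<bar> powr (p - 2) * (u x - u y) * (v x - v y) / norm (x - y) powr (real DIM('a) + s * p))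
    = (LINT z|lborel. pair_form p (real DIM('a) + s * p) u' v' (fst z) (snd z))" for s
  proof -
    have m: "(\<lambda>z. pair_form p (real DIM('a) + s * p) u' v' (fst z) (snd z)) \<in> borel_measurable borel"
      unfolding pair_form_def borel_prod[symmetric] by measurable
    then have m': "(\<lambda>z. pair_form p (real DIM('a) + s * p) u' v' (fst z) (snd z)) \<in> borel_measurable lebesgue"
      by (simp add: measurable_completion)
    have eq: "AE z in lebesgue. pair_form p (real DIM('a) + s * p) u' v' (fst z) (snd z)
      = (case z of (x, y) \<Rightarrow> \<bar>u x - u y\<bar> powr (p - 2) * (u x - u y) * (v x - v y) / norm (x - y) powr (real DIM('a) + s * p))"
      using ae by eventually_elim (auto simp: pair_form_def)
    have "(LINT (x, y)|(lebesgue :: ('a \<times> 'a) measure). \<bar>u x - u y\<bar> powr (p - 2) * (u x - u y) * (v x - v y) / norm (x - y) powr (real DIM('a) + s * p))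
      = (LINT z|lebesgue. pair_form p (real DIM('a) + s * p) u' v' (fst z) (snd z))"
      using eq by (intro integral_cong_AE borel_measurable_AE[OF m' eq] m') auto
    then show ?thesis using m by (simp add: integral_completion)
  qed
  show ?thesis unfolding nonlocal_form_def inner set_lebesgue_integral_def
    by (intro Bochner_Integration.integral_cong) (auto simp: order_weight_def)
qed

context
  fixes u :: "'a::euclidean_space \<Rightarrow> real" and x0 :: 'a and r k p :: real and \<mu> :: "real measure" and M E K1 K2 :: real and W :: "real \<Rightarrow> real" and Eu :: ennreal
  assumes E: "E = real DIM('a) + p" and W: "W = order_weight DIM('a) p"
    and K1: "K1 = near_const DIM('a) p"
    and K2: "K2 = far_const DIM('a) p"
    and p: "1 < p" and r: "0 < r" "r \<le> 1" and k: "0 < k"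
    and um[measurable]: "u \<in> borel_measurable borel"
    and uk: "\<And>x. x \<in> ball x0 r \<Longrightarrow> 0 \<le> u x \<and> u x \<le> k"
    and sets: "sets \<mu> = sets (restrict_space borel {0..1})" and fin: "finite_measure \<mu>"
    and M: "0 < M"
      "\<And>s. 0 < s \<Longrightarrow> s < 1 \<Longrightarrow> C_Nps DIM('a) p s / s \<le> M" "\<And>s. 0 < s \<Longrightarrow> s < 1 \<Longrightarrow> C_Nps DIM('a) p s / (1 - s) \<le> M"
    and Eu: "Eu < \<infinity>" "\<And>h. (\<integral>\<^sup>+x. indicator (ball x0 r) x * indicator (ball x0 r) (x + h) * ennreal (\<bar>u (x + h) - u x\<bar> powr p) \<partial>lborel)
      \<le> ennreal (norm h powr p) * Eu"
    and tail_fin: "(\<integral>\<^sup>+s. ennreal (W s) * tail_at p s (\<lambda>y. \<bar>u y\<bar> powr (p - 1)) x0 r \<partial>\<mu>) < \<infinity>"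
begin

private abbreviation (input) "\<Phi> s \<equiv> pair_form p (real DIM('a) + s * p) u (\<lambda>x. (u x - 2 * k) * cutoff 1 x0 (r / 2) x)"
private abbreviation (input) "I s \<equiv> (LINT z|lborel. \<Phi> s (fst z) (snd z))"

lemma weight_measurable [measurable]: "W \<in> borel_measurable borel"
  unfolding W using p by (intro borel_measurable_order_weight) auto

lemma weight_nonneg: "0 \<le> W s"
  unfolding W using p by (intro order_weight_nonneg) auto

lemma weight_bounds:
  "0 \<le> c \<Longrightarrow> W s * (c / s) \<le> c * M" "0 \<le> c \<Longrightarrow> W s * (c / (1 - s)) \<le> c * M"
proof -
  have *: "C_Nps DIM('a) p s * (c / t) \<le> c * M" if "C_Nps DIM('a) p s / t \<le> M" "0 \<le> c" for t
    using mult_left_mono[OF that] by (simp add: mult_ac)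
  show "0 \<le> c \<Longrightarrow> W s * (c / s) \<le> c * M" "0 \<le> c \<Longrightarrow> W s * (c / (1 - s)) \<le> c * M"
    using M * by (auto simp: W order_weight_def indicator_def)
qed

lemma weight_eq_0: "\<not> (0 < s \<and> s < 1) \<Longrightarrow> W s = 0"
  by (auto simp: W order_weight_def)

lemma pair_form_integral_measurable: "(\<lambda>s. I s) \<in> borel_measurable borel"
proof -
  have "test_function UNIV (cutoff 1 x0 (r / 2))" using r by (intro test_function_cutoff) auto
  note [measurable] = borel_measurable_test_function[OF this]
  have "(\<lambda>s. LINT z|(lborel \<Otimes>\<^sub>M lborel). \<Phi> s (fst z) (snd z)) \<in> borel_measurable borel"
    unfolding pair_form_def by measurable
  then show ?thesis by (simp add: lborel_prod)
qed

text \<open>The factors \<open>1/s\<close> and \<open>1/(1-s)\<close> are absorbed by the weight, so only the tail still depends on \<open>s\<close>.\<close>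

lemma nn_integral_weighted_pair_form_le:
  "\<exists>A B. A < \<infinity> \<and> B < \<infinity> \<and> (\<forall>s. ennreal (W s) * (\<integral>\<^sup>+z. ennreal \<bar>\<Phi> s (fst z) (snd z)\<bar> \<partial>lborel)
    \<le> A + B * (ennreal (W s) * tail_at p s (\<lambda>y. \<bar>u y\<bar> powr (p - 1)) x0 r))"
proof -
  let ?m = "emeasure lborel (ball x0 r)"
  let ?Q = "2 * Eu + ennreal ((64 * k / r) powr p) * ?m"
  let ?c = "2 powr E * 2 powr p * k powr p" and ?d = "2 powr E * 2 powr p * k"
  let ?A = "ennreal (K1 * M) * ?Q + 2 * ?m * ennreal (?c * K2 * r powr (- p) * M)"
  let ?B = "2 * ?m * ennreal ?d"
  have mfin: "?m < \<infinity>" by (rule emeasure_bounded_finite[OF bounded_ball])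
  have K: "0 \<le> K1" "0 \<le> K2" using p by (simp_all add: K1 K2 near_const_nonneg far_const_nonneg)
  have "?A < \<infinity>" "?B < \<infinity>"
    using Eu(1) mfin by (auto simp: ennreal_mult_less_top less_top[symmetric] ennreal_mult_eq_top_iff)
  moreover have "ennreal (W s) * (\<integral>\<^sup>+z. ennreal \<bar>\<Phi> s (fst z) (snd z)\<bar> \<partial>lborel)
      \<le> ?A + ?B * (ennreal (W s) * tail_at p s (\<lambda>y. \<bar>u y\<bar> powr (p - 1)) x0 r)" for s
  proof (cases "0 < s \<and> s < 1")
    case True
    then have s: "0 < s" "s < 1" by auto
    let ?t = "tail_at p s (\<lambda>y. \<bar>u y\<bar> powr (p - 1)) x0 r"
    have "ennreal (W s) * (\<integral>\<^sup>+z. ennreal \<bar>\<Phi> s (fst z) (snd z)\<bar> \<partial>lborel)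
      \<le> ennreal (W s) * (ennreal (K1 / (1 - s)) * ?Q + 2 * ?m * (ennreal ?c * ennreal (K2 * r powr (- p) / s) + ennreal ?d * ?t))"
      unfolding tail_at_def K1 K2
      by (intro mult_left_mono nn_integral_pair_form_le[OF refl E p r k s um uk Eu(2)]) auto
    also have "\<dots> = ennreal (W s * (K1 / (1 - s))) * ?Q + 2 * ?m * ennreal (W s * (?c * K2 * r powr (- p) / s)) + ?B * (ennreal (W s) * ?t)"
    proof -
      have gen: "w * (a * Q + m * (b + d * t)) = (w * a) * Q + m * (w * b) + (m * d) * (w * t)"
        for w a Q m b d t :: ennreal by (simp add: distrib_left mult_ac add_ac)
      have 1: "ennreal (W s * (K1 / (1 - s))) = ennreal (W s) * ennreal (K1 / (1 - s))"
        by (rule ennreal_mult'[OF weight_nonneg])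
      have "ennreal (W s * (?c * (K2 * r powr (- p) / s))) = ennreal (W s) * ennreal (?c * (K2 * r powr (- p) / s))"
        by (rule ennreal_mult'[OF weight_nonneg])
      also have "ennreal (?c * (K2 * r powr (- p) / s)) = ennreal ?c * ennreal (K2 * r powr (- p) / s)"
        by (rule ennreal_mult') simp
      finally have 2: "ennreal (W s * (?c * K2 * r powr (- p) / s)) = ennreal (W s) * (ennreal ?c * ennreal (K2 * r powr (- p) / s))"
        by (simp add: mult.assoc)
      show ?thesis unfolding 1 2 by (rule gen)
    qed
    also have "\<dots> \<le> ennreal (K1 * M) * ?Q + 2 * ?m * ennreal (?c * K2 * r powr (- p) * M) + ?B * (ennreal (W s) * ?t)"
      using K k by (intro add_mono mult_mono ennreal_leI weight_bounds order_refl mult_nonneg_nonneg) auto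
    finally show ?thesis .
  next
    case False
    then show ?thesis by (simp add: weight_eq_0)
  qed
  ultimately show ?thesis by blast
qed

lemma tail_at_measurable:
  assumes "f \<in> borel_measurable borel"
  shows "(\<lambda>s. ennreal (W s) * tail_at p s f x0 r) \<in> borel_measurable \<mu>"
proof -
  note [measurable] = borel_measurable_tail_at[OF assms, of p x0 r] weight_measurable
  have "(\<lambda>s. ennreal (W s) * tail_at p s f x0 r) \<in> borel_measurable borel" by measurable
  then show ?thesis by (rule borel_measurable_on_interval[OF sets])
qed

lemma nn_integral_norm_weighted_pair_form_finite:
  "(\<integral>\<^sup>+s. ennreal (W s) * (\<integral>\<^sup>+z. ennreal \<bar>\<Phi> s (fst z) (snd z)\<bar> \<partial>lborel) \<partial>\<mu>) < \<infinity>"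
proof -
  interpret finite_measure \<mu> by (rule fin)
  obtain A B where AB: "A < \<infinity>" "B < \<infinity>" "\<And>s. ennreal (W s) * (\<integral>\<^sup>+z. ennreal \<bar>\<Phi> s (fst z) (snd z)\<bar> \<partial>lborel)
    \<le> A + B * (ennreal (W s) * tail_at p s (\<lambda>y. \<bar>u y\<bar> powr (p - 1)) x0 r)"
    using nn_integral_weighted_pair_form_le by blast
  note [measurable] = tail_at_measurable[of "\<lambda>y. \<bar>u y\<bar> powr (p - 1)"]
  have "(\<integral>\<^sup>+s. ennreal (W s) * (\<integral>\<^sup>+z. ennreal \<bar>\<Phi> s (fst z) (snd z)\<bar> \<partial>lborel) \<partial>\<mu>)
    \<le> (\<integral>\<^sup>+s. A + B * (ennreal (W s) * tail_at p s (\<lambda>y. \<bar>u y\<bar> powr (p - 1)) x0 r) \<partial>\<mu>)"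
    by (intro nn_integral_mono AB)
  also have "\<dots> = A * emeasure \<mu> (space \<mu>) + B * (\<integral>\<^sup>+s. ennreal (W s) * tail_at p s (\<lambda>y. \<bar>u y\<bar> powr (p - 1)) x0 r \<partial>\<mu>)"
    by (subst nn_integral_add) (simp_all add: nn_integral_cmult)
  also have "\<dots> < \<infinity>"
    using AB(1,2) tail_fin emeasure_finite[of "space \<mu>"]
    by (simp add: ennreal_mult_less_top ennreal_mult_eq_top_iff less_top[symmetric])
  finally show ?thesis .
qed

lemma integrable_weighted_pair_form: "integrable \<mu> (\<lambda>s. W s * I s)"
proof (rule integrableI_bounded)
  note Wm = weight_measurable
  note Im = pair_form_integral_measurable
  show "(\<lambda>s. W s * I s) \<in> borel_measurable \<mu>"
    by (intro borel_measurable_on_interval[OF sets] borel_measurable_times Wm Im)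
  have "(\<integral>\<^sup>+s. ennreal (norm (W s * I s)) \<partial>\<mu>)
    \<le> (\<integral>\<^sup>+s. ennreal (W s) * (\<integral>\<^sup>+z. ennreal \<bar>\<Phi> s (fst z) (snd z)\<bar> \<partial>lborel) \<partial>\<mu>)"
  proof (rule nn_integral_mono)
    fix s
    have "ennreal \<bar>I s\<bar> \<le> (\<integral>\<^sup>+z. ennreal \<bar>\<Phi> s (fst z) (snd z)\<bar> \<partial>lborel)"
    proof (cases "integrable lborel (\<lambda>z. \<Phi> s (fst z) (snd z))")
      case True
      from integral_norm_bound_ennreal[OF this] show ?thesis by simp
    qed (simp add: not_integrable_integral_eq)
    then have "ennreal (W s) * ennreal \<bar>I s\<bar> \<le> ennreal (W s) * (\<integral>\<^sup>+z. ennreal \<bar>\<Phi> s (fst z) (snd z)\<bar> \<partial>lborel)"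
      by (rule mult_left_mono) simp
    then show "ennreal (norm (W s * I s)) \<le> ennreal (W s) * (\<integral>\<^sup>+z. ennreal \<bar>\<Phi> s (fst z) (snd z)\<bar> \<partial>lborel)"
      using weight_nonneg[of s] by (simp add: abs_mult ennreal_mult)
  qed
  also note nn_integral_norm_weighted_pair_form_finite
  finally show "(\<integral>\<^sup>+s. ennreal (norm (W s * I s)) \<partial>\<mu>) < \<infinity>" .
qed

text \<open>The tail integral is finite after integration over \<open>\<mu>\<close>, hence finite for almost every order with
  positive weight.\<close>

lemma AE_integrable_pair_form: "AE s in \<mu>. 0 < W s \<longrightarrow> integrable lborel (\<lambda>z. \<Phi> s (fst z) (snd z))"
proof -
  obtain A B where AB: "A < \<infinity>" "B < \<infinity>" "\<And>s. ennreal (W s) * (\<integral>\<^sup>+z. ennreal \<bar>\<Phi> s (fst z) (snd z)\<bar> \<partial>lborel)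
    \<le> A + B * (ennreal (W s) * tail_at p s (\<lambda>y. \<bar>u y\<bar> powr (p - 1)) x0 r)"
    using nn_integral_weighted_pair_form_le by blast
  have "AE s in \<mu>. ennreal (W s) * tail_at p s (\<lambda>y. \<bar>u y\<bar> powr (p - 1)) x0 r \<noteq> \<infinity>"
    using tail_fin by (intro nn_integral_PInf_AE tail_at_measurable) auto
  then show ?thesis
  proof eventually_elim
    case (elim s)
    show ?case
    proof
      assume W0: "0 < W s"
      then have s: "0 < s" "s < 1"
        using weight_eq_0[of s] by force+
      have "A + B * (ennreal (W s) * tail_at p s (\<lambda>y. \<bar>u y\<bar> powr (p - 1)) x0 r) < \<infinity>"
        using AB(1,2) elim by (simp add: ennreal_mult_less_top ennreal_mult_eq_top_iff less_top[symmetric])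
      then have "ennreal (W s) * (\<integral>\<^sup>+z. ennreal \<bar>\<Phi> s (fst z) (snd z)\<bar> \<partial>lborel) < \<infinity>"
        using AB(3)[of s] by (rule le_less_trans[rotated])
      then have "(\<integral>\<^sup>+z. ennreal \<bar>\<Phi> s (fst z) (snd z)\<bar> \<partial>lborel) < \<infinity>"
        using W0 by (auto simp: ennreal_mult_less_top)
      then show "integrable lborel (\<lambda>z. \<Phi> s (fst z) (snd z))"
        using borel_measurable_pair_form[OF refl E p r k s um uk]
        by (intro integrableI_bounded) auto
    qed
  qed
qed

text \<open>The bound for one order, multiplied by the weight and integrated. The two terms with
  the integral of the weighted forms are the negative and the positive part of the nonlocal form.\<close>

lemma weighted_tail_estimate:
  fixes V :: real
  assumes V: "emeasure lborel (ball x0 r) = ennreal V" "0 \<le> V"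
  shows "ennreal (exp (- 2) * 2 powr (- E) * 2 powr (1 - p) * k) * emeasure lborel (ball x0 (r / 4))
        * (\<integral>\<^sup>+s. ennreal (W s) * tail_at p s (\<lambda>y. max (u y) 0 powr (p - 1)) x0 r \<partial>\<mu>)
      + ennreal (- (LINT s|\<mu>. W s * I s))
    \<le> ennreal (LINT s|\<mu>. W s * I s)
      + (ennreal (V * (K1 * M * (64 * k * p\<^sup>2 / r) powr p + 2 * (2 powr E * (2 powr p + 1) * k powr p * (K2 * r powr (- p)) * M))) * emeasure \<mu> (space \<mu>)
        + ennreal (2 * V * (2 powr E * (2 powr p + 1) * k)) * (\<integral>\<^sup>+s. ennreal (W s) * tail_at p s (\<lambda>y. max (- u y) 0 powr (p - 1)) x0 r \<partial>\<mu>))"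
proof -
  let ?c = "ennreal (exp (- 2) * 2 powr (- E) * 2 powr (1 - p) * k) * emeasure lborel (ball x0 (r / 4))"
  let ?P = "\<lambda>s. tail_at p s (\<lambda>y. max (u y) 0 powr (p - 1)) x0 r" and ?Q = "\<lambda>s. tail_at p s (\<lambda>y. max (- u y) 0 powr (p - 1)) x0 r"
  let ?A = "(64 * k * p\<^sup>2 / r) powr p" and ?C = "2 powr E * (2 powr p + 1) * k powr p" and ?D = "2 powr E * (2 powr p + 1) * k"
  let ?G = "V * (K1 * M * ?A + 2 * (?C * (K2 * r powr (- p)) * M))"
  have Pm: "(\<lambda>s. ennreal (W s) * ?P s) \<in> borel_measurable \<mu>" and Qm: "(\<lambda>s. ennreal (W s) * ?Q s) \<in> borel_measurable \<mu>"
    by (intro tail_at_measurable; measurable)+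
  note wn = weight_nonneg
  note wb = weight_bounds
  note w0 = weight_eq_0
  have K: "0 \<le> K1" "0 \<le> K2" using p by (simp_all add: K1 K2 near_const_nonneg far_const_nonneg)
  have C0: "0 \<le> ?C" and D0: "0 \<le> ?D" using k by auto
  have "(\<integral>\<^sup>+s. ?c * (ennreal (W s) * ?P s) \<partial>\<mu>) + ennreal (- (LINT s|\<mu>. W s * I s))
    \<le> ennreal (LINT s|\<mu>. W s * I s) + (\<integral>\<^sup>+s. ennreal ?G + ennreal (2 * V * ?D) * (ennreal (W s) * ?Q s) \<partial>\<mu>)"
  proof (rule nn_lower_bound_integral[OF integrable_weighted_pair_form])
    show "(\<lambda>s. ?c * (ennreal (W s) * ?P s)) \<in> borel_measurable \<mu>"
      "(\<lambda>s. ennreal ?G + ennreal (2 * V * ?D) * (ennreal (W s) * ?Q s)) \<in> borel_measurable \<mu>"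
      using Pm Qm by measurable
    show "AE s in \<mu>. ?c * (ennreal (W s) * ?P s) + ennreal (- (W s * I s))
      \<le> ennreal (W s * I s) + (ennreal ?G + ennreal (2 * V * ?D) * (ennreal (W s) * ?Q s))"
      using AE_integrable_pair_form
    proof eventually_elim
      case (elim s)
      show ?case
      proof (cases "0 < W s")
        case True
        then have s: "0 < s" "s < 1" using w0[of s] by force+
        have int: "integrable lborel (\<lambda>z. \<Phi> s (fst z) (snd z))" using elim True by blast
        have base: "?c * ?P s + ennreal (- I s)
          \<le> ennreal (I s) + (ennreal (K1 / (1 - s)) * (ennreal ?A * ennreal V) + 2 * ennreal V * (ennreal ?C * ennreal (K2 * r powr (- p) / s) + ennreal ?D * ?Q s))"
          using integral_pair_form_ge[OF refl E p r k s um uk int] unfolding tail_at_def V(1) K1 K2 by simp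
        have e1: "ennreal (W s) * ennreal x = ennreal (W s * x)" for x by (rule ennreal_mult'[OF wn, symmetric])
        have "?c * (ennreal (W s) * ?P s) + ennreal (- (W s * I s)) = ennreal (W s) * (?c * ?P s + ennreal (- I s))"
          by (simp add: distrib_left e1 mult_ac)
        also have "\<dots> \<le> ennreal (W s) * (ennreal (I s) + (ennreal (K1 / (1 - s)) * (ennreal ?A * ennreal V) + 2 * ennreal V * (ennreal ?C * ennreal (K2 * r powr (- p) / s) + ennreal ?D * ?Q s)))"
          by (rule mult_left_mono[OF base]) simp
        also have "\<dots> = ennreal (W s * I s) + (ennreal (W s * (K1 / (1 - s)) * (?A * V) + 2 * V * (?C * (W s * (K2 * r powr (- p) / s)))) + ennreal (2 * V * ?D) * (ennreal (W s) * ?Q s))"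
        proof -
          have gen: "w * (i + (a * (A * v) + 2 * v * (C * b + D * q))) = w * i + (((w * a) * (A * v) + 2 * v * (C * (w * b))) + (2 * v * D) * (w * q))"
            for w i a A v C b D q :: ennreal by (simp add: distrib_left mult_ac add_ac)
          have 1: "ennreal (W s * (K1 / (1 - s)) * (?A * V) + 2 * V * (?C * (W s * (K2 * r powr (- p) / s))))
            = ennreal (W s) * ennreal (K1 / (1 - s)) * (ennreal ?A * ennreal V) + 2 * ennreal V * (ennreal ?C * (ennreal (W s) * ennreal (K2 * r powr (- p) / s)))"
          proof -
            have "ennreal (w * x * (a * v) + 2 * v * (c * (w * y)))
              = ennreal w * ennreal x * (ennreal a * ennreal v) + 2 * ennreal v * (ennreal c * (ennreal w * ennreal y))"
              if "0 \<le> w" "0 \<le> x" "0 \<le> a" "0 \<le> v" "0 \<le> c" "0 \<le> y" for w x a v c y :: real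
              using that by (simp add: ennreal_mult)
            from this show ?thesis by (rule) (use wn[of s] K s V(2) C0 in auto)
          qed
          have 2: "ennreal (2 * V * ?D) = 2 * ennreal V * ennreal ?D" using V D0 by (simp add: ennreal_mult)
          have 3: "ennreal (W s * I s) = ennreal (W s) * ennreal (I s)" by (rule ennreal_mult'[OF wn])
          show ?thesis unfolding 1 2 3 by (rule gen)
        qed
        also have "\<dots> \<le> ennreal (W s * I s) + (ennreal ?G + ennreal (2 * V * ?D) * (ennreal (W s) * ?Q s))"
        proof (intro add_left_mono add_right_mono ennreal_leI)
          have "W s * (K1 / (1 - s)) * (?A * V) + 2 * V * (?C * (W s * (K2 * r powr (- p) / s)))
            \<le> K1 * M * (?A * V) + 2 * V * (?C * (K2 * r powr (- p) * M))"
            using K V C0 by (intro add_mono mult_left_mono mult_right_mono wb mult_nonneg_nonneg) auto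
          then show "W s * (K1 / (1 - s)) * (?A * V) + 2 * V * (?C * (W s * (K2 * r powr (- p) / s))) \<le> ?G"
            by (simp add: algebra_simps)
        qed
        finally show ?thesis .
      next
        case False
        then have "W s = 0" using wn[of s] by linarith
        then show ?thesis by simp
      qed
    qed
  qed
  moreover have "(\<integral>\<^sup>+s. ?c * (ennreal (W s) * ?P s) \<partial>\<mu>) = ?c * (\<integral>\<^sup>+s. ennreal (W s) * ?P s \<partial>\<mu>)"
    by (rule nn_integral_cmult[OF Pm])
  moreover have "(\<integral>\<^sup>+s. ennreal ?G + ennreal (2 * V * ?D) * (ennreal (W s) * ?Q s) \<partial>\<mu>)
    = ennreal ?G * emeasure \<mu> (space \<mu>) + ennreal (2 * V * ?D) * (\<integral>\<^sup>+s. ennreal (W s) * ?Q s \<partial>\<mu>)"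
    using Qm by (subst nn_integral_add) (simp_all add: nn_integral_cmult)
  ultimately show ?thesis by (simp only:)
qed

end

section \<open>The tail estimate\<close>

text \<open>Passage from \<open>(p-1)\<close>-st powers to the tails themselves; the factor \<open>2\<close> is the price of
  \<open>a + b \<le> 2 max a b\<close> for an exponent that may exceed \<open>1\<close>.\<close>

lemma tail_powr_bound:
  fixes b t D k \<rho> p :: real
  assumes p: "1 < p" and nn: "0 \<le> t" "0 \<le> D" "0 < k" "0 \<le> b" "0 \<le> \<rho>"
    and le: "t \<le> D * (k powr (p - 1) + \<rho> powr p * b)"
  shows "t powr (1 / (p - 1)) \<le> (2 * D) powr (1 / (p - 1)) * (k + \<rho> powr (p / (p - 1)) * b powr (1 / (p - 1)))"
proof -
  let ?q = "1 / (p - 1)"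
  have q: "0 \<le> ?q" using p by simp
  have "t powr ?q \<le> (D * (k powr (p - 1) + \<rho> powr p * b)) powr ?q" using nn le q by (intro powr_mono2) auto
  also have "\<dots> = D powr ?q * (k powr (p - 1) + \<rho> powr p * b) powr ?q" using nn by (subst powr_mult) auto
  also have "\<dots> \<le> D powr ?q * (2 powr ?q * ((k powr (p - 1)) powr ?q + (\<rho> powr p * b) powr ?q))"
    using nn q by (intro mult_left_mono add_powr_le) auto
  also have "(k powr (p - 1)) powr ?q = k" using p nn by (simp add: powr_powr)
  also have "(\<rho> powr p * b) powr ?q = \<rho> powr (p / (p - 1)) * b powr ?q"
    using nn by (simp add: powr_mult powr_powr)
  finally show ?thesis using nn by (simp add: powr_mult mult_ac)
qed

text \<open>All terms carry the common factor \<open>\<omega> r\<^sup>N k\<close>, and \<open>r\<^bsup>-p\<^esup>\<close> cancels against the factor \<open>r\<^sup>p\<close>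
  in the definition of the tail; what remains is free of \<open>r\<close>.\<close>

lemma homogeneity_cancellation:
  fixes c1 \<omega> r k p tp tq \<alpha> m M K1 K2 C J :: real and N :: nat
  assumes p: "1 < p" and pos: "0 < c1" "0 < \<omega>" "0 < r" "0 < k"
    and le: "c1 * k * (\<omega> * (r / 4) ^ N) * tp \<le> J
      + \<omega> * r ^ N * (K1 * M * (64 * k * p\<^sup>2 / r) powr p + 2 * (C * k powr p * (K2 * r powr (- p)) * M)) * m
      + 2 * (\<omega> * r ^ N) * (C * k) * tq"
    and J: "J \<le> \<alpha> * ((32 * k * p\<^sup>2 / r) powr p * (\<omega> * r ^ N))"
  shows "r powr p * tp \<le> 4 ^ N / c1 * ((\<alpha> * (32 * p\<^sup>2) powr p + (K1 * M * (64 * p\<^sup>2) powr p + 2 * (C * K2 * M)) * m) * k powr (p - 1)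
    + 2 * C * (r powr p * tq))"
proof -
  have scale: "(c * k * p\<^sup>2 / r) powr p = (c * p\<^sup>2) powr p * k powr p * r powr (- p)" if "0 \<le> c" for c
  proof -
    have "c * k * p\<^sup>2 / r = c * p\<^sup>2 * k * inverse r" by (simp add: divide_inverse mult_ac)
    also have "\<dots> powr p = (c * p\<^sup>2) powr p * k powr p * inverse r powr p"
      using pos that by (simp add: powr_mult)
    also have "inverse r powr p = r powr (- p)" using pos by (simp add: powr_minus inverse_powr)
    finally show ?thesis .
  qed
  have kp: "k powr p = k * k powr (p - 1)" using pos powr_add[of k 1 "p - 1"] by simp
  have rp: "r powr (- p) * r powr p = 1" using pos by (simp add: powr_add[symmetric])
  let ?U = "\<omega> * r ^ N * k"
  have U: "0 < ?U" using pos by simp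
  let ?L = "\<alpha> * (32 * p\<^sup>2) powr p + (K1 * M * (64 * p\<^sup>2) powr p + 2 * (C * K2 * M)) * m"
  have "c1 * k * (\<omega> * (r / 4) ^ N) * tp = ?U * (c1 / 4 ^ N * tp)" by (simp add: power_divide)
  moreover have "\<alpha> * ((32 * k * p\<^sup>2 / r) powr p * (\<omega> * r ^ N))
      + \<omega> * r ^ N * (K1 * M * (64 * k * p\<^sup>2 / r) powr p + 2 * (C * k powr p * (K2 * r powr (- p)) * M)) * m
      + 2 * (\<omega> * r ^ N) * (C * k) * tq
    = ?U * (?L * k powr (p - 1) * r powr (- p) + 2 * C * tq)"
  proof -
    have "(32 * k * p\<^sup>2 / r) powr p = (32 * p\<^sup>2) powr p * k powr p * r powr (- p)"
      "(64 * k * p\<^sup>2 / r) powr p = (64 * p\<^sup>2) powr p * k powr p * r powr (- p)"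
      by (rule scale, simp)+
    then show ?thesis unfolding kp by (simp only:) (simp add: algebra_simps)
  qed
  ultimately have "?U * (c1 / 4 ^ N * tp) \<le> ?U * (?L * k powr (p - 1) * r powr (- p) + 2 * C * tq)"
    using le J by linarith
  then have "c1 / 4 ^ N * tp \<le> ?L * k powr (p - 1) * r powr (- p) + 2 * C * tq"
    using U by (simp only: mult_le_cancel_left_pos)
  then have "4 ^ N / c1 * r powr p * (c1 / 4 ^ N * tp) \<le> 4 ^ N / c1 * r powr p * (?L * k powr (p - 1) * r powr (- p) + 2 * C * tq)"
    using pos by (intro mult_left_mono) auto
  also have "\<dots> = 4 ^ N / c1 * (?L * k powr (p - 1) * (r powr (- p) * r powr p) + 2 * C * (r powr p * tq))"
    by (simp add: algebra_simps)
  also have "4 ^ N / c1 * r powr p * (c1 / 4 ^ N * tp) = r powr p * tp" using pos by simp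
  finally show ?thesis unfolding rp by simp
qed

text \<open>Truncating a Borel representative turns the almost-everywhere bounds into bounds at every point.\<close>

lemma Borel_representative_between:
  fixes u :: "'a::euclidean_space \<Rightarrow> real"
  assumes um: "u \<in> borel_measurable lebesgue" and k: "0 \<le> k" and rR: "r < R"
    and low: "AE x in lebesgue. x \<in> ball x0 R \<longrightarrow> 0 \<le> u x"
    and up: "AE x in lebesgue. x \<in> ball x0 r \<longrightarrow> u x \<le> k"
  obtains u' where "u' \<in> borel_measurable borel" "AE x in lborel. u x = u' x"
    "\<And>x. x \<in> ball x0 r \<Longrightarrow> 0 \<le> u' x \<and> u' x \<le> k" "\<And>x. x \<in> ball x0 R \<Longrightarrow> 0 \<le> u' x"
proof -
  obtain w where w[measurable]: "w \<in> borel_measurable borel" and ae: "AE x in lborel. u x = w x"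
    using completion_ex_borel_measurable_real[OF um] by auto
  define u' where "u' = (\<lambda>x. if x \<in> ball x0 r then max 0 (min k (w x)) else if x \<in> ball x0 R then max 0 (w x) else w x)"
  have "u' \<in> borel_measurable borel" unfolding u'_def by measurable
  moreover have "AE x in lborel. u x = u' x"
  proof -
    have "AE x in lborel. x \<in> ball x0 R \<longrightarrow> 0 \<le> u x" "AE x in lborel. x \<in> ball x0 r \<longrightarrow> u x \<le> k"
      using low up by (simp_all only: AE_completion_iff)
    with ae show ?thesis
    proof eventually_elim
      case (elim x)
      then show ?case using rR by (auto simp: u'_def)
    qed
  qed
  moreover have "0 \<le> u' x \<and> u' x \<le> k" if "x \<in> ball x0 r" for x using that k by (simp add: u'_def)
  moreover have "0 \<le> u' x" if "x \<in> ball x0 R" for x using that k by (simp add: u'_def)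
  ultimately show ?thesis by (rule that)
qed

lemma Tail_integral_finite_imp_Tail:
  "Tail_integral \<mu> p u x0 r < \<infinity> \<Longrightarrow> Tail \<mu> p u x0 r = ereal (enn2real (Tail_integral \<mu> p u x0 r) powr (1 / (p - 1)))"
  by (simp add: Tail_def)

lemma tail_at_mono:
  assumes "\<And>y. f y \<le> g y"
  shows "tail_at p s f x0 r \<le> tail_at p s g x0 r"
  unfolding tail_at_def using assms
  by (intro nn_integral_mono mult_left_mono ennreal_leI mult_right_mono) auto

lemma tail_at_enlarge_ball:
  assumes "r \<le> R" "\<And>y. y \<in> ball x0 R \<Longrightarrow> f y = 0"
  shows "tail_at p s f x0 r = tail_at p s f x0 R"
  unfolding tail_at_def using assms
  by (intro nn_integral_cong) (auto split: split_indicator)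

text \<open>The weak formulation with the test function \<open>(u - 2 k) \<eta>\<close>: the nonlocal form is the negative of the
  gradient term, which bounds it from above. The tail of \<open>u\<^sub>-\<close> at radius \<open>r\<close> equals that at radius \<open>R\<close> up to
  the powers of the radii, as \<open>u\<^sub>-\<close> vanishes in between.\<close>

lemma tail_estimate_of_upper_bound:
  fixes u :: "'a::euclidean_space \<Rightarrow> real" and \<mu> :: "real measure" and p M E K1 K2 L D R r k :: real
  assumes p: "1 < p" and sets: "sets \<mu> = sets (restrict_space borel {0..1})" and fin: "finite_measure \<mu>"
    and M: "0 < M"
      "\<And>s. 0 < s \<Longrightarrow> s < 1 \<Longrightarrow> C_Nps DIM('a) p s / s \<le> M" "\<And>s. 0 < s \<Longrightarrow> s < 1 \<Longrightarrow> C_Nps DIM('a) p s / (1 - s) \<le> M"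
    and E: "E = real DIM('a) + p"
    and K1: "K1 = near_const DIM('a) p"
    and K2: "K2 = far_const DIM('a) p"
    and L: "L = measure \<mu> {1} * (32 * p\<^sup>2) powr p + (K1 * M * (64 * p\<^sup>2) powr p + 2 * (2 powr E * (2 powr p + 1) * K2 * M)) * measure \<mu> (space \<mu>)"
    and D: "D = 4 ^ DIM('a) / (exp (- 2) * 2 powr (- E) * 2 powr (1 - p)) * (L + 2 * (2 powr E * (2 powr p + 1)))"
    and \<Omega>: "open \<Omega>" and sol: "weak_solution \<mu> p \<Omega> u" and ball: "ball x0 R \<subseteq> \<Omega>"
    and low: "AE x in lebesgue. x \<in> ball x0 R \<longrightarrow> 0 \<le> u x"
    and up: "AE x in lebesgue. x \<in> ball x0 r \<longrightarrow> u x \<le> k"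
    and r: "0 < r" "r < R" "r \<le> 1" and k: "0 < k"
  shows "Tail_integral \<mu> p (\<lambda>x. max (u x) 0) x0 r < \<infinity>" "Tail_integral \<mu> p (\<lambda>x. max (- u x) 0) x0 R < \<infinity>"
    and "enn2real (Tail_integral \<mu> p (\<lambda>x. max (u x) 0) x0 r)
      \<le> D * (k powr (p - 1) + (r / R) powr p * enn2real (Tail_integral \<mu> p (\<lambda>x. max (- u x) 0) x0 R))"
proof -
  interpret finite_measure \<mu> by (rule fin)
  obtain G where grad: "has_weak_gradient \<Omega> u G" and Gloc: "L_p_loc p \<Omega> G"
    using sol by (auto simp: weak_solution_def W1p_loc_def)
  have tsp: "L_p_loc (p - 1) UNIV u" "\<And>x r. 0 < r \<Longrightarrow> Tail \<mu> p u x r < \<infinity>"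
    using sol by (auto simp: weak_solution_def tail_space_def)
  have um: "u \<in> borel_measurable lebesgue" using tsp(1) by (simp add: L_p_loc_def lebesgue_on_UNIV_eq)
  have cb: "cball x0 r \<subseteq> \<Omega>" using ball r by auto
  have Gp: "L_p p (cball x0 r) G" using Gloc cb by (simp add: L_p_loc_def)
  obtain u' where u': "u' \<in> borel_measurable borel" "AE x in lborel. u x = u' x"
    and u'k: "\<And>x. x \<in> ball x0 r \<Longrightarrow> 0 \<le> u' x \<and> u' x \<le> k" and u'R: "\<And>x. x \<in> ball x0 R \<Longrightarrow> 0 \<le> u' x"
    using Borel_representative_between[OF um less_imp_le[OF k] r(2) low up] by blast
  note [measurable] = u'(1)
  let ?N = "DIM('a)" and ?W = "order_weight DIM('a) p"
  let ?T = "\<lambda>f \<rho>. \<integral>\<^sup>+s. ennreal (?W s) * tail_at p s f x0 \<rho> \<partial>\<mu>"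
  let ?f = "\<lambda>y. \<bar>u' y\<bar> powr (p - 1)" and ?P = "\<lambda>y. max (u' y) 0 powr (p - 1)" and ?Q = "\<lambda>y. max (- u' y) 0 powr (p - 1)"
  have TI: "Tail_integral \<mu> p u x0 \<rho> = ennreal (\<rho> powr p) * ?T ?f \<rho>" for \<rho>
    by (rule Tail_integral_eq[OF p sets u'])
  have "AE x in lborel. max (u x) 0 = max (u' x) 0" "AE x in lborel. max (- u x) 0 = max (- u' x) 0"
    using u'(2) by (eventually_elim, simp)+
  from Tail_integral_eq[OF p sets _ this(1)] Tail_integral_eq[OF p sets _ this(2)]
  have TIP: "Tail_integral \<mu> p (\<lambda>x. max (u x) 0) x0 \<rho> = ennreal (\<rho> powr p) * ?T ?P \<rho>"
    and TIQ: "Tail_integral \<mu> p (\<lambda>x. max (- u x) 0) x0 \<rho> = ennreal (\<rho> powr p) * ?T ?Q \<rho>" for \<rho>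
    by simp_all
  have fT: "?T ?f \<rho> < \<infinity>" if "0 < \<rho>" for \<rho>
  proof -
    have "Tail_integral \<mu> p u x0 \<rho> \<noteq> \<infinity>" using tsp(2)[OF that, of x0] by (auto simp: Tail_def split: if_splits)
    then show ?thesis using that unfolding TI by (auto simp: ennreal_mult_eq_top_iff less_top[symmetric])
  qed
  have PT: "?T ?P \<rho> < \<infinity>" and QT: "?T ?Q \<rho> < \<infinity>" if "0 < \<rho>" for \<rho>
  proof -
    have "?T ?P \<rho> \<le> ?T ?f \<rho>" "?T ?Q \<rho> \<le> ?T ?f \<rho>"
      using p by (intro nn_integral_mono mult_left_mono tail_at_mono powr_mono2; simp)+
    then show "?T ?P \<rho> < \<infinity>" "?T ?Q \<rho> < \<infinity>" using fT[OF that] by (auto intro: le_less_trans)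
  qed
  show fin1: "Tail_integral \<mu> p (\<lambda>x. max (u x) 0) x0 r < \<infinity>" and fin2: "Tail_integral \<mu> p (\<lambda>x. max (- u x) 0) x0 R < \<infinity>"
    unfolding TIP TIQ using PT[of r] QT[of R] r by (simp_all add: ennreal_mult_less_top)
  obtain tp where tp: "?T ?P r = ennreal tp" "0 \<le> tp"
    using PT[OF r(1)] by (cases "?T ?P r" rule: ennreal_cases) auto
  obtain tq where tq: "?T ?Q r = ennreal tq" "0 \<le> tq"
    using QT[OF r(1)] by (cases "?T ?Q r" rule: ennreal_cases) auto
  have TQ: "?T ?Q R = ?T ?Q r"
  proof -
    have "tail_at p s ?Q x0 r = tail_at p s ?Q x0 R" for s
      using r u'R by (intro tail_at_enlarge_ball) (auto simp: max_def)
    then show ?thesis by simp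
  qed
  obtain Eu where Eu: "Eu < \<infinity>" "\<And>h. (\<integral>\<^sup>+x. indicator (ball x0 r) x * indicator (ball x0 r) (x + h) * ennreal (\<bar>u' (x + h) - u' x\<bar> powr p) \<partial>lborel)
    \<le> ennreal (norm h powr p) * Eu"
    using weak_gradient_difference_Lp[OF \<Omega> cb grad p Gp u'] by blast
  define V where "V = unit_ball_vol (real ?N) * r ^ ?N"
  have Vb: "0 < unit_ball_vol (real ?N)" by simp
  have V: "emeasure lborel (ball x0 r) = ennreal V" "0 \<le> V"
    using r Vb by (simp_all add: V_def emeasure_ball)
  have uk: "AE x in lebesgue. x \<in> ball x0 r \<longrightarrow> 0 \<le> u x \<and> u x \<le> k"
    using low up by eventually_elim (use r in auto)
  let ?v = "\<lambda>x. (u x - 2 * k) * cutoff 1 x0 (r / 2) x" and ?v' = "\<lambda>x. (u' x - 2 * k) * cutoff 1 x0 (r / 2) x"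
  let ?H = "\<lambda>x. cutoff 1 x0 (r / 2) x *\<^sub>R G x + (u x - 2 * k) *\<^sub>R cutoff_gradient x0 (r / 2) x"
  let ?loc = "LINT x|lebesgue_on \<Omega>. norm (G x) powr (p - 2) * (G x \<bullet> ?H x)"
  have eq: "nonlocal_form \<mu> p u ?v + measure \<mu> {1} * ?loc = 0"
  proof -
    have all: "nonlocal_form \<mu> p u v + measure \<mu> {1} * (LINT x|lebesgue_on \<Omega>. norm (G x) powr (p - 2) * (G x \<bullet> H x)) = 0"
      if "open \<Omega>'" "connected \<Omega>'" "bounded \<Omega>'" "closure \<Omega>' \<subseteq> \<Omega>" "v \<in> W1p_0 p \<Omega>'" "has_weak_gradient UNIV v H" for \<Omega>' v H
      using sol that grad unfolding weak_solution_def by blast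
    show ?thesis
      by (rule all[of "ball x0 (r / 2)"])
         (use cb r in \<open>auto intro: cutoff_product_in_W1p_0[OF \<Omega> cb grad p r(1) k Gp um uk] cutoff_product_has_weak_gradient[OF \<Omega> cb grad p r(1) k Gp um uk]\<close>)
  qed
  have test: "test_function UNIV (cutoff 1 x0 (r / 2))" using r by (intro test_function_cutoff) auto
  note [measurable] = borel_measurable_test_function[OF test]
  let ?J = "LINT s|\<mu>. ?W s * (LINT z|lborel. pair_form p (real DIM('a) + s * p) u' ?v' (fst z) (snd z))"
  have J: "nonlocal_form \<mu> p u ?v = ?J"
  proof (rule nonlocal_form_eq[OF sets u'])
    show "?v' \<in> borel_measurable borel" by measurable
    show "AE x in lborel. ?v x = ?v' x" using u'(2) by eventually_elim simp
  qed
  have Vm: "measure lborel (ball x0 r) = V" using V by (simp add: measure_def)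
  have "?J = - (measure \<mu> {1} * ?loc)" using eq J by linarith
  also have "\<dots> \<le> measure \<mu> {1} * ((32 * k * p\<^sup>2 / r) powr p * V)"
    using mult_left_mono[OF local_form_ge[OF \<Omega> cb grad p r(1) k Gp um uk], of "measure \<mu> {1}"] Vm by simp
  finally have Jle: "?J \<le> measure \<mu> {1} * ((32 * k * p\<^sup>2 / r) powr p * V)" .
  let ?c1 = "exp (- 2) * 2 powr (- E) * 2 powr (1 - p)" and ?C = "2 powr E * (2 powr p + 1)"
  let ?Wc = "V * (K1 * M * (64 * k * p\<^sup>2 / r) powr p + 2 * (?C * k powr p * (K2 * r powr (- p)) * M))"
  have K: "0 \<le> K1" "0 \<le> K2" using p by (simp_all add: K1 K2 near_const_nonneg far_const_nonneg)
  have Wc: "0 \<le> ?Wc" using V K M(1) by (intro mult_nonneg_nonneg add_nonneg_nonneg) auto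
  have m: "emeasure \<mu> (space \<mu>) = ennreal (measure \<mu> (space \<mu>))" by (rule emeasure_eq_measure)
  have V4: "emeasure lborel (ball x0 (r / 4)) = ennreal (unit_ball_vol (real ?N) * (r / 4) ^ ?N)"
    using r by (intro emeasure_ball) simp
  have key: "ennreal (?c1 * k) * ennreal (unit_ball_vol (real ?N) * (r / 4) ^ ?N) * ennreal tp + ennreal (- ?J)
    \<le> ennreal ?J + (ennreal ?Wc * ennreal (measure \<mu> (space \<mu>)) + ennreal (2 * V * (?C * k)) * ennreal tq)"
    using weighted_tail_estimate[OF E refl K1 K2 p r(1,3) k u'(1) u'k sets fin M Eu fT[OF r(1)] V]
    unfolding tp tq V4 m .
  have "?c1 * k * (unit_ball_vol (real ?N) * (r / 4) ^ ?N) * tp \<le> ?J + (?Wc * measure \<mu> (space \<mu>) + 2 * V * (?C * k) * tq)"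
  proof -
    have conv: "a * b * t \<le> j + (w * n + d * q)"
      if "ennreal a * ennreal b * ennreal t + ennreal (- j) \<le> ennreal j + (ennreal w * ennreal n + ennreal d * ennreal q)"
        "0 \<le> a" "0 \<le> b" "0 \<le> t" "0 \<le> w" "0 \<le> n" "0 \<le> d" "0 \<le> q" for a b t j w n d q :: real
    proof (cases "0 \<le> j")
      case True
      then show ?thesis using that
        by (simp add: ennreal_neg ennreal_mult[symmetric] ennreal_plus[symmetric] del: ennreal_plus)
    next
      case False
      then have "ennreal (a * b * t + - j) \<le> ennreal (w * n + d * q)" using that
        by (simp add: ennreal_neg ennreal_mult[symmetric] ennreal_plus[symmetric] del: ennreal_plus)
      then have "a * b * t + - j \<le> w * n + d * q" using that by (subst (asm) ennreal_le_iff) auto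
      then show ?thesis by simp
    qed
    show ?thesis using key by (rule conv) (use k Vb r tp tq Wc V in auto)
  qed
  then have "?c1 * k * (unit_ball_vol (real ?N) * (r / 4) ^ ?N) * tp \<le> ?J
      + unit_ball_vol (real ?N) * r ^ ?N * (K1 * M * (64 * k * p\<^sup>2 / r) powr p + 2 * (?C * k powr p * (K2 * r powr (- p)) * M)) * measure \<mu> (space \<mu>)
      + 2 * (unit_ball_vol (real ?N) * r ^ ?N) * (?C * k) * tq" unfolding V_def by simp
  from homogeneity_cancellation[OF p _ Vb r(1) k this Jle[unfolded V_def]]
  have "r powr p * tp \<le> 4 ^ ?N / ?c1 * (L * k powr (p - 1) + 2 * ?C * (r powr p * tq))"
    unfolding L by simp
  also have "\<dots> \<le> 4 ^ ?N / ?c1 * ((L + 2 * ?C) * (k powr (p - 1) + r powr p * tq))"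
  proof (intro mult_left_mono)
    have "0 \<le> L" unfolding L using K M(1) by (intro add_nonneg_nonneg mult_nonneg_nonneg) auto
    then have "0 \<le> L * (r powr p * tq) + 2 * ?C * k powr (p - 1)" using tq by simp
    then show "L * k powr (p - 1) + 2 * ?C * (r powr p * tq) \<le> (L + 2 * ?C) * (k powr (p - 1) + r powr p * tq)"
      by (simp add: algebra_simps)
  qed simp
  also have "\<dots> = D * (k powr (p - 1) + r powr p * tq)" unfolding D by simp
  also have "r powr p * tq = (r / R) powr p * (R powr p * tq)" using r by (simp add: powr_divide)
  finally show "enn2real (Tail_integral \<mu> p (\<lambda>x. max (u x) 0) x0 r)
      \<le> D * (k powr (p - 1) + (r / R) powr p * enn2real (Tail_integral \<mu> p (\<lambda>x. max (- u x) 0) x0 R))"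
    unfolding TIP TIQ TQ tp tq using tp tq by (simp add: enn2real_mult)
qed

theorem lemma5p5:
  fixes p :: real and \<mu> :: "real measure"
  assumes "1 < p"
    and "sets \<mu> = sets (restrict_space borel {0..1})"
    and "finite_measure \<mu>"
    and "measure \<mu> {0} = 0"
    and "measure \<mu> {1} > 0"
    and "measure \<mu> {0<..<1} > 0"
  shows "\<exists>C>0. \<forall>(\<Omega> :: 'a::euclidean_space set) (u :: 'a \<Rightarrow> real) x0 R r.
    open \<Omega> \<longrightarrow> connected \<Omega> \<longrightarrow> bounded \<Omega> \<longrightarrow>
    weak_solution \<mu> p \<Omega> u \<longrightarrow>
    x0 \<in> \<Omega> \<longrightarrow> R > 0 \<longrightarrow> ball x0 R \<subseteq> \<Omega> \<longrightarrow> (AE x in lebesgue_on (ball x0 R). 0 \<le> u x) \<longrightarrow>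
    0 < r \<longrightarrow> r < R \<longrightarrow> r \<le> 1 \<longrightarrow>
    Tail \<mu> p (\<lambda>x. max (u x) 0) x0 r
      \<le> ereal C * esssup (lebesgue_on (ball x0 r)) (\<lambda>x. ereal (u x))
        + ereal (C * (r / R) powr (p / (p - 1))) * Tail \<mu> p (\<lambda>x. max (- u x) 0) x0 R"
proof -
  note p = assms(1) and sets = assms(2) and fin = assms(3)
  obtain M where M: "0 < M"
      "\<And>s. 0 < s \<Longrightarrow> s < 1 \<Longrightarrow> C_Nps DIM('a) p s / s \<le> M" "\<And>s. 0 < s \<Longrightarrow> s < 1 \<Longrightarrow> C_Nps DIM('a) p s / (1 - s) \<le> M"
    using C_Nps_bounded[OF DIM_positive p] by blast
  define E where "E = real DIM('a) + p"
  define K1 where "K1 = near_const DIM('a) p"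
  define K2 where "K2 = far_const DIM('a) p"
  define L where "L = measure \<mu> {1} * (32 * p\<^sup>2) powr p + (K1 * M * (64 * p\<^sup>2) powr p + 2 * (2 powr E * (2 powr p + 1) * K2 * M)) * measure \<mu> (space \<mu>)"
  define D where "D = 4 ^ DIM('a) / (exp (- 2) * 2 powr (- E) * 2 powr (1 - p)) * (L + 2 * (2 powr E * (2 powr p + 1)))"
  have K: "0 \<le> K1" "0 \<le> K2" using p by (simp_all add: K1_def K2_def near_const_nonneg far_const_nonneg)
  have "0 \<le> L" unfolding L_def using K M(1) by (intro add_nonneg_nonneg mult_nonneg_nonneg) auto
  then have D: "0 < D" unfolding D_def by (intro mult_pos_pos divide_pos_pos add_nonneg_pos) (auto intro: add_pos_pos)
  let ?C = "(2 * D) powr (1 / (p - 1))"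
  have C: "0 < ?C" using D by simp
  show ?thesis
  proof (intro exI[of _ ?C] conjI C allI impI)
    fix \<Omega> :: "'a set" and u :: "'a \<Rightarrow> real" and x0 R r
    assume \<Omega>: "open \<Omega>" and sol: "weak_solution \<mu> p \<Omega> u" and ball: "ball x0 R \<subseteq> \<Omega>"
      and low: "AE x in lebesgue_on (ball x0 R). 0 \<le> u x" and r: "0 < r" "r < R" "r \<le> 1"
    let ?S = "esssup (lebesgue_on (ball x0 r)) (\<lambda>x. ereal (u x))"
    let ?P = "Tail \<mu> p (\<lambda>x. max (u x) 0) x0 r" and ?Q = "Tail \<mu> p (\<lambda>x. max (- u x) 0) x0 R"
    let ?q = "ereal (?C * (r / R) powr (p / (p - 1))) * ?Q"
    have low': "AE x in lebesgue. x \<in> ball x0 R \<longrightarrow> 0 \<le> u x"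
      using low by (simp add: AE_restrict_space_iff)
    have "AE x in lebesgue_on (ball x0 r). ereal (u x) \<le> ?S" by (rule esssup_AE)
    then have S: "AE x in lebesgue. x \<in> ball x0 r \<longrightarrow> ereal (u x) \<le> ?S"
      by (simp add: AE_restrict_space_iff)
    have S0: "0 \<le> ?S"
    proof (rule ccontr)
      assume neg: "\<not> 0 \<le> ?S"
      have "AE x in lebesgue. x \<notin> ball x0 r"
        using S low'
      proof eventually_elim
        case (elim x)
        show ?case
        proof
          assume x: "x \<in> ball x0 r"
          then have "0 \<le> ereal (u x)" using elim(2) r by auto
          then have "0 \<le> ?S" using elim(1) x by (metis order_trans)
          then show False using neg by simp
        qed
      qed
      then have "AE x in lborel. x \<notin> ball x0 r" by (simp only: AE_completion_iff)
      then have "ball x0 r \<in> null_sets lborel" by (subst AE_iff_null_sets) auto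
      then have "emeasure lborel (ball x0 r) = 0" by (rule null_setsD1)
      moreover have "emeasure lborel (ball x0 r) > 0"
        using r by (simp add: emeasure_ball ennreal_zero_less_mult_iff)
      ultimately show False by simp
    qed
    show "?P \<le> ereal ?C * ?S + ?q"
    proof (cases ?S)
      case PInf
      then show ?thesis using C by simp
    next
      case MInf
      then show ?thesis using S0 by simp
    next
      case (real \<sigma>)
      then have \<sigma>: "0 \<le> \<sigma>" using S0 by simp
      let ?tp = "enn2real (Tail_integral \<mu> p (\<lambda>x. max (u x) 0) x0 r)"
      let ?tq = "enn2real (Tail_integral \<mu> p (\<lambda>x. max (- u x) 0) x0 R)"
      have est: "Tail_integral \<mu> p (\<lambda>x. max (u x) 0) x0 r < \<infinity>" "Tail_integral \<mu> p (\<lambda>x. max (- u x) 0) x0 R < \<infinity>"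
        "?tp powr (1 / (p - 1)) \<le> ?C * (k + (r / R) powr (p / (p - 1)) * ?tq powr (1 / (p - 1)))"
        if k: "\<sigma> < k" for k
      proof -
        have up: "AE x in lebesgue. x \<in> ball x0 r \<longrightarrow> u x \<le> k"
          using S by eventually_elim (use real k in auto)
        have k0: "0 < k" using k \<sigma> by linarith
        note e = tail_estimate_of_upper_bound[OF p sets fin M E_def K1_def K2_def L_def D_def \<Omega> sol ball low' up r k0]
        show "Tail_integral \<mu> p (\<lambda>x. max (u x) 0) x0 r < \<infinity>" "Tail_integral \<mu> p (\<lambda>x. max (- u x) 0) x0 R < \<infinity>"
          by (rule e(1); assumption) (rule e(2); assumption)
        show "?tp powr (1 / (p - 1)) \<le> ?C * (k + (r / R) powr (p / (p - 1)) * ?tq powr (1 / (p - 1)))"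
          using D k0 r by (intro tail_powr_bound[OF p _ _ _ _ _ e(3)]) auto
      qed
      \<comment> \<open>\<open>k\<close> has to be positive, but the essential supremum may be \<open>0\<close>, so \<open>k\<close> decreases to it\<close>
      have "?tp powr (1 / (p - 1)) \<le> ?C * (\<sigma> + (r / R) powr (p / (p - 1)) * ?tq powr (1 / (p - 1)))"
      proof (rule field_le_epsilon)
        fix \<epsilon> :: real
        assume "0 < \<epsilon>"
        then have "?tp powr (1 / (p - 1)) \<le> ?C * (\<sigma> + \<epsilon> / ?C + (r / R) powr (p / (p - 1)) * ?tq powr (1 / (p - 1)))"
          using C by (intro est(3)) simp
        also have "\<dots> = ?C * (\<sigma> + (r / R) powr (p / (p - 1)) * ?tq powr (1 / (p - 1))) + \<epsilon>"
          using C by (simp add: distrib_left)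
        finally show "?tp powr (1 / (p - 1)) \<le> ?C * (\<sigma> + (r / R) powr (p / (p - 1)) * ?tq powr (1 / (p - 1))) + \<epsilon>" .
      qed
      moreover have "?P = ereal (?tp powr (1 / (p - 1)))" "?Q = ereal (?tq powr (1 / (p - 1)))"
        using est(1,2)[of "\<sigma> + 1"] by (simp_all add: Tail_integral_finite_imp_Tail)
      ultimately show ?thesis using real by (simp add: algebra_simps)
    qed
  qed
qed

end
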